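(* Assume that (OLC) is feasible, that for every $i\in\mathcal N$ the function $c_i:\mathbb R\to\mathbb R$ is twice differentiable with $u\le c_i''(s)\le\ell$ for all $s\in\mathbb R$, where $0<u\le\ell$, and that the following conditions are met: (i) Infinitely large step sizes $\epsilon_{d_i}$ are used in the $d_i$-equation of (ALC), which is then reduced to the algebraic equation $$-c_i'(d_i)+\eta_i\omega_i+\frac{\epsilon_{\mu_i}}{K_i}r_i-\gamma_i^++\gamma_i^-=0,\qquad i\in\mathcal N .$$ (ii) An inaccurate coefficient $\tilde D_i=D_i+\delta a_i$ is used instead of $D_i$ in the $r_i$-equation of (ALC), and the inaccuracy $\delta a_i$ satisfies $$\delta a_i\in 2\Big(\underline d'-\sqrt{\underline d'^2+\underline d'D_{\min}},\ \ \underline d'+\sqrt{\underline d'^2+\underline d'D_{\min}}\Big),$$ where $\underline d':=1/\ell$ and $D_{\min}:=\min_{i\in\mathcal N}D_i$. (iii) Every node $i\in\mathcal N$ has adequate load control capacity such that its control action $d_i(t)$ never hits the limit of $[\underline d_i,\overline d_i]$ at any time $t$. Then the closed-loop system (NET) and (ALC), modified according to (i) and (ii), globally asymptotically converges to a point $(d^*,\omega^*,P^*,\psi^*,\gamma^*,r^*,\sigma^* )$, where $(d^*,\omega^*,P^*,\psi^* )$ is an optimal solution of (R-OLC).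
   Context: **Network.** $G(\mathcal N,\mathcal E)$ is a finite connected directed graph of buses and lines, with arbitrary line orientations (if $ij\in\mathcal E$ then $ji\notin\mathcal E$). The buses are divided into generator buses and load buses, $\mathcal N=\mathcal G\cup\mathcal L$ (disjoint). The buses are grouped into control areas (a partition of $\mathcal N$), and $\mathcal E_{in}\subset\mathcal E$ is the set of lines joining two buses of the same control area. Constants: $B_{ij}>0$ ($ij\in\mathcal E$), $D_i>0$ ($i\in\mathcal N$), $M_i>0$ ($i\in\mathcal G$), a fixed power injection $P^{in}=(P_i^{in})_{i\in\mathcal N}$, load limits $\underline d_i,\overline d_i$ and line limits $\underline P_{ij},\overline P_{ij}$. **(OLC)** Minimize $\sum_{i\in\mathcal N}c_i(d_i)$ over $d,\theta\in\mathbb R^{\mathcal N}$ subject to $d_i=P_i^{in}-\sum_{j:ij\in\mathcal E_{in}}B_{ij}(\theta_i-\theta_j)+\sum_{k:ki\in\mathcal E_{in}}B_{ki}(\theta_k-\theta_i)$ and $\underline d_i\le d_i\le\overline d_i$ for $i\in\mathcal N$; $\underline P_{ij}\le B_{ij}(\theta_i-\theta_j)\le\overline P_{ij}$ for $ij\in\mathcal E_{in}$. **(R-OLC)** Minimize $\sum_{i\in\mathcal N}c_i(d_i)+\sum_{i\in\mathcal N}\frac12D_i\omega_i^2$ over $d,\omega,\psi\in\mathbb R^{\mathcal N}$, $P\in\mathbb R^{\mathcal E}$ subject to $d_i=P_i^{in}-D_i\omega_i-\sum_{j:ij\in\mathcal E}P_{ij}+\sum_{k:ki\in\mathcal E}P_{ki}$,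 $\ \underline d_i\le d_i\le\overline d_i$, $\ d_i=P_i^{in}-\sum_{j:ij\in\mathcal E_{in}}B_{ij}(\psi_i-\psi_j)+\sum_{k:ki\in\mathcal E_{in}}B_{ki}(\psi_k-\psi_i)$ for $i\in\mathcal N$; $\underline P_{ij}\le B_{ij}(\psi_i-\psi_j)\le\overline P_{ij}$ for $ij\in\mathcal E_{in}$. **(NET)** $M_i\dot\omega_i=-\big(D_i\omega_i+d_i-P_i^{in}+\sum_{j:ij\in\mathcal E}P_{ij}-\sum_{k:ki\in\mathcal E}P_{ki}\big)$ for $i\in\mathcal G$; $0=D_i\omega_i+d_i-P_i^{in}+\sum_{j:ij\in\mathcal E}P_{ij}-\sum_{k:ki\in\mathcal E}P_{ki}$ for $i\in\mathcal L$; $\dot P_{ij}=B_{ij}(\omega_i-\omega_j)$ for $ij\in\mathcal E$. **(ALC)** The notation $[x]^+_y$ means $x$ if $x>0$ or $y>0$, and $0$ otherwise. The quantities $\epsilon_{\bullet}>0$ (step sizes) and $K_i>0$ are constants, with $\epsilon_{\omega_i}=1/M_i$ for $i\in\mathcal G$. Set $\eta_i=(\epsilon_{\omega_i}+\epsilon_{\mu_i})/\epsilon_{\omega_i}$ for $i\in\mathcal G$, $\eta_i=1$ for $i\in\mathcal L$, and let $\mu_i$ abbreviate $\frac{\epsilon_{\mu_i}}{\epsilon_{\omega_i}}\omega_i+\frac{\epsilon_{\mu_i}}{K_i}r_i$ for $i\in\mathcal G$ and $\frac{\epsilon_{\mu_i}}{K_i}r_i$ for $i\in\mathcal L$. For $i\in\mathcal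 N$: $\dot d_i=\epsilon_{d_i}\big(-c_i'(d_i)+\eta_i\omega_i+\frac{\epsilon_{\mu_i}}{K_i}r_i-\gamma_i^++\gamma_i^-\big)$; $\dot\psi_i=\epsilon_{\psi_i}\big[\sum_{j:ij\in\mathcal E_{in}}(\mu_i-\mu_j-\sigma_{ij}^++\sigma_{ij}^-)B_{ij}+\sum_{k:ki\in\mathcal E_{in}}(\mu_i-\mu_k+\sigma_{ki}^+-\sigma_{ki}^-)B_{ki}\big]$; $\dot\gamma_i^+=\epsilon_{\gamma_i^+}[d_i-\overline d_i]^+_{\gamma_i^+}$, $\ \dot\gamma_i^-=\epsilon_{\gamma_i^-}[-d_i+\underline d_i]^+_{\gamma_i^-}$; $\dot r_i=K_i\big[D_i\omega_i+\sum_{j:ij\in\mathcal E}P_{ij}-\sum_{k:ki\in\mathcal E}P_{ki}-\sum_{j:ij\in\mathcal E_{in}}B_{ij}(\psi_i-\psi_j)+\sum_{k:ki\in\mathcal E_{in}}B_{ki}(\psi_k-\psi_i)\big]$; and for $ij\in\mathcal E_{in}$: $\dot\sigma_{ij}^+=\epsilon_{\sigma_{ij}^+}[B_{ij}(\psi_i-\psi_j)-\overline P_{ij}]^+_{\sigma_{ij}^+}$, $\ \dot\sigma_{ij}^-=\epsilon_{\sigma_{ij}^-}[-B_{ij}(\psi_i-\psi_j)+\underline P_{ij}]^+_{\sigma_{ij}^-}$. The variables $\gamma_i^\pm,\sigma_{ij}^\pm$ are nonnegative multipliers (the projection keeps them nonnegative). Notation: $\gamma=(\gamma_i^+,\gamma_i^-)_{i\in\mathcal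 N}$, $\sigma=(\sigma_{ij}^+,\sigma_{ij}^-)_{ij\in\mathcal E_{in}}$, $r=(r_i)_{i\in\mathcal N}$. Solutions are understood in the usual Carathéodory sense. In condition (ii), $2(a,b)$ denotes the open interval $(2a,2b)$. "Never hits the limit" in (iii) means $\underline d_i<d_i(t)<\overline d_i$ for all $t\ge0$. "Globally asymptotically converges to a point" means that every solution converges as $t\to\infty$ to some point of the stated kind, possibly depending on the initial state. *)

theory Defs
  imports
    "HOL-Analysis.Analysis"
    "HOL-Library.Disjoint_Sets"
    "Graph_Theory.Digraph_Component"
begin

section \<open>Network data\<close>

text \<open>
  Bus data are functions on \<open>'n\<close> and line data are functions on \<open>'n \<times> 'n\<close>; only their values
  on the buses and on the lines of the grid are ever used.
\<close>

record 'n network =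
  grid :: "'n pair_pre_digraph"
  gens :: "'n set"
  loads :: "'n set"
  areas :: "'n set set"
  suscept :: "'n \<times> 'n \<Rightarrow> real"
  damping :: "'n \<Rightarrow> real"
  inertia :: "'n \<Rightarrow> real"
  injection :: "'n \<Rightarrow> real"
  load_min :: "'n \<Rightarrow> real"
  load_max :: "'n \<Rightarrow> real"
  flow_min :: "'n \<times> 'n \<Rightarrow> real"
  flow_max :: "'n \<times> 'n \<Rightarrow> real"

abbreviation buses :: "'n network \<Rightarrow> 'n set" where
  "buses net \<equiv> pverts (grid net)"

abbreviation lines :: "'n network \<Rightarrow> ('n \<times> 'n) set" where
  "lines net \<equiv> parcs (grid net)"

definition inner_lines :: "'n network \<Rightarrow> ('n \<times> 'n) set" where
  "inner_lines net = {(i, j) \<in> lines net. \<exists>A \<in> areas net. i \<in> A \<and> j \<in> A}"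

text \<open>
  Graph connectivity disregards the orientation of the arcs and includes that there is at
  least one bus.
\<close>

locale power_network =
  fixes net :: "'n network"
  assumes finite_grid: "pair_fin_digraph (grid net)"
    and connected_grid: "Digraph_Component.connected (with_proj (grid net))"
    and oriented: "\<And>i j. (i, j) \<in> lines net \<Longrightarrow> (j, i) \<notin> lines net"
    and gens_loads: "buses net = gens net \<union> loads net" "gens net \<inter> loads net = {}"
    and areas_partition: "partition_on (buses net) (areas net)"
    and suscept_pos: "\<And>i j. (i, j) \<in> lines net \<Longrightarrow> suscept net (i, j) > 0"
    and damping_pos: "\<And>i. i \<in> buses net \<Longrightarrow> damping net i > 0"
    and inertia_pos: "\<And>i. i \<in> gens net \<Longrightarrow> inertia net i > 0"

definition net_outflow :: "('n \<times> 'n) set \<Rightarrow> ('n \<times> 'n \<Rightarrow> real) \<Rightarrow> 'n \<Rightarrow> real" where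
  "net_outflow A F i = (\<Sum>j | (i, j) \<in> A. F (i, j)) - (\<Sum>k | (k, i) \<in> A. F (k, i))"

definition angle_flow :: "'n network \<Rightarrow> ('n \<Rightarrow> real) \<Rightarrow> 'n \<times> 'n \<Rightarrow> real" where
  "angle_flow net \<theta> = (\<lambda>(i, j). suscept net (i, j) * (\<theta> i - \<theta> j))"

section \<open>Optimal load control\<close>

definition OLC_feasible :: "'n network \<Rightarrow> ('n \<Rightarrow> real) \<Rightarrow> ('n \<Rightarrow> real) \<Rightarrow> bool" where
  "OLC_feasible net d \<theta> \<longleftrightarrow>
    (\<forall>i \<in> buses net.
       d i = injection net i - net_outflow (inner_lines net) (angle_flow net \<theta>) i \<and>
       load_min net i \<le> d i \<and> d i \<le> load_max net i) \<and>
    (\<forall>e \<in> inner_lines net.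
       flow_min net e \<le> angle_flow net \<theta> e \<and> angle_flow net \<theta> e \<le> flow_max net e)"

definition ROLC_feasible ::
  "'n network \<Rightarrow> ('n \<Rightarrow> real) \<Rightarrow> ('n \<Rightarrow> real) \<Rightarrow> ('n \<times> 'n \<Rightarrow> real) \<Rightarrow> ('n \<Rightarrow> real) \<Rightarrow> bool" where
  "ROLC_feasible net d \<omega> P \<psi> \<longleftrightarrow>
    (\<forall>i \<in> buses net.
       d i = injection net i - damping net i * \<omega> i - net_outflow (lines net) P i \<and>
       load_min net i \<le> d i \<and> d i \<le> load_max net i \<and>
       d i = injection net i - net_outflow (inner_lines net) (angle_flow net \<psi>) i) \<and>
    (\<forall>e \<in> inner_lines net.
       flow_min net e \<le> angle_flow net \<psi> e \<and> angle_flow net \<psi> e \<le> flow_max net e)"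

definition ROLC_cost ::
  "'n network \<Rightarrow> ('n \<Rightarrow> real \<Rightarrow> real) \<Rightarrow> ('n \<Rightarrow> real) \<Rightarrow> ('n \<Rightarrow> real) \<Rightarrow> real" where
  "ROLC_cost net c d \<omega> =
    (\<Sum>i \<in> buses net. c i (d i)) + (\<Sum>i \<in> buses net. 1 / 2 * damping net i * (\<omega> i)\<^sup>2)"

definition ROLC_optimal ::
  "'n network \<Rightarrow> ('n \<Rightarrow> real \<Rightarrow> real) \<Rightarrow>
    ('n \<Rightarrow> real) \<Rightarrow> ('n \<Rightarrow> real) \<Rightarrow> ('n \<times> 'n \<Rightarrow> real) \<Rightarrow> ('n \<Rightarrow> real) \<Rightarrow> bool" where
  "ROLC_optimal net c d \<omega> P \<psi> \<longleftrightarrow>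
    is_arg_min (\<lambda>(d, \<omega>, P, \<psi>). ROLC_cost net c d \<omega>)
      (\<lambda>(d, \<omega>, P, \<psi>). ROLC_feasible net d \<omega> P \<psi>) (d, \<omega>, P, \<psi>)"

section \<open>Caratheodory solutions\<close>

text \<open>A finite family of non-overlapping compact intervals \<open>k = [Inf k, Sup k]\<close> is a division
  of its union.\<close>

definition abs_continuous_on :: "real \<Rightarrow> real \<Rightarrow> (real \<Rightarrow> real) \<Rightarrow> bool" where
  "abs_continuous_on a b y \<longleftrightarrow>
    (\<forall>\<epsilon>>0. \<exists>\<delta>>0. \<forall>D. D division_of \<Union>D \<longrightarrow> \<Union>D \<subseteq> {a..b} \<longrightarrow> (\<Sum>k\<in>D. Sup k - Inf k) < \<delta> \<longrightarrow>
       (\<Sum>k\<in>D. \<bar>y (Sup k) - y (Inf k)\<bar>) < \<epsilon>)"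

definition caratheodory_rate :: "(real \<Rightarrow> real) \<Rightarrow> (real \<Rightarrow> real) \<Rightarrow> bool" where
  "caratheodory_rate y f \<longleftrightarrow>
    (\<forall>T\<ge>0. abs_continuous_on 0 T y) \<and>
    (AE t in lborel. t \<ge> 0 \<longrightarrow> (y has_real_derivative f t) (at t within {0..}))"

section \<open>Closed loop\<close>

record 'n controller =
  eps_mu :: "'n \<Rightarrow> real"
  eps_psi :: "'n \<Rightarrow> real"
  eps_gamma_up :: "'n \<Rightarrow> real"
  eps_gamma_lo :: "'n \<Rightarrow> real"
  gain :: "'n \<Rightarrow> real"
  eps_sigma_up :: "'n \<times> 'n \<Rightarrow> real"
  eps_sigma_lo :: "'n \<times> 'n \<Rightarrow> real"

definition positive_controller :: "'n network \<Rightarrow> 'n controller \<Rightarrow> bool" where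
  "positive_controller net ctrl \<longleftrightarrow>
    (\<forall>i \<in> buses net. eps_mu ctrl i > 0 \<and> eps_psi ctrl i > 0 \<and>
       eps_gamma_up ctrl i > 0 \<and> eps_gamma_lo ctrl i > 0 \<and> gain ctrl i > 0) \<and>
    (\<forall>e \<in> inner_lines net. eps_sigma_up ctrl e > 0 \<and> eps_sigma_lo ctrl e > 0)"

record 'n state =
  load :: "'n \<Rightarrow> real"
  freq :: "'n \<Rightarrow> real"
  flow :: "'n \<times> 'n \<Rightarrow> real"
  psi :: "'n \<Rightarrow> real"
  gamma_up :: "'n \<Rightarrow> real"
  gamma_lo :: "'n \<Rightarrow> real"
  rvar :: "'n \<Rightarrow> real"
  sigma_up :: "'n \<times> 'n \<Rightarrow> real"
  sigma_lo :: "'n \<times> 'n \<Rightarrow> real"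

definition nonneg_multipliers :: "'n network \<Rightarrow> 'n state \<Rightarrow> bool" where
  "nonneg_multipliers net s \<longleftrightarrow>
    (\<forall>i \<in> buses net. gamma_up s i \<ge> 0 \<and> gamma_lo s i \<ge> 0) \<and>
    (\<forall>e \<in> inner_lines net. sigma_up s e \<ge> 0 \<and> sigma_lo s e \<ge> 0)"

text \<open>The projected rate \<open>[x]\<^sup>+\<^sub>y\<close>.\<close>

definition proj_rate :: "real \<Rightarrow> real \<Rightarrow> real" where
  "proj_rate x y = (if x > 0 \<or> y > 0 then x else 0)"

definition eps_omega :: "'n network \<Rightarrow> 'n \<Rightarrow> real" where
  "eps_omega net i = 1 / inertia net i"

definition eta :: "'n network \<Rightarrow> 'n controller \<Rightarrow> 'n \<Rightarrow> real" where
  "eta net ctrl i =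
    (if i \<in> gens net then (eps_omega net i + eps_mu ctrl i) / eps_omega net i else 1)"

definition mu :: "'n network \<Rightarrow> 'n controller \<Rightarrow> 'n state \<Rightarrow> 'n \<Rightarrow> real" where
  "mu net ctrl s i =
    (if i \<in> gens net
     then eps_mu ctrl i / eps_omega net i * freq s i + eps_mu ctrl i / gain ctrl i * rvar s i
     else eps_mu ctrl i / gain ctrl i * rvar s i)"

definition power_excess :: "'n network \<Rightarrow> 'n state \<Rightarrow> 'n \<Rightarrow> real" where
  "power_excess net s i =
    damping net i * freq s i + load s i - injection net i + net_outflow (lines net) (flow s) i"

definition NET_solution :: "'n network \<Rightarrow> (real \<Rightarrow> 'n state) \<Rightarrow> bool" where
  "NET_solution net x \<longleftrightarrow>
    (\<forall>i \<in> gens net. caratheodory_rate (\<lambda>t. freq (x t) i)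
       (\<lambda>t. - power_excess net (x t) i / inertia net i)) \<and>
    (\<forall>i \<in> loads net. \<forall>t\<ge>0. power_excess net (x t) i = 0) \<and>
    (\<forall>(i, j) \<in> lines net. caratheodory_rate (\<lambda>t. flow (x t) (i, j))
       (\<lambda>t. suscept net (i, j) * (freq (x t) i - freq (x t) j)))"

definition psi_rate :: "'n network \<Rightarrow> 'n controller \<Rightarrow> 'n state \<Rightarrow> 'n \<Rightarrow> real" where
  "psi_rate net ctrl s i = eps_psi ctrl i *
    ((\<Sum>j | (i, j) \<in> inner_lines net.
        (mu net ctrl s i - mu net ctrl s j - sigma_up s (i, j) + sigma_lo s (i, j))
          * suscept net (i, j)) +
     (\<Sum>k | (k, i) \<in> inner_lines net.
        (mu net ctrl s i - mu net ctrl s k + sigma_up s (k, i) - sigma_lo s (k, i))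
          * suscept net (k, i)))"

text \<open>
  The load controller with infinitely fast load update: the differential equation for \<open>load\<close>
  is replaced by the algebraic equation, required at all times. The argument \<open>D'\<close> is the
  damping coefficient used by the controller in the equation for \<open>rvar\<close>; it need not be the
  damping of the network. Multipliers start nonnegative.
\<close>

definition fast_ALC_solution ::
  "'n network \<Rightarrow> ('n \<Rightarrow> real \<Rightarrow> real) \<Rightarrow> 'n controller \<Rightarrow> ('n \<Rightarrow> real) \<Rightarrow>
    (real \<Rightarrow> 'n state) \<Rightarrow> bool" where
  "fast_ALC_solution net c ctrl D' x \<longleftrightarrow>
    nonneg_multipliers net (x 0) \<and>
    (\<forall>i \<in> buses net.
       (\<forall>t\<ge>0. - deriv (c i) (load (x t) i) + eta net ctrl i * freq (x t) i
                + eps_mu ctrl i / gain ctrl i * rvar (x t) i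
                - gamma_up (x t) i + gamma_lo (x t) i = 0) \<and>
       caratheodory_rate (\<lambda>t. psi (x t) i) (\<lambda>t. psi_rate net ctrl (x t) i) \<and>
       caratheodory_rate (\<lambda>t. gamma_up (x t) i)
         (\<lambda>t. eps_gamma_up ctrl i *
                proj_rate (load (x t) i - load_max net i) (gamma_up (x t) i)) \<and>
       caratheodory_rate (\<lambda>t. gamma_lo (x t) i)
         (\<lambda>t. eps_gamma_lo ctrl i *
                proj_rate (- load (x t) i + load_min net i) (gamma_lo (x t) i)) \<and>
       caratheodory_rate (\<lambda>t. rvar (x t) i)
         (\<lambda>t. gain ctrl i *
                (D' i * freq (x t) i + net_outflow (lines net) (flow (x t)) i
                 - net_outflow (inner_lines net) (angle_flow net (psi (x t))) i))) \<and>
    (\<forall>e \<in> inner_lines net.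
       caratheodory_rate (\<lambda>t. sigma_up (x t) e)
         (\<lambda>t. eps_sigma_up ctrl e *
                proj_rate (angle_flow net (psi (x t)) e - flow_max net e) (sigma_up (x t) e)) \<and>
       caratheodory_rate (\<lambda>t. sigma_lo (x t) e)
         (\<lambda>t. eps_sigma_lo ctrl e *
                proj_rate (- angle_flow net (psi (x t)) e + flow_min net e) (sigma_lo (x t) e)))"

definition converges_to :: "'n network \<Rightarrow> (real \<Rightarrow> 'n state) \<Rightarrow> 'n state \<Rightarrow> bool" where
  "converges_to net x s \<longleftrightarrow>
    (\<forall>i \<in> buses net.
       ((\<lambda>t. load (x t) i) \<longlongrightarrow> load s i) at_top \<and>
       ((\<lambda>t. freq (x t) i) \<longlongrightarrow> freq s i) at_top \<and>
       ((\<lambda>t. psi (x t) i) \<longlongrightarrow> psi s i) at_top \<and>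
       ((\<lambda>t. gamma_up (x t) i) \<longlongrightarrow> gamma_up s i) at_top \<and>
       ((\<lambda>t. gamma_lo (x t) i) \<longlongrightarrow> gamma_lo s i) at_top \<and>
       ((\<lambda>t. rvar (x t) i) \<longlongrightarrow> rvar s i) at_top) \<and>
    (\<forall>e \<in> lines net. ((\<lambda>t. flow (x t) e) \<longlongrightarrow> flow s e) at_top) \<and>
    (\<forall>e \<in> inner_lines net.
       ((\<lambda>t. sigma_up (x t) e) \<longlongrightarrow> sigma_up s e) at_top \<and>
       ((\<lambda>t. sigma_lo (x t) e) \<longlongrightarrow> sigma_lo s e) at_top)"

end

theory Submission
  imports Defs
begin

text \<open>
  Write \<open>\<mu>\<close> for the auxiliary signal \<open>mu\<close>. Differentiating it, with the network equations inserted, gives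
  the rate \<open>\<epsilon> (P\<^sup>i\<^sup>n - d + \<delta>a \<omega> - outflow of B (\<psi>\<^sub>i - \<psi>\<^sub>j))\<close> at generators and at loads alike
  (\<open>rate_mu\<close>), and the algebraic equation becomes \<open>c' (d) = \<omega> + \<mu> - \<gamma>\<^sup>+ + \<gamma>\<^sup>-\<close>. So the closed loop is
  the projected primal-dual gradient flow of the Lagrangian of (R-OLC), disturbed only by the term
  \<open>\<delta>a \<omega>\<close>. Let \<open>V\<close> be half the weighted squared distance of the state to a saddle point, at which the
  frequencies vanish. All bilinear terms cancel, the projections have the right sign, and
  (\<open>V_rate_le\<close>)

    \<open>V' \<le> - \<Sum>\<^sub>i ((D\<^sub>i + \<delta>a\<^sub>i) \<omega>\<^sub>i\<^sup>2 - \<delta>a\<^sub>i \<omega>\<^sub>i \<Delta>c'\<^sub>i + \<Delta>c'\<^sub>i \<Delta>d\<^sub>i) + \<Sum>\<^sub>i \<delta>a\<^sub>i \<omega>\<^sub>i \<Delta>\<gamma>\<^sub>i\<close>.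

  Since \<open>\<Delta>c'\<^sub>i \<Delta>d\<^sub>i \<ge> (\<Delta>c'\<^sub>i)\<^sup>2 / l\<close>, the first sum dominates a quadratic form in \<open>\<omega>\<^sub>i\<close> and \<open>\<Delta>c'\<^sub>i\<close>, and
  the admissible range of \<open>\<delta>a\<^sub>i\<close> is the one in which this form is positive definite.

  The second sum has no sign. Loads strictly inside their limits make \<open>\<gamma>\<^sup>+\<close> and \<open>\<gamma>\<^sup>-\<close> nonincreasing,
  but they may start positive and need not reach zero. The cure is an integration by parts: with an
  antiderivative \<open>\<Theta>\<^sub>i\<close> of \<open>\<omega>\<^sub>i\<close>, the quantity \<open>V - \<Sum>\<^sub>i \<delta>a\<^sub>i \<Theta>\<^sub>i \<Delta>\<gamma>\<^sub>i\<close> has the indefinite sum replaced by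
  \<open>- \<Sum>\<^sub>i \<delta>a\<^sub>i \<Theta>\<^sub>i \<gamma>\<^sub>i'\<close>, and the rates \<open>\<gamma>\<^sub>i'\<close> are integrable because \<open>\<gamma>\<^sup>+\<close> and \<open>\<gamma>\<^sup>-\<close> are monotone
  and nonnegative. Connectedness of the grid makes \<open>\<Theta>\<^sub>i\<close> a linear function of the line flows and of
  \<open>r\<close> (\<open>phase_exists\<close>): phase differences are read off the flows, and their weighted mean off
  \<open>\<Sum>\<^sub>i r\<^sub>i / K\<^sub>i\<close>. Hence \<open>\<Theta>\<^sub>i\<close> grows only like the square root of \<open>V\<close>, and the factor
  \<open>exp (\<Sum> (\<gamma>\<^sup>+ + \<gamma>\<^sup>-))\<close> absorbs the remaining term as in Gronwall's inequality
  (\<open>energy_certificate\<close>). So the state is bounded, and Barbalat's lemma gives \<open>\<omega> \<rightarrow> 0\<close> and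
  \<open>d \<rightarrow> d*\<close>.

  The multipliers \<open>\<gamma>\<close> converge by monotonicity and \<open>\<mu>\<close> through the algebraic equation; Barbalat's lemma
  for \<open>\<omega>\<close> and \<open>\<mu>\<close> gives the limits of the nodal outflows, an energy identity those of the virtual flows.
  What remains are \<open>P\<close>, \<open>\<psi>\<close> and \<open>\<sigma>\<close>: they are bounded, and a limit point along a sequence of times is,
  together with the limits found so far, again a saddle point (\<open>limit_point_saddle\<close>). Relative to this
  one, the corrected energy is nonincreasing up to a multiple of \<open>\<Sum> (\<gamma>\<^sup>+ + \<gamma>\<^sup>-)\<close>, hence convergent,
  and it tends to zero along the sequence; so it tends to zero and the trajectory converges
  (\<open>energy_vanishes\<close>, \<open>trajectory_converges\<close>).

  A saddle point exists because (OLC) attains its minimum on a polyhedron, where Farkas' lemma supplies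
  the multipliers (\<open>ROLC_saddle_exists\<close>). Its load stays the limit of \<open>d\<close>, and with zero frequency an
  optimal load of (OLC) is optimal for (R-OLC). All statements about Caratheodory solutions go back to
  one comparison principle, \<open>caratheodory_rate_decreasing\<close>.
\<close>

section \<open>Comparison principle and calculus for Caratheodory rates\<close>

lemma abs_continuous_onD_division:
  assumes "abs_continuous_on a b y" "\<epsilon> > 0"
  obtains \<delta> where "\<delta> > 0"
    "\<And>D. D division_of \<Union>D \<Longrightarrow> \<Union>D \<subseteq> {a..b} \<Longrightarrow> (\<Sum>k\<in>D. Sup k - Inf k) < \<delta> \<Longrightarrow>
       (\<Sum>k\<in>D. \<bar>y (Sup k) - y (Inf k)\<bar>) < \<epsilon>"
  using assms unfolding abs_continuous_on_def by blast

lemma abs_continuous_on_imp_continuous_on: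
  assumes "abs_continuous_on a b y"
  shows "continuous_on {a..b} y"
  unfolding continuous_on_iff
proof (intro ballI allI impI)
  fix s \<epsilon> :: real assume s: "s \<in> {a..b}" and "\<epsilon> > 0"
  obtain \<delta> where "\<delta> > 0" and \<delta>: "\<And>D. D division_of \<Union>D \<Longrightarrow> \<Union>D \<subseteq> {a..b} \<Longrightarrow>
      (\<Sum>k\<in>D. Sup k - Inf k) < \<delta> \<Longrightarrow> (\<Sum>k\<in>D. \<bar>y (Sup k) - y (Inf k)\<bar>) < \<epsilon>"
    by (rule abs_continuous_onD_division[OF assms \<open>\<epsilon> > 0\<close>]) (rule that)
  have *: "\<bar>y q - y p\<bar> < \<epsilon>" if "a \<le> p" "p \<le> q" "q \<le> b" "q - p < \<delta>" for p q
    using \<delta>[of "{{p..q}}"] that by (auto simp: division_of_def simp flip: interval_cbox)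
  show "\<exists>d>0. \<forall>t\<in>{a..b}. dist t s < d \<longrightarrow> dist (y t) (y s) < \<epsilon>"
  proof (intro exI conjI ballI impI)
    show "\<delta> > 0" by fact
    fix t assume "t \<in> {a..b}" "dist t s < \<delta>"
    then show "dist (y t) (y s) < \<epsilon>"
      using *[of t s] *[of s t] s by (cases "t \<le> s") (auto simp: dist_real_def abs_minus_commute)
  qed
qed

lemma division_Sup_Inf:
  fixes k :: "real set"
  assumes "D division_of \<Union>D" "\<Union>D \<subseteq> {a..b}" "k \<in> D"
  shows "Sup k \<in> {a..b}" "Inf k \<in> {a..b}" "Inf k \<le> Sup k"
proof -
  obtain p q where k: "k = {p..q}" "k \<noteq> {}"
    using division_ofD(3,4)[OF assms(1,3)] by auto
  moreover have "k \<subseteq> {a..b}" using assms by auto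
  ultimately show "Sup k \<in> {a..b}" "Inf k \<in> {a..b}" "Inf k \<le> Sup k" by auto
qed

text \<open>
  One criterion covers sums, products, exponentials and changes of a function outside the interval.
\<close>

lemma abs_continuous_on_dominated:
  assumes f: "abs_continuous_on a b f" and g: "abs_continuous_on a b g"
    and h: "\<And>s t. s \<in> {a..b} \<Longrightarrow> t \<in> {a..b} \<Longrightarrow>
      \<bar>h t - h s\<bar> \<le> C * (\<bar>f t - f s\<bar> + \<bar>g t - g s\<bar>)"
  shows "abs_continuous_on a b h"
  unfolding abs_continuous_on_def
proof (intro allI impI)
  fix \<epsilon> :: real assume "\<epsilon> > 0"
  define \<eta> where "\<eta> = \<epsilon> / (2 * (\<bar>C\<bar> + 1))"
  have "\<eta> > 0" using \<open>\<epsilon> > 0\<close> by (auto simp: \<eta>_def)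
  obtain \<delta>1 where d1: "\<delta>1 > 0" "\<And>D. D division_of \<Union>D \<Longrightarrow> \<Union>D \<subseteq> {a..b} \<Longrightarrow>
      (\<Sum>k\<in>D. Sup k - Inf k) < \<delta>1 \<Longrightarrow> (\<Sum>k\<in>D. \<bar>f (Sup k) - f (Inf k)\<bar>) < \<eta>"
    by (rule abs_continuous_onD_division[OF f \<open>\<eta> > 0\<close>]) (rule that)
  obtain \<delta>2 where d2: "\<delta>2 > 0" "\<And>D. D division_of \<Union>D \<Longrightarrow> \<Union>D \<subseteq> {a..b} \<Longrightarrow>
      (\<Sum>k\<in>D. Sup k - Inf k) < \<delta>2 \<Longrightarrow> (\<Sum>k\<in>D. \<bar>g (Sup k) - g (Inf k)\<bar>) < \<eta>"
    by (rule abs_continuous_onD_division[OF g \<open>\<eta> > 0\<close>]) (rule that)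
  show "\<exists>\<delta>>0. \<forall>D. D division_of \<Union>D \<longrightarrow> \<Union>D \<subseteq> {a..b} \<longrightarrow> (\<Sum>k\<in>D. Sup k - Inf k) < \<delta> \<longrightarrow>
       (\<Sum>k\<in>D. \<bar>h (Sup k) - h (Inf k)\<bar>) < \<epsilon>"
  proof (intro exI conjI allI impI)
    show "min \<delta>1 \<delta>2 > 0" using d1 d2 by auto
    fix D :: "real set set" assume D: "D division_of \<Union>D" "\<Union>D \<subseteq> {a..b}"
      "(\<Sum>k\<in>D. Sup k - Inf k) < min \<delta>1 \<delta>2"
    have "(\<Sum>k\<in>D. \<bar>h (Sup k) - h (Inf k)\<bar>)
        \<le> (\<Sum>k\<in>D. (\<bar>C\<bar> + 1) * (\<bar>f (Sup k) - f (Inf k)\<bar> + \<bar>g (Sup k) - g (Inf k)\<bar>))"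
    proof (rule sum_mono)
      fix k assume "k \<in> D"
      have "\<bar>h (Sup k) - h (Inf k)\<bar> \<le> C * (\<bar>f (Sup k) - f (Inf k)\<bar> + \<bar>g (Sup k) - g (Inf k)\<bar>)"
        using h division_Sup_Inf[OF D(1,2) \<open>k \<in> D\<close>] by blast
      also have "\<dots> \<le> (\<bar>C\<bar> + 1) * (\<bar>f (Sup k) - f (Inf k)\<bar> + \<bar>g (Sup k) - g (Inf k)\<bar>)"
        by (intro mult_right_mono) auto
      finally show "\<bar>h (Sup k) - h (Inf k)\<bar>
        \<le> (\<bar>C\<bar> + 1) * (\<bar>f (Sup k) - f (Inf k)\<bar> + \<bar>g (Sup k) - g (Inf k)\<bar>)" .
    qed
    also have "\<dots> = (\<bar>C\<bar> + 1) * ((\<Sum>k\<in>D. \<bar>f (Sup k) - f (Inf k)\<bar>) + (\<Sum>k\<in>D. \<bar>g (Sup k) - g (Inf k)\<bar>))"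
      by (simp only: sum_distrib_left sum.distrib distrib_left)
    also have "\<dots> < (\<bar>C\<bar> + 1) * (\<eta> + \<eta>)"
      using d1(2)[OF D(1,2)] d2(2)[OF D(1,2)] D(3) by (intro mult_strict_left_mono add_strict_mono) auto
    also have "\<dots> = \<epsilon>"
    proof -
      have "\<bar>C\<bar> + 1 \<noteq> 0" by linarith
      then have "2 * (\<bar>C\<bar> + 1) * \<eta> = \<epsilon>" unfolding \<eta>_def by simp
      then show ?thesis by (simp add: algebra_simps)
    qed
    finally show "(\<Sum>k\<in>D. \<bar>h (Sup k) - h (Inf k)\<bar>) < \<epsilon>" .
  qed
qed

lemma abs_continuous_on_subinterval:
  assumes "abs_continuous_on a b y" "a \<le> a'" "b' \<le> b"
  shows "abs_continuous_on a' b' y"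
proof -
  have "\<Union>D \<subseteq> {a..b}" if "\<Union>D \<subseteq> {a'..b'}" for D :: "real set set"
    using that assms(2,3) by (meson atLeastatMost_subset_iff order_trans)
  then show ?thesis using assms(1) unfolding abs_continuous_on_def by meson
qed

text \<open>
  Absolute continuity makes exceptional null sets harmless in tagged divisions: the null set has an open
  neighbourhood of small measure, so the intervals tagged in it have small total length and contribute
  little variation.
\<close>

lemma abs_continuous_on_null_tags:
  fixes y :: "real \<Rightarrow> real"
  assumes ac: "abs_continuous_on a b y" and N: "negligible N" and "\<epsilon> > 0"
  obtains O' where "open O'" "N \<subseteq> O'"
    "\<And>p. p tagged_partial_division_of {a..b} \<Longrightarrow> (\<And>x K. (x, K) \<in> p \<Longrightarrow> K \<subseteq> O') \<Longrightarrow>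
      (\<Sum>(x, K)\<in>p. \<bar>y (Sup K) - y (Inf K)\<bar>) < \<epsilon>"
proof -
  obtain \<delta> where "\<delta> > 0" and \<delta>: "\<And>D. D division_of \<Union>D \<Longrightarrow> \<Union>D \<subseteq> {a..b} \<Longrightarrow>
      (\<Sum>k\<in>D. Sup k - Inf k) < \<delta> \<Longrightarrow> (\<Sum>k\<in>D. \<bar>y (Sup k) - y (Inf k)\<bar>) < \<epsilon>"
    by (rule abs_continuous_onD_division[OF ac \<open>\<epsilon> > 0\<close>]) (rule that)
  have N0: "N \<in> null_sets lebesgue" using N negligible_iff_null_sets by blast
  then have "N \<in> sets lebesgue" by auto
  then obtain T where T: "open T" "N \<subseteq> T" "T - N \<in> lmeasurable" "emeasure lebesgue (T - N) < ennreal \<delta>"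
    using \<open>\<delta> > 0\<close> by (rule sets_lebesgue_outer_open) (rule that)
  have T_sets: "T \<in> sets lebesgue" using T(1) by (simp add: borel_open)
  have T_meas: "emeasure lebesgue T < ennreal \<delta>"
    using T(4) emeasure_Diff_null_set[OF N0 T_sets] by simp
  show thesis
  proof
    show "open T" "N \<subseteq> T" by fact+
    fix p assume p: "p tagged_partial_division_of {a..b}" and pT: "\<And>x K. (x, K) \<in> p \<Longrightarrow> K \<subseteq> T"
    let ?D = "snd ` p"
    have D: "?D division_of \<Union>?D" by (rule partial_division_of_tagged_division[OF p])
    have D_ab: "\<Union>?D \<subseteq> {a..b}" using tagged_partial_division_ofD(3)[OF p] by force
    have D_T: "\<Union>?D \<subseteq> T" using pT by force
    have "ennreal (measure lebesgue (\<Union>?D)) = emeasure lebesgue (\<Union>?D)"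
      using lmeasurable_division[OF D] by (simp add: emeasure_eq_measure2)
    also have "\<dots> \<le> emeasure lebesgue T" by (rule emeasure_mono[OF D_T T_sets])
    also have "\<dots> < ennreal \<delta>" by (rule T_meas)
    finally have "measure lebesgue (\<Union>?D) < \<delta>" by (simp add: ennreal_less_iff)
    moreover have "(\<Sum>k\<in>?D. Sup k - Inf k) = (\<Sum>k\<in>?D. measure lebesgue k)"
    proof (rule sum.cong)
      fix k assume "k \<in> ?D"
      then obtain u v where "k = cbox u v" "k \<noteq> {}" 
        using division_ofD(3)[OF D \<open>k \<in> ?D\<close>] division_ofD(4)[OF D \<open>k \<in> ?D\<close>] by metis
      then show "Sup k - Inf k = measure lebesgue k" by auto
    qed simp
    ultimately have "(\<Sum>k\<in>?D. Sup k - Inf k) < \<delta>" using content_division[OF D] by simp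
    then have "(\<Sum>k\<in>?D. \<bar>y (Sup k) - y (Inf k)\<bar>) < \<epsilon>" by (rule \<delta>[OF D D_ab])
    moreover have "(\<Sum>(x, K)\<in>p. \<bar>y (Sup K) - y (Inf K)\<bar>) = (\<Sum>k\<in>?D. \<bar>y (Sup k) - y (Inf k)\<bar>)"
    proof -
      let ?d = "\<lambda>k. if k = {} then 0 else \<bar>y (Sup k) - y (Inf k)\<bar>"
      have *: "?d (cbox u v) = 0" if "box u v = {}" for u v :: real
        using that by (cases "u = v") auto
      have "(\<Sum>(x, K)\<in>p. \<bar>y (Sup K) - y (Inf K)\<bar>) = (\<Sum>(x, K)\<in>p. ?d K)"
        using tagged_partial_division_ofD(2)[OF p] by (intro sum.cong) fastforce+
      also have "\<dots> = (\<Sum>k\<in>?D. ?d k)"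
        by (rule sum.over_tagged_division_lemma[OF tagged_partial_division_of_Union_self[OF p]]) (rule *)
      also have "\<dots> = (\<Sum>k\<in>?D. \<bar>y (Sup k) - y (Inf k)\<bar>)"
        using division_ofD(3)[OF D] by (intro sum.cong) auto
      finally show ?thesis .
    qed
    ultimately show "(\<Sum>(x, K)\<in>p. \<bar>y (Sup K) - y (Inf K)\<bar>) < \<epsilon>" by simp
  qed
qed

text \<open>
  The comparison principle. On a tagged division that is fine for a suitable gauge, an interval tagged
  where the derivative exists increases \<open>y\<close> by at most \<open>\<epsilon>\<close> times its length, and the intervals with
  other tags contribute less than \<open>\<epsilon>\<close> in total.
\<close>

lemma caratheodory_rate_decreasing:
  assumes y: "caratheodory_rate y f" and "0 \<le> a" "a \<le> b"
    and f: "\<And>t. a < t \<Longrightarrow> t < b \<Longrightarrow> f t \<le> 0"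
  shows "y b \<le> y a"
proof (rule field_le_epsilon)
  fix e :: real assume "e > 0"
  define \<epsilon> where "\<epsilon> = e / (b - a + 1)"
  have "\<epsilon> > 0" using \<open>e > 0\<close> \<open>a \<le> b\<close> by (simp add: \<epsilon>_def)
  have ac: "abs_continuous_on a b y"
    using y \<open>0 \<le> a\<close> \<open>a \<le> b\<close> abs_continuous_on_subinterval[of 0 b y a b]
    unfolding caratheodory_rate_def by auto
  obtain N where N: "N \<in> null_sets lborel"
    "{t. \<not> (t \<ge> 0 \<longrightarrow> (y has_real_derivative f t) (at t within {0..}))} \<subseteq> N"
    using y unfolding caratheodory_rate_def by (auto elim!: AE_E simp: null_sets_def)
  \<comment> \<open>The bound on the rate concerns the open interval, so the endpoints join the null set.\<close>
  define N' where "N' = insert a (insert b N)"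
  have "N \<in> null_sets lebesgue" using N(1) null_sets_completionI by blast
  then have "negligible N'" by (simp add: N'_def negligible_iff_null_sets negligible_insert flip: negligible_iff_null_sets)
  then obtain T where T: "open T" "N' \<subseteq> T" and small: "\<And>p. p tagged_partial_division_of {a..b} \<Longrightarrow>
      (\<And>x K. (x, K) \<in> p \<Longrightarrow> K \<subseteq> T) \<Longrightarrow> (\<Sum>(x, K)\<in>p. \<bar>y (Sup K) - y (Inf K)\<bar>) < \<epsilon>"
    using abs_continuous_on_null_tags[OF ac _ \<open>\<epsilon> > 0\<close>] by blast
  have good: "\<exists>d>0. \<forall>s\<ge>0. \<bar>s - t\<bar> < d \<longrightarrow> \<bar>y s - y t - f t * (s - t)\<bar> \<le> \<epsilon> * \<bar>s - t\<bar>"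
    if t: "t \<in> {a..b}" "t \<notin> N'" for t
  proof -
    have "(y has_derivative (\<lambda>x. f t * x)) (at t within {0..})"
      using N(2) t \<open>0 \<le> a\<close> unfolding N'_def has_field_derivative_def
      by (smt (verit, best) atLeastAtMost_iff insert_iff mem_Collect_eq subset_iff)
    then show ?thesis
      using \<open>\<epsilon> > 0\<close> unfolding has_derivative_within_alt by fastforce
  qed
  then obtain r where r: "\<And>t. t \<in> {a..b} \<Longrightarrow> t \<notin> N' \<Longrightarrow> r t > 0 \<and>
      (\<forall>s\<ge>0. \<bar>s - t\<bar> < r t \<longrightarrow> \<bar>y s - y t - f t * (s - t)\<bar> \<le> \<epsilon> * \<bar>s - t\<bar>)"
    by metis
  define g where "g t = (if t \<in> N' then T else if t \<in> {a..b} then ball t (r t) else UNIV)" for t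
  have "gauge g" using T r unfolding gauge_def g_def by auto
  then obtain p where p: "p tagged_division_of {a..b}" "g fine p"
    using fine_division_exists_real by blast
  define p1 where "p1 = {(x, K) \<in> p. x \<in> N'}"
  define p2 where "p2 = {(x, K) \<in> p. x \<notin> N'}"
  have fin: "finite p" using p by auto
  have split: "p = p1 \<union> p2" "p1 \<inter> p2 = {}" by (auto simp: p1_def p2_def)
  have fin12: "finite p1" "finite p2" using fin split by auto
  have "p1 tagged_partial_division_of {a..b}"
    using p(1) split(1) tagged_partial_division_subset unfolding tagged_division_of_def by blast
  moreover have "K \<subseteq> T" if "(x, K) \<in> p1" for x K
    using fineD[OF p(2), of x K] that unfolding p1_def g_def by auto
  ultimately have S1: "(\<Sum>(x, K)\<in>p1. \<bar>y (Sup K) - y (Inf K)\<bar>) < \<epsilon>" by (rule small)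
  have S1': "(\<Sum>(x, K)\<in>p1. y (Sup K) - y (Inf K)) \<le> (\<Sum>(x, K)\<in>p1. \<bar>y (Sup K) - y (Inf K)\<bar>)"
    by (rule sum_mono) auto
  have tag: "y (Sup K) - y (Inf K) \<le> \<epsilon> * (Sup K - Inf K)" if xK: "(x, K) \<in> p2" for x K
  proof -
    have inp: "(x, K) \<in> p" "x \<notin> N'" using xK by (auto simp: p2_def)
    obtain u v where K: "K = {u..v}" using tagged_division_ofD(4)[OF p(1) inp(1)] by auto
    have x: "x \<in> K" "K \<subseteq> {a..b}" using tagged_division_ofD(2,3)[OF p(1) inp(1)] by auto
    have uv: "u \<le> x" "x \<le> v" "a \<le> u" "v \<le> b" using x K by auto
    have "K \<subseteq> ball x (r x)" using p(2) inp x unfolding fine_def g_def by fastforce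
    moreover have "u \<in> K" "v \<in> K" using K uv by auto
    ultimately have near: "u \<in> ball x (r x)" "v \<in> ball x (r x)" by blast+
    have "\<bar>y s - y x - f x * (s - x)\<bar> \<le> \<epsilon> * \<bar>s - x\<bar>" if "s \<ge> 0" "\<bar>s - x\<bar> < r x" for s
      using r[of x] inp x that by blast
    moreover have "\<bar>u - x\<bar> < r x" "\<bar>v - x\<bar> < r x" "u \<ge> 0" "v \<ge> 0"
      using near uv \<open>0 \<le> a\<close> by (auto simp: dist_real_def abs_minus_commute)
    ultimately have "\<bar>y u - y x - f x * (u - x)\<bar> \<le> \<epsilon> * \<bar>u - x\<bar>" "\<bar>y v - y x - f x * (v - x)\<bar> \<le> \<epsilon> * \<bar>v - x\<bar>"
      by blast+
    then have "y v - y u \<le> f x * (v - u) + \<epsilon> * (v - u)"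
      using uv by (simp add: algebra_simps)
    moreover have "f x \<le> 0" using f[of x] inp x by (auto simp: N'_def)
    then have "f x * (v - u) \<le> 0" using uv by (simp add: mult_nonpos_nonneg)
    ultimately show ?thesis using K uv by simp
  qed
  have "(\<Sum>(x, K)\<in>p2. y (Sup K) - y (Inf K)) \<le> (\<Sum>(x, K)\<in>p2. \<epsilon> * (Sup K - Inf K))"
    using tag by (intro sum_mono) auto
  also have "\<dots> \<le> (\<Sum>(x, K)\<in>p. \<epsilon> * (Sup K - Inf K))"
  proof (rule sum_mono2[OF fin])
    show "p2 \<subseteq> p" using split by auto
    fix z assume "z \<in> p - p2"
    then obtain x K where z: "z = (x, K)" "(x, K) \<in> p" by (cases z) auto
    obtain u v where K: "K = {u..v}" using tagged_division_ofD(4)[OF p(1) z(2)] by auto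
    have "x \<in> K" using tagged_division_ofD(2)[OF p(1) z(2)] .
    then show "0 \<le> (case z of (x, K) \<Rightarrow> \<epsilon> * (Sup K - Inf K))" using z K \<open>\<epsilon> > 0\<close> by auto
  qed
  also have "\<dots> = \<epsilon> * (b - a)"
    using additive_tagged_division_1[OF \<open>a \<le> b\<close> p(1), of "\<lambda>x. \<epsilon> * x"] by (simp add: algebra_simps)
  finally have S2: "(\<Sum>(x, K)\<in>p2. y (Sup K) - y (Inf K)) \<le> \<epsilon> * (b - a)" .
  have "y b - y a = (\<Sum>(x, K)\<in>p. y (Sup K) - y (Inf K))"
    using additive_tagged_division_1[OF \<open>a \<le> b\<close> p(1), of y] by simp
  also have "\<dots> = (\<Sum>(x, K)\<in>p1. y (Sup K) - y (Inf K)) + (\<Sum>(x, K)\<in>p2. y (Sup K) - y (Inf K))"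
    using sum.union_disjoint[OF fin12 split(2)] split(1) by auto
  also have "\<dots> \<le> \<epsilon> + \<epsilon> * (b - a)" using S1 S1' S2 by simp
  also have "\<dots> = \<epsilon> * (b - a + 1)" by (simp add: algebra_simps)
  also have "\<dots> = e" using \<open>a \<le> b\<close> by (simp add: \<epsilon>_def)
  finally show "y b \<le> y a + e" by simp
qed

lemma caratheodory_rate_continuous_on:
  assumes "caratheodory_rate y f"
  shows "continuous_on {0..b} y"
  using assms abs_continuous_on_imp_continuous_on[of 0 b y]
  unfolding caratheodory_rate_def by (cases "b \<ge> 0") auto

lemma caratheodory_rate_const: "caratheodory_rate (\<lambda>t. k) (\<lambda>t. 0)"
  by (auto simp: caratheodory_rate_def abs_continuous_on_def intro: exI[of _ 1])

lemma caratheodory_rate_add: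
  assumes f: "caratheodory_rate f f'" and g: "caratheodory_rate g g'"
  shows "caratheodory_rate (\<lambda>t. f t + g t) (\<lambda>t. f' t + g' t)"
  unfolding caratheodory_rate_def
proof (intro conjI allI impI)
  fix T :: real assume "0 \<le> T"
  then have "abs_continuous_on 0 T f" "abs_continuous_on 0 T g"
    using f g unfolding caratheodory_rate_def by auto
  then show "abs_continuous_on 0 T (\<lambda>t. f t + g t)"
    by (rule abs_continuous_on_dominated[where C = 1]) auto
next
  have "AE t in lborel. t \<ge> 0 \<longrightarrow> (f has_real_derivative f' t) (at t within {0..})"
    "AE t in lborel. t \<ge> 0 \<longrightarrow> (g has_real_derivative g' t) (at t within {0..})"
    using f g unfolding caratheodory_rate_def by auto
  then show "AE t in lborel. 0 \<le> t \<longrightarrow>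
      ((\<lambda>t. f t + g t) has_real_derivative f' t + g' t) (at t within {0..})"
    by eventually_elim (auto intro: DERIV_add)
qed

lemma caratheodory_rate_mult:
  assumes f: "caratheodory_rate f f'" and g: "caratheodory_rate g g'"
  shows "caratheodory_rate (\<lambda>t. f t * g t) (\<lambda>t. f' t * g t + f t * g' t)"
  unfolding caratheodory_rate_def
proof (intro conjI allI impI)
  fix T :: real assume "0 \<le> T"
  have ac: "abs_continuous_on 0 T f" "abs_continuous_on 0 T g"
    using f g \<open>0 \<le> T\<close> unfolding caratheodory_rate_def by auto
  have "bounded (f ` {0..T})" "bounded (g ` {0..T})"
    using ac abs_continuous_on_imp_continuous_on compact_continuous_image compact_imp_bounded
    by (metis compact_Icc)+
  then obtain C1 C2 where C: "\<And>t. t \<in> {0..T} \<Longrightarrow> \<bar>f t\<bar> \<le> C1" "\<And>t. t \<in> {0..T} \<Longrightarrow> \<bar>g t\<bar> \<le> C2"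
    unfolding bounded_real by blast
  show "abs_continuous_on 0 T (\<lambda>t. f t * g t)"
  proof (rule abs_continuous_on_dominated[OF ac, where C = "C1 + C2"])
    fix s t assume st: "s \<in> {0..T}" "t \<in> {0..T}"
    have "f t * g t - f s * g s = f t * (g t - g s) + g s * (f t - f s)" by (simp add: algebra_simps)
    then have "\<bar>f t * g t - f s * g s\<bar> \<le> \<bar>f t\<bar> * \<bar>g t - g s\<bar> + \<bar>g s\<bar> * \<bar>f t - f s\<bar>"
      by (metis abs_mult abs_triangle_ineq)
    also have "\<dots> \<le> C1 * \<bar>g t - g s\<bar> + C2 * \<bar>f t - f s\<bar>"
      using C st by (intro add_mono mult_right_mono) auto
    also have "\<dots> \<le> (C1 + C2) * (\<bar>f t - f s\<bar> + \<bar>g t - g s\<bar>)"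
      using C[OF st(1)] by (simp add: algebra_simps)
    finally show "\<bar>f t * g t - f s * g s\<bar> \<le> (C1 + C2) * (\<bar>f t - f s\<bar> + \<bar>g t - g s\<bar>)" .
  qed
next
  have "AE t in lborel. t \<ge> 0 \<longrightarrow> (f has_real_derivative f' t) (at t within {0..})"
    "AE t in lborel. t \<ge> 0 \<longrightarrow> (g has_real_derivative g' t) (at t within {0..})"
    using f g unfolding caratheodory_rate_def by auto
  then show "AE t in lborel. 0 \<le> t \<longrightarrow>
      ((\<lambda>t. f t * g t) has_real_derivative f' t * g t + f t * g' t) (at t within {0..})"
    by eventually_elim (auto intro!: derivative_eq_intros)
qed

lemma caratheodory_rate_cong:
  assumes "caratheodory_rate y f" "\<And>t. t \<ge> 0 \<Longrightarrow> y t = y' t" "\<And>t. t \<ge> 0 \<Longrightarrow> f t = f' t"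
  shows "caratheodory_rate y' f'"
  unfolding caratheodory_rate_def
proof (intro conjI allI impI)
  fix T :: real assume "0 \<le> T"
  then have ac: "abs_continuous_on 0 T y" using assms(1) unfolding caratheodory_rate_def by auto
  show "abs_continuous_on 0 T y'"
    by (rule abs_continuous_on_dominated[OF ac ac, where C = 1]) (auto simp flip: assms(2))
next
  have "AE t in lborel. t \<ge> 0 \<longrightarrow> (y has_real_derivative f t) (at t within {0..})"
    using assms(1) unfolding caratheodory_rate_def by auto
  then show "AE t in lborel. 0 \<le> t \<longrightarrow> (y' has_real_derivative f' t) (at t within {0..})"
  proof eventually_elim
    case (elim t)
    then show ?case
      using assms(2,3) has_field_derivative_transform_within[of y "f t" t "{0..}" 1 y'] by auto
  qed
qed

lemma caratheodory_rate_cmult: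
  assumes "caratheodory_rate y f"
  shows "caratheodory_rate (\<lambda>t. k * y t) (\<lambda>t. k * f t)"
  using caratheodory_rate_mult[OF caratheodory_rate_const assms, of k] by simp

lemma caratheodory_rate_minus:
  assumes "caratheodory_rate y f"
  shows "caratheodory_rate (\<lambda>t. - y t) (\<lambda>t. - f t)"
  using caratheodory_rate_cmult[OF assms, of "-1"] by simp

lemma caratheodory_rate_diff:
  assumes "caratheodory_rate f f'" "caratheodory_rate g g'"
  shows "caratheodory_rate (\<lambda>t. f t - g t) (\<lambda>t. f' t - g' t)"
  using caratheodory_rate_add[OF assms(1) caratheodory_rate_minus[OF assms(2)]] by simp

lemma caratheodory_rate_sum:
  assumes "\<And>i. i \<in> A \<Longrightarrow> caratheodory_rate (y i) (f i)"
  shows "caratheodory_rate (\<lambda>t. \<Sum>i\<in>A. y i t) (\<lambda>t. \<Sum>i\<in>A. f i t)"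
proof (cases "finite A")
  case True
  then show ?thesis using assms
    by (induction A) (auto intro: caratheodory_rate_const caratheodory_rate_add)
qed (simp add: caratheodory_rate_const)

lemma caratheodory_rate_square:
  assumes "caratheodory_rate y f"
  shows "caratheodory_rate (\<lambda>t. (y t - k)\<^sup>2 / (2 * w)) (\<lambda>t. (y t - k) * (f t / w))"
proof -
  have 1: "caratheodory_rate (\<lambda>t. y t - k) f"
    using caratheodory_rate_diff[OF assms caratheodory_rate_const[of k]] by simp
  show ?thesis
    by (rule caratheodory_rate_cong[OF caratheodory_rate_cmult[OF caratheodory_rate_mult[OF 1 1], of "1 / (2 * w)"]])
      (cases "w = 0"; auto simp: power2_eq_square field_simps)+
qed

lemma caratheodory_rate_exp:
  assumes y: "caratheodory_rate y f"
  shows "caratheodory_rate (\<lambda>t. exp (y t)) (\<lambda>t. exp (y t) * f t)"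
  unfolding caratheodory_rate_def
proof (intro conjI allI impI)
  fix T :: real assume "0 \<le> T"
  then have ac: "abs_continuous_on 0 T y" using y unfolding caratheodory_rate_def by auto
  have "bounded (y ` {0..T})"
    using ac abs_continuous_on_imp_continuous_on compact_continuous_image compact_imp_bounded
    by (metis compact_Icc)
  then obtain C where C: "\<And>t. t \<in> {0..T} \<Longrightarrow> \<bar>y t\<bar> \<le> C" unfolding bounded_real by blast
  have step: "\<bar>exp p - exp q\<bar> \<le> exp C * \<bar>p - q\<bar>" if "p \<le> C" "q \<le> C" for p q :: real
  proof -
    have *: "exp p - exp q \<le> exp p * (p - q)" for p q :: real
    proof -
      have "1 + (q - p) \<le> exp (q - p)" by (rule exp_ge_add_one_self)
      then have "exp p * (1 + (q - p)) \<le> exp p * exp (q - p)" by (intro mult_left_mono) auto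
      then show ?thesis by (simp add: exp_diff algebra_simps)
    qed
    have **: "exp p * \<bar>p - q\<bar> \<le> exp C * \<bar>p - q\<bar>" "exp q * \<bar>p - q\<bar> \<le> exp C * \<bar>p - q\<bar>"
      using that by (auto intro!: mult_right_mono)
    show ?thesis
    proof (cases "q \<le> p")
      case True
      then show ?thesis using *[of p q] ** by auto
    next
      case False
      then have "\<bar>p - q\<bar> = q - p" "\<bar>exp p - exp q\<bar> = exp q - exp p" by auto
      then show ?thesis using *[of q p] **(2) by simp
    qed
  qed
  show "abs_continuous_on 0 T (\<lambda>t. exp (y t))"
  proof (rule abs_continuous_on_dominated[OF ac ac, where C = "exp C"])
    fix s t assume "s \<in> {0..T}" "t \<in> {0..T}"
    then have "\<bar>exp (y t) - exp (y s)\<bar> \<le> exp C * \<bar>y t - y s\<bar>" using C by (intro step) (auto dest!: abs_le_D1)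
    also have "\<dots> \<le> exp C * (\<bar>y t - y s\<bar> + \<bar>y t - y s\<bar>)" by (intro mult_left_mono) auto
    finally show "\<bar>exp (y t) - exp (y s)\<bar> \<le> exp C * (\<bar>y t - y s\<bar> + \<bar>y t - y s\<bar>)" .
  qed
next
  have "AE t in lborel. t \<ge> 0 \<longrightarrow> (y has_real_derivative f t) (at t within {0..})"
    using y unfolding caratheodory_rate_def by auto
  then show "AE t in lborel. 0 \<le> t \<longrightarrow>
      ((\<lambda>t. exp (y t)) has_real_derivative exp (y t) * f t) (at t within {0..})"
    by eventually_elim (auto intro!: derivative_eq_intros)
qed

lemma caratheodory_rate_le:
  assumes y: "caratheodory_rate y f" and "0 \<le> a" "a \<le> b"
    and f: "\<And>t. a < t \<Longrightarrow> t < b \<Longrightarrow> f t \<le> k"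
  shows "y b - y a \<le> k * (b - a)"
proof -
  have "caratheodory_rate (\<lambda>t. t) (\<lambda>t. 1)"
    unfolding caratheodory_rate_def abs_continuous_on_def
  proof (intro conjI allI impI)
    fix T \<epsilon> :: real assume "\<epsilon> > 0"
    have "(\<Sum>k\<in>D. \<bar>Sup k - Inf k\<bar>) = (\<Sum>k\<in>D. Sup k - Inf k)"
      if "D division_of \<Union>D" "\<Union>D \<subseteq> {0..T}" for D
      using division_Sup_Inf(3)[OF that] by (intro sum.cong) auto
    then show "\<exists>\<delta>>0. \<forall>D. D division_of \<Union>D \<longrightarrow> \<Union>D \<subseteq> {0..T} \<longrightarrow> (\<Sum>k\<in>D. Sup k - Inf k) < \<delta> \<longrightarrow>
        (\<Sum>k\<in>D. \<bar>Sup k - Inf k\<bar>) < \<epsilon>"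
      using \<open>\<epsilon> > 0\<close> by metis
  qed auto
  then have "caratheodory_rate (\<lambda>t. y t - k * t) (\<lambda>t. f t - k)"
    using caratheodory_rate_diff[OF y caratheodory_rate_cmult[of "\<lambda>t. t" "\<lambda>t. 1" k]] by simp
  then have "y b - k * b \<le> y a - k * a"
    using f by (intro caratheodory_rate_decreasing[OF _ \<open>0 \<le> a\<close> \<open>a \<le> b\<close>]) auto
  then show ?thesis by (simp add: algebra_simps)
qed

lemma caratheodory_rate_ge:
  assumes y: "caratheodory_rate y f" and "0 \<le> a" "a \<le> b"
    and f: "\<And>t. a < t \<Longrightarrow> t < b \<Longrightarrow> k \<le> f t"
  shows "k * (b - a) \<le> y b - y a"
  using caratheodory_rate_le[OF caratheodory_rate_minus[OF y] assms(2,3), of "-k"] f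
  by (simp add: algebra_simps)

text \<open>
  While \<open>y\<close> is negative it cannot decrease, so it cannot have become negative after its last
  nonnegative time.
\<close>

lemma caratheodory_rate_nonneg:
  assumes y: "caratheodory_rate y f" and "y 0 \<ge> 0"
    and f: "\<And>t. t \<ge> 0 \<Longrightarrow> y t < 0 \<Longrightarrow> f t \<ge> 0"
    and "t \<ge> 0"
  shows "y t \<ge> 0"
proof (rule ccontr)
  assume neg: "\<not> y t \<ge> 0"
  define S where "S = {s \<in> {0..t}. y s \<ge> 0}"
  have "continuous_on {0..t} y" by (rule caratheodory_rate_continuous_on[OF y])
  then have "closed S"
    unfolding S_def by (intro closed_Collect_le continuous_on_closed_Collect_le continuous_intros) auto
  moreover have S0: "0 \<in> S" "bdd_above S" using \<open>y 0 \<ge> 0\<close> \<open>t \<ge> 0\<close> by (auto simp: S_def bdd_above_def)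
  ultimately have s: "Sup S \<in> S" using closed_contains_Sup by blast
  have "f r \<ge> 0" if "Sup S < r" "r < t" for r
  proof -
    have "r \<notin> S" using that S0 cSup_upper[of r S] by auto
    then show ?thesis using f[of r] that s by (auto simp: S_def)
  qed
  then have "0 * (t - Sup S) \<le> y t - y (Sup S)"
    using s by (intro caratheodory_rate_ge[OF y]) (auto simp: S_def)
  then show False using s neg by (auto simp: S_def)
qed

section \<open>Bounded and Lipschitz signals, Barbalat's lemma\<close>

definition lipschitz_signal :: "(real \<Rightarrow> real) \<Rightarrow> bool" where
  "lipschitz_signal y \<longleftrightarrow> (\<exists>K\<ge>0. \<forall>s\<ge>0. \<forall>t\<ge>0. \<bar>y t - y s\<bar> \<le> K * \<bar>t - s\<bar>)"

definition bounded_signal :: "(real \<Rightarrow> real) \<Rightarrow> bool" where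
  "bounded_signal y \<longleftrightarrow> (\<exists>K\<ge>0. \<forall>t\<ge>0. \<bar>y t\<bar> \<le> K)"

lemma bounded_signalI: "(\<And>t. t \<ge> 0 \<Longrightarrow> \<bar>y t\<bar> \<le> K) \<Longrightarrow> bounded_signal y"
  unfolding bounded_signal_def by (metis abs_ge_zero order_refl order_trans)

lemma lipschitz_signalI:
  assumes "\<And>s t. 0 \<le> s \<Longrightarrow> s \<le> t \<Longrightarrow> \<bar>y t - y s\<bar> \<le> K * (t - s)"
  shows "lipschitz_signal y"
  unfolding lipschitz_signal_def
proof (intro exI conjI allI impI)
  fix s t :: real assume st: "0 \<le> s" "0 \<le> t"
  have *: "\<bar>y t - y s\<bar> \<le> \<bar>K\<bar> * (t - s)" if "0 \<le> s" "s \<le> t" for s t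
  proof -
    have "\<bar>y t - y s\<bar> \<le> K * (t - s)" using that by (rule assms)
    also have "\<dots> \<le> \<bar>K\<bar> * (t - s)" using that by (intro mult_right_mono) auto
    finally show ?thesis .
  qed
  show "\<bar>y t - y s\<bar> \<le> \<bar>K\<bar> * \<bar>t - s\<bar>"
    using *[of s t] *[of t s] st by (cases "s \<le> t") (auto simp: abs_minus_commute)
qed auto

lemma lipschitz_signalE:
  assumes "lipschitz_signal y"
  obtains K where "K > 0" "\<And>s t. 0 \<le> s \<Longrightarrow> 0 \<le> t \<Longrightarrow> \<bar>y t - y s\<bar> \<le> K * \<bar>t - s\<bar>"
proof -
  obtain K where K: "K \<ge> 0" "\<And>s t. 0 \<le> s \<Longrightarrow> 0 \<le> t \<Longrightarrow> \<bar>y t - y s\<bar> \<le> K * \<bar>t - s\<bar>"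
    using assms unfolding lipschitz_signal_def by blast
  show thesis
  proof (rule that[of "K + 1"])
    fix s t :: real assume "0 \<le> s" "0 \<le> t"
    then have "\<bar>y t - y s\<bar> \<le> K * \<bar>t - s\<bar>" by (rule K)
    also have "\<dots> \<le> (K + 1) * \<bar>t - s\<bar>" by (intro mult_right_mono) auto
    finally show "\<bar>y t - y s\<bar> \<le> (K + 1) * \<bar>t - s\<bar>" .
  qed (use K in auto)
qed

lemma bounded_signalE:
  assumes "bounded_signal y"
  obtains K where "K > 0" "\<And>t. 0 \<le> t \<Longrightarrow> \<bar>y t\<bar> \<le> K"
  using assms unfolding bounded_signal_def
  by (metis less_add_one order.strict_trans1 order_less_imp_le order_trans)

lemma bounded_signal_const [simp]: "bounded_signal (\<lambda>t. k)"
  by (rule bounded_signalI[of _ "\<bar>k\<bar>"]) simp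

lemma bounded_signal_add:
  assumes "bounded_signal f" "bounded_signal g"
  shows "bounded_signal (\<lambda>t. f t + g t)"
proof -
  obtain K L where "\<And>t. 0 \<le> t \<Longrightarrow> \<bar>f t\<bar> \<le> K" "\<And>t. 0 \<le> t \<Longrightarrow> \<bar>g t\<bar> \<le> L"
    using assms by (auto elim!: bounded_signalE)
  then show ?thesis by (intro bounded_signalI[of _ "K + L"]) (smt (verit))
qed

lemma bounded_signal_mult:
  assumes "bounded_signal f" "bounded_signal g"
  shows "bounded_signal (\<lambda>t. f t * g t)"
proof -
  obtain K L where "K > 0" "\<And>t. 0 \<le> t \<Longrightarrow> \<bar>f t\<bar> \<le> K" "\<And>t. 0 \<le> t \<Longrightarrow> \<bar>g t\<bar> \<le> L"
    using assms by (auto elim!: bounded_signalE)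
  then show ?thesis by (intro bounded_signalI[of _ "K * L"]) (auto simp: abs_mult intro!: mult_mono)
qed

lemma bounded_signal_cmult: "bounded_signal f \<Longrightarrow> bounded_signal (\<lambda>t. k * f t)"
  by (intro bounded_signal_mult) auto

lemma bounded_signal_diff:
  assumes "bounded_signal f" "bounded_signal g"
  shows "bounded_signal (\<lambda>t. f t - g t)"
  using bounded_signal_add[OF assms(1) bounded_signal_cmult[OF assms(2), of "-1"]] by simp

lemma bounded_signal_sum:
  assumes "\<And>i. i \<in> A \<Longrightarrow> bounded_signal (f i)"
  shows "bounded_signal (\<lambda>t. \<Sum>i\<in>A. f i t)"
  using assms by (induction A rule: infinite_finite_induct) (auto intro: bounded_signal_add)

lemma lipschitz_signal_const [simp]: "lipschitz_signal (\<lambda>t. k)"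
  by (rule lipschitz_signalI[of _ 0]) simp

lemma lipschitz_signal_add:
  assumes "lipschitz_signal f" "lipschitz_signal g"
  shows "lipschitz_signal (\<lambda>t. f t + g t)"
proof -
  obtain K L where K: "\<And>s t. 0 \<le> s \<Longrightarrow> 0 \<le> t \<Longrightarrow> \<bar>f t - f s\<bar> \<le> K * \<bar>t - s\<bar>"
    and L: "\<And>s t. 0 \<le> s \<Longrightarrow> 0 \<le> t \<Longrightarrow> \<bar>g t - g s\<bar> \<le> L * \<bar>t - s\<bar>"
    using assms by (auto elim!: lipschitz_signalE)
  show ?thesis
  proof (rule lipschitz_signalI[of _ "K + L"])
    fix s t :: real assume "0 \<le> s" "s \<le> t"
    then show "\<bar>f t + g t - (f s + g s)\<bar> \<le> (K + L) * (t - s)"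
      using K[of s t] L[of s t] by (simp add: algebra_simps)
  qed
qed

lemma lipschitz_signal_mult:
  assumes "lipschitz_signal f" "lipschitz_signal g" "bounded_signal f" "bounded_signal g"
  shows "lipschitz_signal (\<lambda>t. f t * g t)"
proof -
  obtain K L where K: "\<And>s t. 0 \<le> s \<Longrightarrow> 0 \<le> t \<Longrightarrow> \<bar>f t - f s\<bar> \<le> K * \<bar>t - s\<bar>"
    and L: "\<And>s t. 0 \<le> s \<Longrightarrow> 0 \<le> t \<Longrightarrow> \<bar>g t - g s\<bar> \<le> L * \<bar>t - s\<bar>" and "K > 0" "L > 0"
    using assms by (auto elim!: lipschitz_signalE)
  obtain M N where M: "M > 0" "\<And>t. 0 \<le> t \<Longrightarrow> \<bar>f t\<bar> \<le> M" and N: "N > 0" "\<And>t. 0 \<le> t \<Longrightarrow> \<bar>g t\<bar> \<le> N"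
    using assms by (auto elim!: bounded_signalE)
  show ?thesis
  proof (rule lipschitz_signalI[of _ "M * L + N * K"])
    fix s t :: real assume st: "0 \<le> s" "s \<le> t"
    have "f t * g t - f s * g s = f t * (g t - g s) + g s * (f t - f s)" by (simp add: algebra_simps)
    then have "\<bar>f t * g t - f s * g s\<bar> \<le> \<bar>f t\<bar> * \<bar>g t - g s\<bar> + \<bar>g s\<bar> * \<bar>f t - f s\<bar>"
      by (metis abs_mult abs_triangle_ineq)
    also have "\<dots> \<le> M * (L * \<bar>t - s\<bar>) + N * (K * \<bar>t - s\<bar>)"
      using K[of s t] L[of s t] M N st by (intro add_mono mult_mono) auto
    also have "\<dots> = (M * L + N * K) * (t - s)" using st by (simp add: algebra_simps)
    finally show "\<bar>f t * g t - f s * g s\<bar> \<le> (M * L + N * K) * (t - s)" .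
  qed
qed

lemma lipschitz_signal_cmult:
  assumes "lipschitz_signal f"
  shows "lipschitz_signal (\<lambda>t. k * f t)"
proof -
  obtain K where K: "\<And>s t. 0 \<le> s \<Longrightarrow> 0 \<le> t \<Longrightarrow> \<bar>f t - f s\<bar> \<le> K * \<bar>t - s\<bar>"
    using assms by (auto elim!: lipschitz_signalE)
  show ?thesis
  proof (rule lipschitz_signalI[of _ "\<bar>k\<bar> * K"])
    fix s t :: real assume st: "0 \<le> s" "s \<le> t"
    have "\<bar>k * f t - k * f s\<bar> = \<bar>k\<bar> * \<bar>f t - f s\<bar>" by (metis abs_mult right_diff_distrib)
    also have "\<dots> \<le> \<bar>k\<bar> * (K * (t - s))" using K[of s t] st by (intro mult_left_mono) auto
    finally show "\<bar>k * f t - k * f s\<bar> \<le> \<bar>k\<bar> * K * (t - s)" by (simp add: mult.assoc)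
  qed
qed

lemma lipschitz_signal_diff:
  assumes "lipschitz_signal f" "lipschitz_signal g"
  shows "lipschitz_signal (\<lambda>t. f t - g t)"
  using lipschitz_signal_add[OF assms(1) lipschitz_signal_cmult[OF assms(2), of "-1"]] by simp

lemma lipschitz_signal_sum:
  assumes "\<And>i. i \<in> A \<Longrightarrow> lipschitz_signal (f i)"
  shows "lipschitz_signal (\<lambda>t. \<Sum>i\<in>A. f i t)"
  using assms by (induction A rule: infinite_finite_induct) (auto intro: lipschitz_signal_add)

lemma lipschitz_signal_dominated:
  assumes "lipschitz_signal f" and "\<And>s t. 0 \<le> s \<Longrightarrow> 0 \<le> t \<Longrightarrow> \<bar>y t - y s\<bar> \<le> k * \<bar>f t - f s\<bar>" and "k \<ge> 0"
  shows "lipschitz_signal y"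
proof -
  obtain K where K: "\<And>s t. 0 \<le> s \<Longrightarrow> 0 \<le> t \<Longrightarrow> \<bar>f t - f s\<bar> \<le> K * \<bar>t - s\<bar>"
    using assms by (auto elim!: lipschitz_signalE)
  show ?thesis
  proof (rule lipschitz_signalI[of _ "k * K"])
    fix s t :: real assume st: "0 \<le> s" "s \<le> t"
    have "\<bar>y t - y s\<bar> \<le> k * \<bar>f t - f s\<bar>" using st by (intro assms) auto
    also have "\<dots> \<le> k * (K * (t - s))" using K[of s t] st \<open>k \<ge> 0\<close> by (intro mult_left_mono) auto
    finally show "\<bar>y t - y s\<bar> \<le> k * K * (t - s)" by (simp add: mult.assoc)
  qed
qed

lemma caratheodory_rate_lipschitz:
  assumes "caratheodory_rate y f" "bounded_signal f"
  shows "lipschitz_signal y"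
proof -
  obtain K where K: "\<And>t. 0 \<le> t \<Longrightarrow> \<bar>f t\<bar> \<le> K" using assms(2) by (rule bounded_signalE) (rule that)
  show ?thesis
  proof (rule lipschitz_signalI[of _ K])
    fix s t :: real assume st: "0 \<le> s" "s \<le> t"
    have "y t - y s \<le> K * (t - s)"
      using st K by (intro caratheodory_rate_le[OF assms(1)]) (smt (verit))+
    moreover have "- K * (t - s) \<le> y t - y s"
      using st K by (intro caratheodory_rate_ge[OF assms(1)]) (smt (verit))+
    ultimately show "\<bar>y t - y s\<bar> \<le> K * (t - s)" by (simp add: abs_le_iff)
  qed
qed

text \<open>
  A convergent function cannot have a rate that stays above a positive constant on infinitely many
  intervals of a fixed length. The bound by a Lipschitz minorant \<open>q\<close> of the rate serves both the
  dissipation inequality and the usual form of Barbalat's lemma.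
\<close>

lemma barbalat_le:
  assumes y: "caratheodory_rate y f" and lim: "(y \<longlongrightarrow> L) at_top"
    and q: "lipschitz_signal q" "\<And>t. t \<ge> 0 \<Longrightarrow> q t \<le> f t" and "\<epsilon> > 0"
  shows "\<forall>\<^sub>F t in at_top. q t < \<epsilon>"
proof -
  obtain K where K: "K > 0" "\<And>s t. 0 \<le> s \<Longrightarrow> 0 \<le> t \<Longrightarrow> \<bar>q t - q s\<bar> \<le> K * \<bar>t - s\<bar>"
    using q(1) by (rule lipschitz_signalE) (rule that)
  \<comment> \<open>Within time \<open>\<delta>\<close> the minorant cannot fall from \<open>\<epsilon>\<close> below \<open>\<epsilon> / 2\<close>.\<close>
  define \<delta> where "\<delta> = \<epsilon> / (2 * K)"
  have "\<delta> > 0" "K * \<delta> = \<epsilon> / 2" using \<open>\<epsilon> > 0\<close> \<open>K > 0\<close> by (auto simp: \<delta>_def)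
  have "\<forall>\<^sub>F t in at_top. dist (y t) L < \<delta> * \<epsilon> / 4"
    using \<open>\<delta> > 0\<close> \<open>\<epsilon> > 0\<close> by (intro tendstoD[OF lim]) auto
  then obtain T where T: "\<And>t. t \<ge> T \<Longrightarrow> dist (y t) L < \<delta> * \<epsilon> / 4"
    unfolding eventually_at_top_linorder by blast
  have "q t < \<epsilon>" if t: "t \<ge> max T 0" for t
  proof (rule ccontr)
    assume "\<not> q t < \<epsilon>"
    have "\<epsilon> / 2 \<le> f s" if s: "t < s" "s < t + \<delta>" for s
    proof -
      have "\<bar>q s - q t\<bar> \<le> K * \<bar>s - t\<bar>" using s t by (intro K(2)) auto
      also have "\<dots> \<le> K * \<delta>" using K(1) s by (intro mult_left_mono) auto
      finally have "\<epsilon> / 2 \<le> q s" using \<open>\<not> q t < \<epsilon>\<close> \<open>K * \<delta> = \<epsilon> / 2\<close> by linarith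
      then show ?thesis using q(2)[of s] s t by simp
    qed
    then have "\<epsilon> / 2 * (t + \<delta> - t) \<le> y (t + \<delta>) - y t"
      using t \<open>\<delta> > 0\<close> by (intro caratheodory_rate_ge[OF y]) auto
    moreover have "y (t + \<delta>) - y t < \<delta> * \<epsilon> / 4 + \<delta> * \<epsilon> / 4"
      using T[of t] T[of "t + \<delta>"] t \<open>\<delta> > 0\<close> by (auto simp: dist_real_def abs_real_def split: if_splits)
    ultimately show False by (simp add: field_simps)
  qed
  then show ?thesis unfolding eventually_at_top_linorder by blast
qed

lemma tendsto_0_if_eventually_between:
  fixes q :: "real \<Rightarrow> real"
  assumes "\<And>\<epsilon>. \<epsilon> > 0 \<Longrightarrow> \<forall>\<^sub>F t in at_top. q t < \<epsilon>" "\<And>\<epsilon>. \<epsilon> > 0 \<Longrightarrow> \<forall>\<^sub>F t in at_top. - q t < \<epsilon>"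
  shows "(q \<longlongrightarrow> 0) at_top"
proof (rule tendstoI)
  fix e :: real assume "e > 0"
  show "\<forall>\<^sub>F t in at_top. dist (q t) 0 < e"
    using assms(1)[OF \<open>e > 0\<close>] assms(2)[OF \<open>e > 0\<close>]
    by (rule eventually_elim2) auto
qed

lemma barbalat:
  assumes y: "caratheodory_rate y f" and lim: "(y \<longlongrightarrow> L) at_top" and f: "lipschitz_signal f"
  shows "(f \<longlongrightarrow> 0) at_top"
proof (rule tendsto_0_if_eventually_between)
  fix \<epsilon> :: real assume "\<epsilon> > 0"
  then show "\<forall>\<^sub>F t in at_top. f t < \<epsilon>" by (intro barbalat_le[OF y lim f]) auto
  show "\<forall>\<^sub>F t in at_top. - f t < \<epsilon>"
    using \<open>\<epsilon> > 0\<close> lipschitz_signal_cmult[OF f, of "-1"]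
    by (intro barbalat_le[OF caratheodory_rate_minus[OF y] tendsto_minus[OF lim]]) auto
qed

lemma antimono_bounded_tendsto:
  fixes y :: "real \<Rightarrow> real"
  assumes dec: "\<And>s t. 0 \<le> s \<Longrightarrow> s \<le> t \<Longrightarrow> y t \<le> y s" and bdd: "\<And>t. t \<ge> 0 \<Longrightarrow> b \<le> y t"
  obtains L where "(y \<longlongrightarrow> L) at_top" "\<And>t. t \<ge> 0 \<Longrightarrow> L \<le> y t" "b \<le> L"
proof
  have B: "bdd_below (y ` {0..})" using bdd by (auto simp: bdd_below_def)
  define L where "L = Inf (y ` {0..})"
  show le: "L \<le> y t" if "t \<ge> 0" for t
    unfolding L_def using that by (intro cInf_lower[OF _ B]) auto
  show "b \<le> L" unfolding L_def using bdd by (intro cInf_greatest) auto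
  show "(y \<longlongrightarrow> L) at_top"
  proof (rule order_tendstoI)
    fix a assume "a < L"
    then have "a < y t" if "t \<ge> 0" for t using le[OF that] by simp
    then show "\<forall>\<^sub>F t in at_top. a < y t" unfolding eventually_at_top_linorder by blast
  next
    fix a assume "L < a"
    then obtain s where "s \<ge> 0" "y s < a"
      unfolding L_def using cInf_less_iff[OF _ B] by auto
    then have "y t < a" if "t \<ge> s" for t using dec[of s t] that by simp
    then show "\<forall>\<^sub>F t in at_top. y t < a" unfolding eventually_at_top_linorder by blast
  qed
qed

lemma dissipation_vanishes:
  assumes y: "caratheodory_rate y f" and bdd: "\<And>t. t \<ge> 0 \<Longrightarrow> b \<le> y t"
    and q: "lipschitz_signal q" "\<And>t. t \<ge> 0 \<Longrightarrow> 0 \<le> q t" "\<And>t. t \<ge> 0 \<Longrightarrow> f t \<le> - q t"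
  shows "(q \<longlongrightarrow> 0) at_top"
proof -
  have "f t \<le> 0" if "t \<ge> 0" for t using q(2,3)[OF that] by linarith
  then have dec: "y t \<le> y s" if "0 \<le> s" "s \<le> t" for s t
    using that by (intro caratheodory_rate_decreasing[OF y]) auto
  obtain L where "(y \<longlongrightarrow> L) at_top"
    by (rule antimono_bounded_tendsto[of y b]) (use dec bdd that in auto)
  then have lim: "((\<lambda>t. - y t) \<longlongrightarrow> - L) at_top" by (rule tendsto_minus)
  show ?thesis
  proof (rule tendsto_0_if_eventually_between)
    fix \<epsilon> :: real assume "\<epsilon> > 0"
    show "\<forall>\<^sub>F t in at_top. q t < \<epsilon>"
    proof (rule barbalat_le[OF caratheodory_rate_minus[OF y] lim q(1) _ \<open>\<epsilon> > 0\<close>])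
      show "q t \<le> - f t" if "t \<ge> 0" for t using q(3)[OF that] by simp
    qed
    show "\<forall>\<^sub>F t in at_top. - q t < \<epsilon>"
      using eventually_ge_at_top[of 0] by eventually_elim (use q(2) \<open>\<epsilon> > 0\<close> in fastforce)
  qed
qed

text \<open>
  Compactness in the form needed for states that are families over finite sets of buses and lines.
\<close>

lemma finite_family_convergent_subseq:
  fixes z :: "'i \<Rightarrow> nat \<Rightarrow> real"
  assumes "finite A" "\<And>i. i \<in> A \<Longrightarrow> bounded (range (z i))"
  obtains \<rho> where "strict_mono \<rho>" "\<And>i. i \<in> A \<Longrightarrow> convergent (\<lambda>n. z i (\<rho> n))"
  using assms
proof (induction A arbitrary: thesis rule: finite_induct)
  case empty
  then show ?case using strict_mono_id by auto
next
  case (insert a A)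
  obtain \<rho> where \<rho>: "strict_mono \<rho>" "\<And>i. i \<in> A \<Longrightarrow> convergent (\<lambda>n. z i (\<rho> n))"
    using insert by blast
  have "bounded (range (\<lambda>n. z a (\<rho> n)))"
    using insert.prems(2)[of a] by (rule bounded_subset) auto
  then obtain l r where r: "strict_mono r" "((\<lambda>n. z a (\<rho> n)) \<circ> r) \<longlonglongrightarrow> l"
    using bounded_imp_convergent_subsequence by blast
  show ?case
  proof (rule insert.prems(1))
    show "strict_mono (\<rho> \<circ> r)" using \<rho>(1) r(1) by (rule strict_mono_o)
    fix i assume i: "i \<in> insert a A"
    show "convergent (\<lambda>n. z i ((\<rho> \<circ> r) n))"
    proof (cases "i = a")
      case True
      then show ?thesis using r(2) by (auto simp: convergent_def o_def)
    next
      case False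
      then show ?thesis
        using convergent_subseq_convergent[OF \<rho>(2) r(1), of i] i by (auto simp: o_def)
    qed
  qed
qed

section \<open>Outflows and connectedness\<close>

lemma net_outflow_linear:
  "net_outflow A (\<lambda>e. a * f e + b * g e) i = a * net_outflow A f i + b * net_outflow A g i"
  by (simp add: net_outflow_def sum.distrib sum_distrib_left algebra_simps)

lemma net_outflow_cong:
  "(\<And>e. e \<in> A \<Longrightarrow> f e = g e) \<Longrightarrow> net_outflow A f i = net_outflow A g i"
  unfolding net_outflow_def by (intro arg_cong2[of _ _ _ _ "(-)"] sum.cong) auto

lemma net_outflow_diff: "net_outflow A (\<lambda>e. f e - g e) i = net_outflow A f i - net_outflow A g i"
  using net_outflow_linear[of A 1 f "-1" g i] by simp

text \<open>
  Summation by parts on a graph: the outflow operator is the transpose of taking differences along arcs.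
\<close>

lemma sum_mult_net_outflow:
  assumes N: "finite N" and A: "A \<subseteq> N \<times> N"
  shows "(\<Sum>i\<in>N. x i * net_outflow A f i) = (\<Sum>e\<in>A. (x (fst e) - x (snd e)) * f e)"
proof -
  have fin: "finite A" using finite_subset[OF A] N by simp
  have 1: "(\<Sum>i\<in>N. x i * (\<Sum>j | (i, j) \<in> A. f (i, j))) = (\<Sum>e\<in>A. x (fst e) * f e)"
  proof -
    have "(\<Sum>i\<in>N. x i * (\<Sum>j | (i, j) \<in> A. f (i, j))) = (\<Sum>i\<in>N. \<Sum>j | (i, j) \<in> A. x i * f (i, j))"
      by (simp add: sum_distrib_left)
    also have "\<dots> = (\<Sum>(i, j)\<in>(SIGMA i:N. {j. (i, j) \<in> A}). x i * f (i, j))"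
      using N A by (intro sum.Sigma) (auto intro: finite_subset[of _ N])
    also have "(SIGMA i:N. {j. (i, j) \<in> A}) = A" using A by auto
    finally show ?thesis by (simp add: case_prod_beta)
  qed
  have 2: "(\<Sum>i\<in>N. x i * (\<Sum>k | (k, i) \<in> A. f (k, i))) = (\<Sum>e\<in>A. x (snd e) * f e)"
  proof -
    have "(\<Sum>i\<in>N. x i * (\<Sum>k | (k, i) \<in> A. f (k, i))) = (\<Sum>i\<in>N. \<Sum>k | (k, i) \<in> A. x i * f (k, i))"
      by (simp add: sum_distrib_left)
    also have "\<dots> = (\<Sum>(i, k)\<in>(SIGMA i:N. {k. (k, i) \<in> A}). x i * f (k, i))"
      using N A by (intro sum.Sigma) (auto intro: finite_subset[of _ N])
    also have "\<dots> = (\<Sum>e\<in>A. x (snd e) * f e)"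
      using A by (intro sum.reindex_bij_witness[of _ prod.swap prod.swap]) auto
    finally show ?thesis .
  qed
  show ?thesis
    unfolding net_outflow_def
    by (simp add: right_diff_distrib left_diff_distrib sum_subtractf 1 2)
qed

lemma tendsto_net_outflow:
  assumes "\<And>e. e \<in> A \<Longrightarrow> ((\<lambda>t. f t e) \<longlongrightarrow> g e) \<F>"
  shows "((\<lambda>t. net_outflow A (f t) i) \<longlongrightarrow> net_outflow A g i) \<F>"
  unfolding net_outflow_def by (intro tendsto_intros assms) simp_all

lemma angle_flow_eq: "angle_flow net \<theta> e = suscept net e * (\<theta> (fst e) - \<theta> (snd e))"
  by (cases e) (simp add: angle_flow_def)

lemma sum_mult_angle_outflow:
  assumes "finite N" "A \<subseteq> N \<times> N"
  shows "(\<Sum>i\<in>N. x i * net_outflow A (angle_flow net h) i)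
    = (\<Sum>i\<in>N. h i * net_outflow A (angle_flow net x) i)"
  by (simp add: sum_mult_net_outflow[OF assms] angle_flow_eq mult_ac)

lemma net_outflow_angle_shift:
  "net_outflow A (angle_flow net (\<lambda>i. s * h i + \<psi> i)) i =
    s * net_outflow A (angle_flow net h) i + net_outflow A (angle_flow net \<psi>) i"
proof -
  have "angle_flow net (\<lambda>i. s * h i + \<psi> i) = (\<lambda>e. s * angle_flow net h e + 1 * angle_flow net \<psi> e)"
    by (auto simp: angle_flow_eq algebra_simps)
  then show ?thesis
    using net_outflow_linear[of A s "angle_flow net h" 1 "angle_flow net \<psi>" i] by simp
qed

context power_network
begin

lemma finite_buses: "finite (buses net)"
  using finite_grid by (rule pair_fin_digraph.pair_finite_verts)

lemma finite_lines: "finite (lines net)"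
  using finite_grid by (rule pair_fin_digraph.pair_finite_arcs)

lemma lines_subset: "lines net \<subseteq> buses net \<times> buses net"
proof -
  interpret pair_fin_digraph "grid net" by (rule finite_grid)
  show ?thesis using arc_fst_in_verts arc_snd_in_verts by (force simp: mem_Times_iff)
qed

lemma line_ends: "e \<in> lines net \<Longrightarrow> fst e \<in> buses net" "e \<in> lines net \<Longrightarrow> snd e \<in> buses net"
  using lines_subset by auto

lemma inner_lines_subset: "inner_lines net \<subseteq> lines net"
  by (auto simp: inner_lines_def)

lemma finite_inner_lines: "finite (inner_lines net)"
  using finite_subset[OF inner_lines_subset finite_lines] .

lemma inner_lines_buses: "inner_lines net \<subseteq> buses net \<times> buses net"
  using inner_lines_subset lines_subset by blast

lemma line_suscept_pos: "e \<in> lines net \<Longrightarrow> suscept net e > 0"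
  by (cases e) (auto intro: suscept_pos)

lemma buses_nonempty: "buses net \<noteq> {}"
  using connected_grid by (auto simp: connected_def strongly_connected_def mk_symmetric_def)

text \<open>
  The form in which connectedness of the grid is used: an equivalence that holds along lines holds
  between all buses.
\<close>

lemma connected_equivalence:
  assumes refl: "\<And>i. i \<in> buses net \<Longrightarrow> Q i i"
    and sym: "\<And>i j. Q i j \<Longrightarrow> Q j i" and trans: "\<And>i j k. Q i j \<Longrightarrow> Q j k \<Longrightarrow> Q i k"
    and line: "\<And>e. e \<in> lines net \<Longrightarrow> Q (fst e) (snd e)"
    and "i \<in> buses net" "j \<in> buses net"
  shows "Q i j"
proof -
  let ?S = "with_proj (mk_symmetric (with_proj (grid net)))"
  have ends: "arcs_ends ?S = (\<Union>e\<in>lines net. {(fst e, snd e), (snd e, fst e)})"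
    by (simp add: mk_symmetric_def)
  have "i \<rightarrow>\<^sup>*\<^bsub>?S\<^esub> j"
    using connected_grid assms(5,6) by (auto simp: connected_def strongly_connected_def mk_symmetric_def)
  then have "(i, j) \<in> rtrancl_on (verts ?S) (arcs_ends ?S)" by (simp add: reachable_def)
  then show ?thesis
  proof (induction rule: rtrancl_on_induct)
    case base
    then show ?case using refl \<open>i \<in> buses net\<close> by simp
  next
    case (step y z)
    have "Q y z" using step.hyps(2) line sym unfolding ends by auto
    then show ?case using step.IH trans by blast
  qed
qed

end

section \<open>Farkas' lemma\<close>

definition linear_functional :: "(('n \<Rightarrow> real) \<Rightarrow> real) \<Rightarrow> bool" where
  "linear_functional a \<longleftrightarrow> (\<forall>k x y. a (\<lambda>i. k * x i + y i) = k * a x + a y)"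

lemma linear_functionalD: "linear_functional a \<Longrightarrow> a (\<lambda>i. k * x i + y i) = k * a x + a y"
  by (simp add: linear_functional_def)

lemma linear_functional_zero: "linear_functional a \<Longrightarrow> a (\<lambda>i. 0) = 0"
  using linear_functionalD[of a 0 "\<lambda>i. 0" "\<lambda>i. 0"] linear_functionalD[of a "-1" "\<lambda>i. 0" "\<lambda>i. 0"] by simp

lemma linear_functional_scale: "linear_functional a \<Longrightarrow> a (\<lambda>i. k * x i) = k * a x"
  using linear_functionalD[of a k x "\<lambda>i. 0"] linear_functional_zero[of a] by simp

text \<open>
  Bartl's induction on the number of functionals. If dropping \<open>a m\<close> destroys the implication, there is
  a \<open>y\<close> with \<open>a m y = 1\<close> that satisfies the other constraints and has \<open>b y > 0\<close>; subtracting
  \<open>a m x * y\<close> projects every \<open>x\<close> to the kernel of \<open>a m\<close>, where the induction hypothesis applies, and the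
  coefficient that \<open>a m\<close> receives is nonnegative.
\<close>

lemma farkas:
  fixes a :: "'k \<Rightarrow> ('n \<Rightarrow> real) \<Rightarrow> real"
  assumes "finite K" "\<And>k. k \<in> K \<Longrightarrow> linear_functional (a k)" "linear_functional b"
    and "\<And>x. (\<And>k. k \<in> K \<Longrightarrow> a k x \<le> 0) \<Longrightarrow> b x \<le> 0"
  shows "\<exists>w. (\<forall>k\<in>K. w k \<ge> 0) \<and> (\<forall>x. b x = (\<Sum>k\<in>K. w k * a k x))"
  using assms
proof (induction K arbitrary: a b rule: finite_induct)
  case empty
  have "b x = 0" for x
    using empty(3)[of x] empty(3)[of "\<lambda>i. - 1 * x i"] linear_functional_scale[OF empty(2), of "-1" x] by simp
  then show ?case by simp
next
  case (insert m K)
  show ?case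
  proof (cases "\<forall>x. (\<forall>k\<in>K. a k x \<le> 0) \<longrightarrow> b x \<le> 0")
    case True
    then obtain w where w: "\<forall>k\<in>K. w k \<ge> 0" "\<forall>x. b x = (\<Sum>k\<in>K. w k * a k x)"
      using insert.IH[of a b] insert.prems by auto
    have "(\<Sum>k\<in>K. (w(m := 0)) k * a k x) = (\<Sum>k\<in>K. w k * a k x)" for x
      using insert.hyps by (intro sum.cong) auto
    then show ?thesis
      using w insert.hyps by (intro exI[of _ "w(m := 0)"]) auto
  next
    case False
    then obtain z where z: "\<forall>k\<in>K. a k z \<le> 0" "b z > 0" by auto
    have "a m z > 0" using insert.prems(3)[of z] z by force
    \<comment> \<open>Normalized so that \<open>a m y = 1\<close>.\<close>
    define y where "y = (\<lambda>i. (1 / a m z) * z i)"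
    have a_y: "a k y = a k z / a m z" if "k \<in> insert m K" for k
      unfolding y_def linear_functional_scale[OF insert.prems(1)[OF that]] by simp
    have b_y: "b y = b z / a m z"
      unfolding y_def linear_functional_scale[OF insert.prems(2)] by simp
    have y: "\<forall>k\<in>K. a k y \<le> 0" "b y > 0" "a m y = 1"
      using z \<open>a m z > 0\<close> a_y b_y by (auto simp: divide_nonpos_pos)
    define a' where "a' k x = a k x - a m x * a k y" for k x
    define b' where "b' x = b x - a m x * b y" for x
    have a'_eq: "a' k x = a k (\<lambda>i. - a m x * y i + x i)" if "k \<in> insert m K" for k x
      unfolding a'_def using linear_functionalD[OF insert.prems(1)[OF that], of "- a m x" y x] by simp
    have b'_eq: "b' x = b (\<lambda>i. - a m x * y i + x i)" for x
      unfolding b'_def using linear_functionalD[OF insert.prems(2), of "- a m x" y x] by simp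
    have "\<exists>w. (\<forall>k\<in>K. w k \<ge> 0) \<and> (\<forall>x. b' x = (\<Sum>k\<in>K. w k * a' k x))"
    proof (rule insert.IH)
      show "linear_functional (a' k)" if "k \<in> K" for k
        using that insert.prems(1)[of k] insert.prems(1)[of m]
        by (auto simp: linear_functional_def a'_def algebra_simps)
      show "linear_functional b'"
        using insert.prems(2) insert.prems(1)[of m]
        by (auto simp: linear_functional_def b'_def algebra_simps)
      fix x assume x: "\<And>k. k \<in> K \<Longrightarrow> a' k x \<le> 0"
      have "a' m x = 0" using y by (simp add: a'_def)
      show "b' x \<le> 0"
        unfolding b'_eq
      proof (rule insert.prems(3))
        fix k assume k: "k \<in> insert m K"
        show "a k (\<lambda>i. - a m x * y i + x i) \<le> 0"
          using k x \<open>a' m x = 0\<close> unfolding a'_eq[OF k, symmetric] by auto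
      qed
    qed
    then obtain w where w: "\<forall>k\<in>K. w k \<ge> 0" "\<forall>x. b' x = (\<Sum>k\<in>K. w k * a' k x)" by blast
    define l0 where "l0 = b y - (\<Sum>k\<in>K. w k * a k y)"
    have "(\<Sum>k\<in>K. w k * a k y) \<le> 0"
      using w y by (intro sum_nonpos) (auto simp: mult_nonneg_nonpos)
    then have "l0 \<ge> 0" using y by (simp add: l0_def)
    have "b x = (\<Sum>k\<in>insert m K. (w(m := l0)) k * a k x)" for x
    proof -
      have "b x = b' x + a m x * b y" by (simp add: b'_def)
      also have "b' x = (\<Sum>k\<in>K. w k * a k x) - a m x * (\<Sum>k\<in>K. w k * a k y)"
        using w(2) by (simp add: a'_def right_diff_distrib sum_subtractf sum_distrib_left mult_ac)
      finally have "b x = l0 * a m x + (\<Sum>k\<in>K. w k * a k x)" by (simp add: l0_def algebra_simps)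
      also have "(\<Sum>k\<in>K. w k * a k x) = (\<Sum>k\<in>K. (w(m := l0)) k * a k x)"
        using insert.hyps by (intro sum.cong) auto
      finally show ?thesis using insert.hyps by simp
    qed
    then show ?thesis using w(1) \<open>l0 \<ge> 0\<close> by (intro exI[of _ "w(m := l0)"]) auto
  qed
qed

section \<open>Minimum and saddle point of optimal load control\<close>

text \<open>
  Flows determine angles only up to a constant on each component, so a sequence of angles may diverge
  although its flows converge. Convergence of differences is an equivalence relation; subtracting the
  angle at a representative of each class yields a convergent sequence with the same flows.
\<close>

lemma limit_of_differences:
  fixes \<psi> :: "nat \<Rightarrow> 'n \<Rightarrow> real"
  obtains \<psi>' where "\<And>i j. convergent (\<lambda>n. \<psi> n i - \<psi> n j) \<Longrightarrow> (\<lambda>n. \<psi> n i - \<psi> n j) \<longlonglongrightarrow> \<psi>' i - \<psi>' j"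
proof -
  define Q where "Q i j \<longleftrightarrow> convergent (\<lambda>n. \<psi> n i - \<psi> n j)" for i j
  have Q_refl: "Q i i" for i by (simp add: Q_def convergent_const)
  have Q_sym: "Q j i" if "Q i j" for i j
    using convergent_minus_iff[of "\<lambda>n. \<psi> n i - \<psi> n j"] that by (simp add: Q_def)
  have Q_trans: "Q i k" if "Q i j" "Q j k" for i j k
    using convergent_add[of "\<lambda>n. \<psi> n i - \<psi> n j" "\<lambda>n. \<psi> n j - \<psi> n k"] that by (simp add: Q_def)
  define rep where "rep i = (SOME j. Q i j)" for i
  have rep: "Q i (rep i)" for i unfolding rep_def by (rule someI[of _ i]) (rule Q_refl)
  have rep_eq: "rep i = rep j" if "Q i j" for i j
  proof -
    have "Q i = Q j" using that Q_sym Q_trans by blast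
    then show ?thesis by (simp add: rep_def)
  qed
  define \<psi>' where "\<psi>' i = lim (\<lambda>n. \<psi> n i - \<psi> n (rep i))" for i
  have lim: "(\<lambda>n. \<psi> n i - \<psi> n (rep i)) \<longlonglongrightarrow> \<psi>' i" for i
    using rep[of i] unfolding Q_def \<psi>'_def convergent_LIMSEQ_iff .
  show thesis
  proof (rule that)
    fix i j assume "convergent (\<lambda>n. \<psi> n i - \<psi> n j)"
    then have "rep i = rep j" using rep_eq by (simp add: Q_def)
    then show "(\<lambda>n. \<psi> n i - \<psi> n j) \<longlonglongrightarrow> \<psi>' i - \<psi>' j"
      using tendsto_diff[OF lim[of i] lim[of j]] by simp
  qed
qed

text \<open>
  In (OLC) the angles determine the load, so the problem is treated as a minimization over the angles
  alone.
\<close>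

definition balanced_load :: "'n network \<Rightarrow> ('n \<Rightarrow> real) \<Rightarrow> 'n \<Rightarrow> real" where
  "balanced_load net \<psi> i = injection net i - net_outflow (inner_lines net) (angle_flow net \<psi>) i"

definition angle_feasible :: "'n network \<Rightarrow> ('n \<Rightarrow> real) \<Rightarrow> bool" where
  "angle_feasible net \<psi> \<longleftrightarrow>
    (\<forall>i \<in> buses net. load_min net i \<le> balanced_load net \<psi> i \<and> balanced_load net \<psi> i \<le> load_max net i) \<and>
    (\<forall>e \<in> inner_lines net.
       flow_min net e \<le> angle_flow net \<psi> e \<and> angle_flow net \<psi> e \<le> flow_max net e)"

context power_network
begin

text \<open>
  Along a minimizing sequence the flows are bounded by the line limits, so they converge along a
  subsequence; loads and costs are continuous functions of the flows.
\<close>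

lemma angle_optimum_exists:
  fixes c :: "'n \<Rightarrow> real \<Rightarrow> real"
  assumes cont: "\<And>i. i \<in> buses net \<Longrightarrow> continuous_on UNIV (c i)"
    and feas: "angle_feasible net \<theta>"
  obtains \<psi> where "angle_feasible net \<psi>"
    "\<And>\<theta>. angle_feasible net \<theta> \<Longrightarrow>
      (\<Sum>i\<in>buses net. c i (balanced_load net \<psi> i)) \<le> (\<Sum>i\<in>buses net. c i (balanced_load net \<theta> i))"
proof -
  let ?J = "\<lambda>\<psi>. \<Sum>i\<in>buses net. c i (balanced_load net \<psi> i)"
  define S where "S = ?J ` {\<psi>. angle_feasible net \<psi>}"
  have "\<exists>b. \<forall>d\<in>{load_min net i..load_max net i}. b \<le> c i d" if "i \<in> buses net" for i
  proof -
    have "compact (c i ` {load_min net i..load_max net i})"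
      using cont[OF that] continuous_on_subset by (intro compact_continuous_image) auto
    then have "bdd_below (c i ` {load_min net i..load_max net i})"
      by (intro bounded_imp_bdd_below compact_imp_bounded)
    then show ?thesis by (auto simp: bdd_below_def)
  qed
  then obtain b where b: "\<And>i d. i \<in> buses net \<Longrightarrow> d \<in> {load_min net i..load_max net i} \<Longrightarrow> b i \<le> c i d"
    by metis
  have S_bdd: "bdd_below S"
    unfolding S_def bdd_below_def angle_feasible_def
    by (intro exI[of _ "\<Sum>i\<in>buses net. b i"]) (auto intro!: sum_mono b)
  have S_ne: "S \<noteq> {}" using feas by (auto simp: S_def)
  have "\<exists>\<psi>. angle_feasible net \<psi> \<and> ?J \<psi> < Inf S + 1 / real (Suc n)" for n
  proof -
    have "Inf S < Inf S + 1 / real (Suc n)" by simp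
    then obtain s where "s \<in> S" "s < Inf S + 1 / real (Suc n)"
      using cInf_less_iff[OF S_ne S_bdd] by blast
    then show ?thesis by (auto simp: S_def)
  qed
  then obtain \<psi> where \<psi>: "\<And>n. angle_feasible net (\<psi> n)" "\<And>n. ?J (\<psi> n) < Inf S + 1 / real (Suc n)"
    by metis
  have "bounded (range (\<lambda>n. angle_flow net (\<psi> n) e))" if "e \<in> inner_lines net" for e
    using \<psi>(1) that
    by (intro bounded_subset[OF bounded_closed_interval[of "flow_min net e" "flow_max net e"]])
      (auto simp: angle_feasible_def)
  then obtain \<rho> where \<rho>: "strict_mono \<rho>"
    "\<And>e. e \<in> inner_lines net \<Longrightarrow> convergent (\<lambda>n. angle_flow net (\<psi> (\<rho> n)) e)"
    using finite_family_convergent_subseq[OF finite_inner_lines, of "\<lambda>e n. angle_flow net (\<psi> n) e"] by metis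
  obtain \<psi>' where \<psi>': "\<And>i j. convergent (\<lambda>n. \<psi> (\<rho> n) i - \<psi> (\<rho> n) j) \<Longrightarrow>
      (\<lambda>n. \<psi> (\<rho> n) i - \<psi> (\<rho> n) j) \<longlonglongrightarrow> \<psi>' i - \<psi>' j"
    using limit_of_differences[of "\<lambda>n. \<psi> (\<rho> n)"] by metis
  have flow: "(\<lambda>n. angle_flow net (\<psi> (\<rho> n)) e) \<longlonglongrightarrow> angle_flow net \<psi>' e" if e: "e \<in> inner_lines net" for e
  proof -
    have "suscept net e > 0" using e inner_lines_subset line_suscept_pos by blast
    then have "convergent (\<lambda>n. \<psi> (\<rho> n) (fst e) - \<psi> (\<rho> n) (snd e))"
      using \<rho>(2)[OF e] unfolding angle_flow_eq by (subst (asm) convergent_mult_const_iff) auto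
    then show ?thesis unfolding angle_flow_eq by (intro tendsto_intros \<psi>')
  qed
  have ld: "(\<lambda>n. balanced_load net (\<psi> (\<rho> n)) i) \<longlonglongrightarrow> balanced_load net \<psi>' i" for i
    unfolding balanced_load_def by (intro tendsto_intros tendsto_net_outflow flow)
  have "angle_feasible net \<psi>'"
    unfolding angle_feasible_def
  proof (intro conjI ballI)
    fix i assume i: "i \<in> buses net"
    show "load_min net i \<le> balanced_load net \<psi>' i"
      by (rule LIMSEQ_le_const[OF ld]) (use \<psi>(1) i in \<open>auto simp: angle_feasible_def\<close>)
    show "balanced_load net \<psi>' i \<le> load_max net i"
      by (rule LIMSEQ_le_const2[OF ld]) (use \<psi>(1) i in \<open>auto simp: angle_feasible_def\<close>)
  next
    fix e assume e: "e \<in> inner_lines net"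
    show "flow_min net e \<le> angle_flow net \<psi>' e"
      by (rule LIMSEQ_le_const[OF flow[OF e]]) (use \<psi>(1) e in \<open>auto simp: angle_feasible_def\<close>)
    show "angle_flow net \<psi>' e \<le> flow_max net e"
      by (rule LIMSEQ_le_const2[OF flow[OF e]]) (use \<psi>(1) e in \<open>auto simp: angle_feasible_def\<close>)
  qed
  moreover have "?J \<psi>' \<le> ?J \<theta>" if "angle_feasible net \<theta>" for \<theta>
  proof -
    have "(\<lambda>n. ?J (\<psi> (\<rho> n))) \<longlonglongrightarrow> ?J \<psi>'"
    proof (intro tendsto_sum)
      fix i assume "i \<in> buses net"
      then have "isCont (c i) (balanced_load net \<psi>' i)"
        using cont continuous_on_eq_continuous_at[of UNIV "c i"] by auto
      then show "(\<lambda>n. c i (balanced_load net (\<psi> (\<rho> n)) i)) \<longlonglongrightarrow> c i (balanced_load net \<psi>' i)"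
        using ld isCont_tendsto_compose by blast
    qed
    moreover have "(\<lambda>n. Inf S + 1 / real (Suc (\<rho> n))) \<longlonglongrightarrow> Inf S + 0"
      using LIMSEQ_subseq_LIMSEQ[OF LIMSEQ_inverse_real_of_nat \<rho>(1)]
      by (intro tendsto_intros) (simp add: o_def inverse_eq_divide)
    moreover have "\<exists>N. \<forall>n\<ge>N. ?J (\<psi> (\<rho> n)) \<le> Inf S + 1 / real (Suc (\<rho> n))"
      using \<psi>(2) less_imp_le by blast
    ultimately have "?J \<psi>' \<le> Inf S + 0" by (rule LIMSEQ_le)
    also have "\<dots> \<le> ?J \<theta>" using cInf_lower[OF _ S_bdd] that by (auto simp: S_def)
    finally show ?thesis .
  qed
  ultimately show thesis by (rule that)
qed

end

text \<open>
  The Karush-Kuhn-Tucker conditions of (R-OLC) at zero frequency. The multiplier of the physical power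
  balance is the frequency itself; \<open>m\<close> belongs to the balance with the virtual flows, \<open>gu\<close>, \<open>gl\<close> to the
  load limits and \<open>su\<close>, \<open>sl\<close> to the line limits.
\<close>

definition ROLC_saddle ::
  "'n network \<Rightarrow> ('n \<Rightarrow> real \<Rightarrow> real) \<Rightarrow> ('n \<Rightarrow> real) \<Rightarrow> ('n \<times> 'n \<Rightarrow> real) \<Rightarrow> ('n \<Rightarrow> real) \<Rightarrow>
    ('n \<Rightarrow> real) \<Rightarrow> ('n \<Rightarrow> real) \<Rightarrow> ('n \<Rightarrow> real) \<Rightarrow> ('n \<times> 'n \<Rightarrow> real) \<Rightarrow> ('n \<times> 'n \<Rightarrow> real) \<Rightarrow> bool" where
  "ROLC_saddle net c d P \<psi> m gu gl su sl \<longleftrightarrow>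
    ROLC_feasible net d (\<lambda>i. 0) P \<psi> \<and>
    (\<forall>i \<in> buses net. gu i \<ge> 0 \<and> gl i \<ge> 0 \<and>
       gu i * (d i - load_max net i) = 0 \<and> gl i * (load_min net i - d i) = 0 \<and>
       deriv (c i) (d i) = m i - gu i + gl i \<and>
       net_outflow (inner_lines net) (\<lambda>e. angle_flow net m e - suscept net e * (su e - sl e)) i = 0) \<and>
    (\<forall>e \<in> inner_lines net. su e \<ge> 0 \<and> sl e \<ge> 0 \<and>
       su e * (angle_flow net \<psi> e - flow_max net e) = 0 \<and>
       sl e * (flow_min net e - angle_flow net \<psi> e) = 0)"

text \<open>
  A direction that does not violate the active constraints to first order stays feasible for short
  steps; the constraints being affine, no curvature term arises.
\<close>

lemma eventually_le_right_of_slack: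
  fixes g a b :: real
  assumes "g \<le> b" "g = b \<Longrightarrow> a \<le> 0"
  shows "\<forall>\<^sub>F s in at_right 0. g + s * a \<le> b"
proof (cases "g = b")
  case True
  have "\<forall>\<^sub>F s::real in at_right 0. s > 0" by (simp add: eventually_at_right_less)
  then show ?thesis
    by eventually_elim (use True assms in \<open>auto simp: mult_nonneg_nonpos\<close>)
next
  case False
  have "((\<lambda>s. g + s * a) \<longlongrightarrow> g + 0 * a) (at_right 0)" by (intro tendsto_intros)
  then have "\<forall>\<^sub>F s in at_right 0. g + s * a < b"
    using False assms by (intro order_tendstoD(2)) auto
  then show ?thesis by eventually_elim auto
qed

context power_network
begin

text \<open>
  At the optimum no direction that respects the active constraints decreases the cost. Farkas' lemma
  turns this into multipliers for the active constraints, and inactive ones get the multiplier zero.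
\<close>

lemma angle_optimum_multipliers:
  fixes c :: "'n \<Rightarrow> real \<Rightarrow> real"
  assumes diff: "\<And>i s. i \<in> buses net \<Longrightarrow> c i field_differentiable (at s)"
    and feas: "angle_feasible net \<psi>"
    and opt: "\<And>\<theta>. angle_feasible net \<theta> \<Longrightarrow>
      (\<Sum>i\<in>buses net. c i (balanced_load net \<psi> i)) \<le> (\<Sum>i\<in>buses net. c i (balanced_load net \<theta> i))"
  obtains gu gl su sl where
    "\<And>i. i \<in> buses net \<Longrightarrow> gu i \<ge> 0 \<and> gl i \<ge> 0 \<and>
       gu i * (balanced_load net \<psi> i - load_max net i) = 0 \<and>
       gl i * (load_min net i - balanced_load net \<psi> i) = 0"
    "\<And>e. e \<in> inner_lines net \<Longrightarrow> su e \<ge> 0 \<and> sl e \<ge> 0 \<and>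
       su e * (angle_flow net \<psi> e - flow_max net e) = 0 \<and>
       sl e * (flow_min net e - angle_flow net \<psi> e) = 0"
    "\<And>h. (\<Sum>i\<in>buses net. (deriv (c i) (balanced_load net \<psi> i) + gu i - gl i) *
              net_outflow (inner_lines net) (angle_flow net h) i)
       = (\<Sum>e\<in>inner_lines net. (su e - sl e) * angle_flow net h e)"
proof -
  let ?L = "\<lambda>h i. net_outflow (inner_lines net) (angle_flow net h) i"
  let ?d = "balanced_load net \<psi>"
  let ?f = "angle_flow net \<psi>"
  let ?N = "buses net" and ?F = "inner_lines net"
  have L_lin: "?L (\<lambda>i. s * h i + \<theta> i) i = s * ?L h i + ?L \<theta> i" for s h \<theta> i
    by (rule net_outflow_angle_shift)
  have f_lin: "angle_flow net (\<lambda>i. s * h i + \<theta> i) e = s * angle_flow net h e + angle_flow net \<theta> e" for s h \<theta> e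
    by (simp add: angle_flow_eq algebra_simps)
  define a :: "bool \<times> ('n + 'n \<times> 'n) \<Rightarrow> ('n \<Rightarrow> real) \<Rightarrow> real" where
    "a k h = (case k of (up, Inl i) \<Rightarrow> if up then - ?L h i else ?L h i
                      | (up, Inr e) \<Rightarrow> if up then angle_flow net h e else - angle_flow net h e)" for k h
  define K where "K = (\<lambda>i. (True, Inl i)) ` {i \<in> ?N. ?d i = load_max net i} \<union>
    (\<lambda>i. (False, Inl i)) ` {i \<in> ?N. ?d i = load_min net i} \<union>
    (\<lambda>e. (True, Inr e)) ` {e \<in> ?F. ?f e = flow_max net e} \<union>
    (\<lambda>e. (False, Inr e)) ` {e \<in> ?F. ?f e = flow_min net e}"
  define b where "b h = (\<Sum>i\<in>?N. deriv (c i) (?d i) * ?L h i)" for h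
  have "finite K" unfolding K_def using finite_buses finite_inner_lines by auto
  moreover have "linear_functional (a k)" for k
    unfolding linear_functional_def a_def by (auto split: prod.splits sum.splits simp: L_lin f_lin)
  moreover have "linear_functional b"
    unfolding linear_functional_def b_def L_lin
    by (simp add: distrib_left sum.distrib sum_distrib_left mult_ac)
  moreover have "b h \<le> 0" if h: "\<And>k. k \<in> K \<Longrightarrow> a k h \<le> 0" for h
  proof (rule ccontr)
    assume "\<not> b h \<le> 0"
    let ?\<theta> = "\<lambda>s i. s * h i + \<psi> i"
    have d_shift: "balanced_load net (?\<theta> s) i = ?d i + s * (- ?L h i)" for s i
      by (simp add: balanced_load_def L_lin)
    have f_shift: "angle_flow net (?\<theta> s) e = ?f e + s * angle_flow net h e" for s e
      by (simp add: f_lin)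
    have "\<forall>\<^sub>F s in at_right 0. \<forall>i\<in>?N. load_min net i \<le> balanced_load net (?\<theta> s) i"
    proof (intro eventually_ball_finite finite_buses ballI)
      fix i assume i: "i \<in> ?N"
      have "\<forall>\<^sub>F s in at_right 0. - ?d i + s * ?L h i \<le> - load_min net i"
        using feas i h[of "(False, Inl i)"]
        by (intro eventually_le_right_of_slack) (auto simp: angle_feasible_def K_def a_def)
      then show "\<forall>\<^sub>F s in at_right 0. load_min net i \<le> balanced_load net (?\<theta> s) i"
        by eventually_elim (simp add: d_shift)
    qed
    moreover have "\<forall>\<^sub>F s in at_right 0. \<forall>i\<in>?N. balanced_load net (?\<theta> s) i \<le> load_max net i"
      unfolding d_shift
    proof (intro eventually_ball_finite finite_buses ballI eventually_le_right_of_slack)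
      fix i assume i: "i \<in> ?N"
      show "- ?L h i \<le> 0" if "?d i = load_max net i"
        using feas i h[of "(True, Inl i)"] that by (auto simp: angle_feasible_def K_def a_def)
      show "?d i \<le> load_max net i" using feas i by (auto simp: angle_feasible_def)
    qed
    moreover have "\<forall>\<^sub>F s in at_right 0. \<forall>e\<in>?F. flow_min net e \<le> angle_flow net (?\<theta> s) e"
    proof (intro eventually_ball_finite finite_inner_lines ballI)
      fix e assume e: "e \<in> ?F"
      have "\<forall>\<^sub>F s in at_right 0. - ?f e + s * (- angle_flow net h e) \<le> - flow_min net e"
        using feas e h[of "(False, Inr e)"]
        by (intro eventually_le_right_of_slack) (auto simp: angle_feasible_def K_def a_def)
      then show "\<forall>\<^sub>F s in at_right 0. flow_min net e \<le> angle_flow net (?\<theta> s) e"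
        by eventually_elim (simp add: f_shift)
    qed
    moreover have "\<forall>\<^sub>F s in at_right 0. \<forall>e\<in>?F. angle_flow net (?\<theta> s) e \<le> flow_max net e"
      unfolding f_shift
    proof (intro eventually_ball_finite finite_inner_lines ballI eventually_le_right_of_slack)
      fix e assume e: "e \<in> ?F"
      show "angle_flow net h e \<le> 0" if "?f e = flow_max net e"
        using e h[of "(True, Inr e)"] that by (auto simp: K_def a_def)
      show "?f e \<le> flow_max net e" using feas e by (auto simp: angle_feasible_def)
    qed
    ultimately have "\<forall>\<^sub>F s in at_right 0. angle_feasible net (?\<theta> s)"
      by eventually_elim (auto simp: angle_feasible_def)
    then have ev: "\<forall>\<^sub>F s in at_right 0. (\<Sum>i\<in>?N. c i (?d i)) \<le> (\<Sum>i\<in>?N. c i (?d i + s * (- ?L h i)))"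
    proof eventually_elim
      case (elim s)
      show ?case using opt[OF elim] unfolding d_shift .
    qed
    have der: "((\<lambda>s. \<Sum>i\<in>?N. c i (?d i + s * (- ?L h i))) has_real_derivative
        (\<Sum>i\<in>?N. deriv (c i) (?d i) * (- ?L h i))) (at 0)"
    proof (rule DERIV_sum)
      fix i assume i: "i \<in> ?N"
      have "(c i has_real_derivative deriv (c i) (?d i)) (at (?d i + 0 * (- ?L h i)))"
        using diff[OF i] by (simp add: DERIV_deriv_iff_field_differentiable)
      moreover have "((\<lambda>s. ?d i + s * (- ?L h i)) has_real_derivative (- ?L h i)) (at 0)"
        by (auto intro!: derivative_eq_intros)
      ultimately show "((\<lambda>s. c i (?d i + s * (- ?L h i))) has_real_derivative
          deriv (c i) (?d i) * (- ?L h i)) (at 0)"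
        by (rule DERIV_chain2)
    qed
    have neg: "(\<Sum>i\<in>?N. deriv (c i) (?d i) * (- ?L h i)) < 0"
      using \<open>\<not> b h \<le> 0\<close> by (simp add: b_def sum_negf)
    from DERIV_neg_dec_right[OF der neg] obtain \<delta> where \<delta>: "\<delta> > 0" "\<forall>s>0. s < \<delta> \<longrightarrow>
        (\<Sum>i\<in>?N. c i (?d i + (0 + s) * (- ?L h i))) < (\<Sum>i\<in>?N. c i (?d i + 0 * (- ?L h i)))"
      by blast
    then have "\<forall>\<^sub>F s in at_right 0. (\<Sum>i\<in>?N. c i (?d i + s * (- ?L h i))) < (\<Sum>i\<in>?N. c i (?d i))"
      by (intro eventually_at_rightI[of _ \<delta>]) auto
    with ev have "\<forall>\<^sub>F s::real in at_right 0. False" by eventually_elim simp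
    then show False by (simp add: trivial_limit_at_right_real)
  qed
  ultimately obtain w where w: "\<forall>k\<in>K. w k \<ge> 0" "\<forall>x. b x = (\<Sum>k\<in>K. w k * a k x)"
    using farkas[of K a b] by blast
  define w' where "w' k = (if k \<in> K then w k else 0)" for k
  have nonneg: "w' k \<ge> 0" for k using w(1) by (simp add: w'_def)
  show thesis
  proof (rule that[of "\<lambda>i. w' (True, Inl i)" "\<lambda>i. w' (False, Inl i)" "\<lambda>e. w' (True, Inr e)" "\<lambda>e. w' (False, Inr e)"])
    fix i assume "i \<in> ?N"
    then show "w' (True, Inl i) \<ge> 0 \<and> w' (False, Inl i) \<ge> 0 \<and>
       w' (True, Inl i) * (?d i - load_max net i) = 0 \<and> w' (False, Inl i) * (load_min net i - ?d i) = 0"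
      using nonneg by (auto simp: w'_def K_def)
  next
    fix e assume "e \<in> ?F"
    then show "w' (True, Inr e) \<ge> 0 \<and> w' (False, Inr e) \<ge> 0 \<and>
       w' (True, Inr e) * (?f e - flow_max net e) = 0 \<and> w' (False, Inr e) * (flow_min net e - ?f e) = 0"
      using nonneg by (auto simp: w'_def K_def)
  next
    fix h
    let ?U = "(UNIV :: bool set) \<times> (?N <+> ?F)"
    have "b h = (\<Sum>k\<in>K. w' k * a k h)" using w(2) by (simp add: w'_def)
    also have "\<dots> = (\<Sum>k\<in>?U. w' k * a k h)"
      using finite_buses finite_inner_lines
      by (intro sum.mono_neutral_left) (auto simp: K_def w'_def)
    also have "\<dots> = (\<Sum>up\<in>(UNIV :: bool set). \<Sum>k\<in>?N <+> ?F. w' (up, k) * a (up, k) h)"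
      by (simp add: sum.cartesian_product case_prod_beta)
    also have "\<dots> = (\<Sum>i\<in>?N. (w' (False, Inl i) - w' (True, Inl i)) * ?L h i)
        + (\<Sum>e\<in>?F. (w' (True, Inr e) - w' (False, Inr e)) * angle_flow net h e)"
      using finite_buses finite_inner_lines
      by (simp add: UNIV_bool sum.Plus a_def left_diff_distrib sum_subtractf sum_negf)
    finally show "(\<Sum>i\<in>?N. (deriv (c i) (?d i) + w' (True, Inl i) - w' (False, Inl i)) * ?L h i)
       = (\<Sum>e\<in>?F. (w' (True, Inr e) - w' (False, Inr e)) * angle_flow net h e)"
      by (simp add: b_def algebra_simps sum.distrib sum_subtractf)
  qed
qed

text \<open>
  The physical flows can be taken equal to the virtual flows on inner lines and zero on tie lines, which
  balances the power at zero frequency.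
\<close>

lemma ROLC_saddle_exists:
  fixes c :: "'n \<Rightarrow> real \<Rightarrow> real"
  assumes diff: "\<And>i s. i \<in> buses net \<Longrightarrow> c i field_differentiable (at s)"
    and "OLC_feasible net d0 \<theta>0"
  obtains d P \<psi> m gu gl su sl where "ROLC_saddle net c d P \<psi> m gu gl su sl"
    "\<And>d' \<theta>. OLC_feasible net d' \<theta> \<Longrightarrow> (\<Sum>i\<in>buses net. c i (d i)) \<le> (\<Sum>i\<in>buses net. c i (d' i))"
proof -
  let ?N = "buses net" and ?F = "inner_lines net"
  have feasible: "angle_feasible net \<theta> \<and> (\<forall>i\<in>?N. d i = balanced_load net \<theta> i)" if "OLC_feasible net d \<theta>" for d \<theta>
    using that by (auto simp: OLC_feasible_def angle_feasible_def balanced_load_def)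
  have "continuous_on UNIV (c i)" if "i \<in> ?N" for i
    using diff[OF that] by (auto intro!: continuous_at_imp_continuous_on field_differentiable_imp_continuous_at)
  then obtain \<psi> where feas: "angle_feasible net \<psi>" and opt: "\<And>\<theta>. angle_feasible net \<theta> \<Longrightarrow>
      (\<Sum>i\<in>?N. c i (balanced_load net \<psi> i)) \<le> (\<Sum>i\<in>?N. c i (balanced_load net \<theta> i))"
    by (rule angle_optimum_exists[of c \<theta>0]) (use feasible[OF assms(2)] that in auto)
  obtain gu gl su sl where
    g: "\<And>i. i \<in> ?N \<Longrightarrow> gu i \<ge> 0 \<and> gl i \<ge> 0 \<and>
       gu i * (balanced_load net \<psi> i - load_max net i) = 0 \<and>
       gl i * (load_min net i - balanced_load net \<psi> i) = 0" and
    s: "\<And>e. e \<in> ?F \<Longrightarrow> su e \<ge> 0 \<and> sl e \<ge> 0 \<and>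
       su e * (angle_flow net \<psi> e - flow_max net e) = 0 \<and>
       sl e * (flow_min net e - angle_flow net \<psi> e) = 0" and
    stat: "\<And>h. (\<Sum>i\<in>?N. (deriv (c i) (balanced_load net \<psi> i) + gu i - gl i) *
              net_outflow ?F (angle_flow net h) i) = (\<Sum>e\<in>?F. (su e - sl e) * angle_flow net h e)"
    by (rule angle_optimum_multipliers[OF diff feas opt]) (assumption, assumption, rule that)
  let ?d = "balanced_load net \<psi>"
  let ?P = "\<lambda>e. if e \<in> ?F then angle_flow net \<psi> e else 0"
  let ?m = "\<lambda>i. deriv (c i) (?d i) + gu i - gl i"
  have P: "net_outflow (lines net) ?P i = net_outflow ?F (angle_flow net \<psi>) i" if "i \<in> ?N" for i
  proof -
    have "(\<Sum>k | (i, k) \<in> lines net. ?P (i, k)) = (\<Sum>k | (i, k) \<in> ?F. angle_flow net \<psi> (i, k))"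
      using lines_subset inner_lines_subset finite_buses
      by (intro sum.mono_neutral_cong_right) (auto intro: finite_subset[of _ ?N])
    moreover have "(\<Sum>k | (k, i) \<in> lines net. ?P (k, i)) = (\<Sum>k | (k, i) \<in> ?F. angle_flow net \<psi> (k, i))"
      using lines_subset inner_lines_subset finite_buses
      by (intro sum.mono_neutral_cong_right) (auto intro: finite_subset[of _ ?N])
    ultimately show ?thesis unfolding net_outflow_def by simp
  qed
  have stat': "net_outflow ?F (\<lambda>e. angle_flow net ?m e - suscept net e * (su e - sl e)) i = 0" if i: "i \<in> ?N" for i
  proof -
    \<comment> \<open>Testing with a unit vector isolates the stationarity condition at bus \<open>i\<close>.\<close>
    let ?h = "\<lambda>j. if j = i then 1 else (0::real)"
    have "(\<Sum>j\<in>?N. ?m j * net_outflow ?F (angle_flow net ?h) j) = (\<Sum>j\<in>?N. ?h j * net_outflow ?F (angle_flow net ?m) j)"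
      by (rule sum_mult_angle_outflow[OF finite_buses inner_lines_buses])
    moreover have "(\<Sum>e\<in>?F. (su e - sl e) * angle_flow net ?h e) =
        (\<Sum>j\<in>?N. ?h j * net_outflow ?F (\<lambda>e. suscept net e * (su e - sl e)) j)"
      unfolding sum_mult_net_outflow[OF finite_buses inner_lines_buses] angle_flow_eq by (simp add: mult_ac)
    ultimately have "(\<Sum>j\<in>?N. ?h j * net_outflow ?F (angle_flow net ?m) j)
        = (\<Sum>j\<in>?N. ?h j * net_outflow ?F (\<lambda>e. suscept net e * (su e - sl e)) j)"
      using stat[of ?h] by simp
    then show ?thesis using i finite_buses by (simp add: net_outflow_diff if_distrib[of "\<lambda>x. x * _"] cong: if_cong)
  qed
  show thesis
  proof (rule that)
    show "ROLC_saddle net c ?d ?P \<psi> ?m gu gl su sl"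
      unfolding ROLC_saddle_def ROLC_feasible_def
      using feas g s stat' P by (auto simp: angle_feasible_def balanced_load_def)
    fix d' \<theta> assume "OLC_feasible net d' \<theta>"
    then have *: "angle_feasible net \<theta>" "\<forall>i\<in>?N. d' i = balanced_load net \<theta> i" using feasible by auto
    have "(\<Sum>i\<in>?N. c i (?d i)) \<le> (\<Sum>i\<in>?N. c i (balanced_load net \<theta> i))" by (rule opt) fact
    also have "\<dots> = (\<Sum>i\<in>?N. c i (d' i))" using *(2) by simp
    finally show "(\<Sum>i\<in>?N. c i (?d i)) \<le> (\<Sum>i\<in>?N. c i (d' i))" .
  qed
qed

end

section \<open>Projections, quadratic forms and sublinear signals\<close>

text \<open>
  The projection only helps: it discards a negative rate at a multiplier that is zero, which does not
  exceed the multiplier \<open>s\<close> of the saddle point. Here \<open>k\<close> is the slack of the constraint at the saddle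
  point.
\<close>

lemma proj_rate_saddle_le:
  assumes "0 \<le> y" "0 \<le> s" "k \<le> 0" "s * k = 0"
  shows "(y - s) * proj_rate z y \<le> (y - s) * (z - k)"
proof -
  have "y * k \<le> 0" using assms by (simp add: mult_nonneg_nonpos)
  moreover have "(y - s) * (z - k) = (y - s) * z - y * k + s * k" by (simp add: algebra_simps)
  ultimately have "(y - s) * z \<le> (y - s) * (z - k)" using assms(4) by linarith
  moreover have "(y - s) * proj_rate z y \<le> (y - s) * z"
    using assms by (auto simp: proj_rate_def mult_nonneg_nonpos)
  ultimately show ?thesis by linarith
qed

text \<open>
  Lowering both diagonal entries by \<open>\<kappa>\<close> keeps the discriminant condition, since
  \<open>(a - \<kappa>) (b - \<kappa>) = \<delta>\<^sup>2 / 4 + \<kappa>\<^sup>2\<close> for the chosen \<open>\<kappa>\<close>.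
\<close>

lemma quadratic_form_coercive:
  fixes a b \<delta> :: real
  assumes "a > 0" "b > 0" "\<delta>\<^sup>2 < 4 * a * b"
  obtains \<kappa> where "\<kappa> > 0" "\<And>x y. \<kappa> * (x\<^sup>2 + y\<^sup>2) \<le> a * x\<^sup>2 - \<delta> * x * y + b * y\<^sup>2"
proof
  define \<kappa> where "\<kappa> = (4 * a * b - \<delta>\<^sup>2) / (4 * (a + b))"
  show "\<kappa> > 0" using assms by (simp add: \<kappa>_def)
  have \<kappa>: "\<kappa> * (a + b) = a * b - \<delta>\<^sup>2 / 4" using assms by (simp add: \<kappa>_def field_simps)
  have "\<kappa> * (a + b) \<le> a * b" using \<kappa> by simp
  also have "\<dots> < a * (a + b)" using assms by simp
  finally have "\<kappa> < a" using assms by simp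
  fix x y :: real
  have "(a - \<kappa>) * (b - \<kappa>) - \<delta>\<^sup>2 / 4 = \<kappa>\<^sup>2"
    using \<kappa> by (simp add: algebra_simps power2_eq_square)
  moreover have "A * (A * x\<^sup>2 - \<delta> * x * y + B * y\<^sup>2) = (A * x - \<delta> * y / 2)\<^sup>2 + (A * B - \<delta>\<^sup>2 / 4) * y\<^sup>2" for A B
    by (simp add: power2_eq_square field_simps)
  ultimately have "(a - \<kappa>) * ((a - \<kappa>) * x\<^sup>2 - \<delta> * x * y + (b - \<kappa>) * y\<^sup>2)
      = ((a - \<kappa>) * x - \<delta> * y / 2)\<^sup>2 + \<kappa>\<^sup>2 * y\<^sup>2"
    by simp
  then have "0 \<le> (a - \<kappa>) * ((a - \<kappa>) * x\<^sup>2 - \<delta> * x * y + (b - \<kappa>) * y\<^sup>2)" by simp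
  then have "0 \<le> (a - \<kappa>) * x\<^sup>2 - \<delta> * x * y + (b - \<kappa>) * y\<^sup>2"
    using \<open>\<kappa> < a\<close> by (simp add: zero_le_mult_iff)
  then show "\<kappa> * (x\<^sup>2 + y\<^sup>2) \<le> a * x\<^sup>2 - \<delta> * x * y + b * y\<^sup>2" by (simp add: algebra_simps)
qed

text \<open>
  With \<open>V\<close> a quadratic energy, this is satisfied by every signal that is linear in the state. The
  arbitrary factor \<open>\<eta>\<close> is what allows such signals to be absorbed into \<open>V\<close>.
\<close>

definition sublinear_in :: "(real \<Rightarrow> real) \<Rightarrow> (real \<Rightarrow> real) \<Rightarrow> bool" where
  "sublinear_in V y \<longleftrightarrow> (\<forall>\<eta>>0. \<exists>C. \<forall>t\<ge>0. \<bar>y t\<bar> \<le> \<eta> * V t + C)"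

lemma sublinear_inE:
  assumes "sublinear_in V y" "\<eta> > 0"
  obtains C where "\<And>t. t \<ge> 0 \<Longrightarrow> \<bar>y t\<bar> \<le> \<eta> * V t + C"
  using assms unfolding sublinear_in_def by blast

lemma sublinear_in_const:
  assumes "\<And>t. t \<ge> 0 \<Longrightarrow> V t \<ge> 0"
  shows "sublinear_in V (\<lambda>t. k)"
  unfolding sublinear_in_def
proof (intro allI impI exI[of _ "\<bar>k\<bar>"])
  fix \<eta> t :: real assume "\<eta> > 0" "t \<ge> 0"
  then show "\<bar>k\<bar> \<le> \<eta> * V t + \<bar>k\<bar>" using assms[of t] by simp
qed

lemma sublinear_in_add:
  assumes "sublinear_in V f" "sublinear_in V g"
  shows "sublinear_in V (\<lambda>t. f t + g t)"
  unfolding sublinear_in_def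
proof (intro allI impI)
  fix \<eta> :: real assume "\<eta> > 0"
  then have \<eta>: "\<eta> / 2 > 0" by simp
  obtain C1 where C1: "\<And>t. t \<ge> 0 \<Longrightarrow> \<bar>f t\<bar> \<le> \<eta> / 2 * V t + C1"
    using assms(1) \<eta> by (rule sublinear_inE) (rule that)
  obtain C2 where C2: "\<And>t. t \<ge> 0 \<Longrightarrow> \<bar>g t\<bar> \<le> \<eta> / 2 * V t + C2"
    using assms(2) \<eta> by (rule sublinear_inE) (rule that)
  show "\<exists>C. \<forall>t\<ge>0. \<bar>f t + g t\<bar> \<le> \<eta> * V t + C"
  proof (intro exI[of _ "C1 + C2"] allI impI)
    fix t :: real assume "t \<ge> 0"
    then show "\<bar>f t + g t\<bar> \<le> \<eta> * V t + (C1 + C2)"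
      using C1[of t] C2[of t] by (simp add: field_simps)
  qed
qed

lemma sublinear_in_cmult:
  assumes "sublinear_in V f"
  shows "sublinear_in V (\<lambda>t. k * f t)"
  unfolding sublinear_in_def
proof (intro allI impI)
  fix \<eta> :: real assume "\<eta> > 0"
  then have \<eta>: "\<eta> / (\<bar>k\<bar> + 1) > 0" by (simp add: add_nonneg_pos)
  obtain C where C: "\<And>t. t \<ge> 0 \<Longrightarrow> \<bar>f t\<bar> \<le> \<eta> / (\<bar>k\<bar> + 1) * V t + C"
    using assms(1) \<eta> by (rule sublinear_inE) (rule that)
  show "\<exists>C. \<forall>t\<ge>0. \<bar>k * f t\<bar> \<le> \<eta> * V t + C"
  proof (intro exI[of _ "(\<bar>k\<bar> + 1) * C"] allI impI)
    fix t :: real assume "t \<ge> 0"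
    have "\<bar>k * f t\<bar> \<le> (\<bar>k\<bar> + 1) * \<bar>f t\<bar>" by (simp add: abs_mult mult_right_mono)
    also have "\<dots> \<le> (\<bar>k\<bar> + 1) * (\<eta> / (\<bar>k\<bar> + 1) * V t + C)"
      using C[OF \<open>t \<ge> 0\<close>] by (intro mult_left_mono) auto
    also have "\<dots> = (\<bar>k\<bar> + 1) * (\<eta> / (\<bar>k\<bar> + 1)) * V t + (\<bar>k\<bar> + 1) * C" by (simp only: distrib_left mult.assoc)
    also have "(\<bar>k\<bar> + 1) * (\<eta> / (\<bar>k\<bar> + 1)) = \<eta>"
    proof -
      have "\<bar>k\<bar> + 1 \<noteq> 0" by linarith
      then show ?thesis by simp
    qed
    finally show "\<bar>k * f t\<bar> \<le> \<eta> * V t + (\<bar>k\<bar> + 1) * C" .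
  qed
qed

lemma sublinear_in_dominated:
  assumes "sublinear_in V f" "\<And>t. t \<ge> 0 \<Longrightarrow> \<bar>y t\<bar> \<le> \<bar>f t\<bar>"
  shows "sublinear_in V y"
  using assms unfolding sublinear_in_def by (meson order_trans)

lemma sublinear_in_abs: "sublinear_in V f \<Longrightarrow> sublinear_in V (\<lambda>t. \<bar>f t\<bar>)"
  by (erule sublinear_in_dominated) simp

lemma sublinear_in_sum:
  assumes "\<And>t. t \<ge> 0 \<Longrightarrow> V t \<ge> 0" "\<And>i. i \<in> A \<Longrightarrow> sublinear_in V (f i)"
  shows "sublinear_in V (\<lambda>t. \<Sum>i\<in>A. f i t)"
  using assms(2)
  by (induction A rule: infinite_finite_induct) (auto intro: sublinear_in_add sublinear_in_const[OF assms(1)])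

lemma sublinear_in_square:
  assumes V: "\<And>t. t \<ge> 0 \<Longrightarrow> (y t - k)\<^sup>2 / (2 * w) \<le> V t" and "w > 0"
  shows "sublinear_in V y"
  unfolding sublinear_in_def
proof (intro allI impI)
  fix \<eta> :: real assume "\<eta> > 0"
  show "\<exists>C. \<forall>t\<ge>0. \<bar>y t\<bar> \<le> \<eta> * V t + C"
  proof (intro exI[of _ "\<bar>k\<bar> + w / (2 * \<eta>)"] allI impI)
    fix t :: real assume "t \<ge> 0"
    let ?a = "\<bar>y t - k\<bar>"
    have "0 \<le> (\<eta> * ?a - w)\<^sup>2" by simp
    then have "2 * \<eta> * w * ?a \<le> \<eta>\<^sup>2 * ?a\<^sup>2 + w\<^sup>2" by (simp add: power2_eq_square algebra_simps)
    then have "?a \<le> \<eta> * ((y t - k)\<^sup>2 / (2 * w)) + w / (2 * \<eta>)"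
      using \<open>\<eta> > 0\<close> \<open>w > 0\<close> by (simp add: field_simps power2_eq_square)
    also have "\<eta> * ((y t - k)\<^sup>2 / (2 * w)) \<le> \<eta> * V t"
      using V[OF \<open>t \<ge> 0\<close>] \<open>\<eta> > 0\<close> by (intro mult_left_mono) auto
    finally show "\<bar>y t\<bar> \<le> \<eta> * V t + (\<bar>k\<bar> + w / (2 * \<eta>))" by linarith
  qed
qed

section \<open>The closed loop\<close>

text \<open>
  The hypotheses of the theorem, with the range of the inaccuracy replaced by the inequality that is
  used: \<open>\<delta>a\<^sub>i\<^sup>2 < 4 (D\<^sub>i + \<delta>a\<^sub>i) / l\<close>.
\<close>

locale closed_loop = power_network net for net :: "'n network" +
  fixes ctrl :: "'n controller" and c :: "'n \<Rightarrow> real \<Rightarrow> real" and u l :: real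
    and \<delta>a :: "'n \<Rightarrow> real" and x :: "real \<Rightarrow> 'n state"
  assumes ctrl_pos: "positive_controller net ctrl"
    and u_pos: "0 < u" and u_le_l: "u \<le> l"
    and cost_diff: "\<And>i s. i \<in> buses net \<Longrightarrow> c i field_differentiable (at s)"
    and marginal_cost_diff: "\<And>i s. i \<in> buses net \<Longrightarrow> deriv (c i) field_differentiable (at s)"
    and curvature: "\<And>i s. i \<in> buses net \<Longrightarrow> u \<le> deriv (deriv (c i)) s \<and> deriv (deriv (c i)) s \<le> l"
    and damping_error: "\<And>i. i \<in> buses net \<Longrightarrow> (\<delta>a i)\<^sup>2 < 4 * (damping net i + \<delta>a i) * (1 / l)"
    and NET: "NET_solution net x"
    and ALC: "fast_ALC_solution net c ctrl (\<lambda>i. damping net i + \<delta>a i) x"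
    and load_interior: "\<And>i t. i \<in> buses net \<Longrightarrow> t \<ge> 0 \<Longrightarrow>
           load_min net i < load (x t) i \<and> load (x t) i < load_max net i"
begin

text \<open>
  The edge quantity whose outflow drives \<open>psi\<close>, see \<open>psi_rate_eq\<close>; at a saddle point this outflow
  vanishes.
\<close>

abbreviation psi_drive :: "'n state \<Rightarrow> 'n \<times> 'n \<Rightarrow> real" where
  "psi_drive s \<equiv> (\<lambda>e. angle_flow net (mu net ctrl s) e - suscept net e * (sigma_up s e - sigma_lo s e))"

abbreviation gamma_up_rate :: "real \<Rightarrow> 'n \<Rightarrow> real" where
  "gamma_up_rate t i \<equiv>
    eps_gamma_up ctrl i * proj_rate (load (x t) i - load_max net i) (gamma_up (x t) i)"

abbreviation gamma_lo_rate :: "real \<Rightarrow> 'n \<Rightarrow> real" where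
  "gamma_lo_rate t i \<equiv>
    eps_gamma_lo ctrl i * proj_rate (- load (x t) i + load_min net i) (gamma_lo (x t) i)"

abbreviation mu_rate :: "real \<Rightarrow> 'n \<Rightarrow> real" where
  "mu_rate t i \<equiv> eps_mu ctrl i * (injection net i - load (x t) i + \<delta>a i * freq (x t) i
      - net_outflow (inner_lines net) (angle_flow net (psi (x t))) i)"

lemma eps_pos:
  assumes "i \<in> buses net"
  shows "eps_mu ctrl i > 0" "eps_psi ctrl i > 0" "eps_gamma_up ctrl i > 0" "eps_gamma_lo ctrl i > 0"
    "gain ctrl i > 0"
  using ctrl_pos assms by (auto simp: positive_controller_def)

lemma eps_sigma_pos:
  assumes "e \<in> inner_lines net"
  shows "eps_sigma_up ctrl e > 0" "eps_sigma_lo ctrl e > 0"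
  using ctrl_pos assms by (auto simp: positive_controller_def)

lemma l_pos: "l > 0" using u_pos u_le_l by simp

lemma gens_buses: "i \<in> gens net \<Longrightarrow> i \<in> buses net" using gens_loads by auto

lemma rate_freq:
  "i \<in> gens net \<Longrightarrow> caratheodory_rate (\<lambda>t. freq (x t) i) (\<lambda>t. - power_excess net (x t) i / inertia net i)"
  using NET by (auto simp: NET_solution_def)

lemma power_excess_load: "i \<in> loads net \<Longrightarrow> t \<ge> 0 \<Longrightarrow> power_excess net (x t) i = 0"
  using NET by (auto simp: NET_solution_def)

lemma rate_flow:
  "e \<in> lines net \<Longrightarrow> caratheodory_rate (\<lambda>t. flow (x t) e)
     (\<lambda>t. suscept net e * (freq (x t) (fst e) - freq (x t) (snd e)))"
  using NET by (cases e) (auto simp: NET_solution_def)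

lemma rate_gamma:
  assumes "i \<in> buses net"
  shows "caratheodory_rate (\<lambda>t. gamma_up (x t) i) (\<lambda>t. gamma_up_rate t i)"
    "caratheodory_rate (\<lambda>t. gamma_lo (x t) i) (\<lambda>t. gamma_lo_rate t i)"
  using ALC assms by (auto simp: fast_ALC_solution_def)

lemma rate_sigma:
  assumes "e \<in> inner_lines net"
  shows "caratheodory_rate (\<lambda>t. sigma_up (x t) e)
         (\<lambda>t. eps_sigma_up ctrl e *
                proj_rate (angle_flow net (psi (x t)) e - flow_max net e) (sigma_up (x t) e))"
    "caratheodory_rate (\<lambda>t. sigma_lo (x t) e)
         (\<lambda>t. eps_sigma_lo ctrl e *
                proj_rate (- angle_flow net (psi (x t)) e + flow_min net e) (sigma_lo (x t) e))"
  using ALC assms by (auto simp: fast_ALC_solution_def)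

lemma rate_rvar:
  assumes "i \<in> buses net"
  shows "caratheodory_rate (\<lambda>t. rvar (x t) i)
         (\<lambda>t. gain ctrl i *
                ((damping net i + \<delta>a i) * freq (x t) i + net_outflow (lines net) (flow (x t)) i
                 - net_outflow (inner_lines net) (angle_flow net (psi (x t))) i))"
  using ALC assms by (auto simp: fast_ALC_solution_def)

lemma psi_rate_eq: "psi_rate net ctrl s i = eps_psi ctrl i * net_outflow (inner_lines net) (psi_drive s) i"
proof -
  have "(\<Sum>j | (i, j) \<in> inner_lines net.
        (mu net ctrl s i - mu net ctrl s j - sigma_up s (i, j) + sigma_lo s (i, j)) * suscept net (i, j))
      = (\<Sum>j | (i, j) \<in> inner_lines net. psi_drive s (i, j))"
    by (intro sum.cong) (auto simp: angle_flow_eq algebra_simps)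
  moreover have "(\<Sum>k | (k, i) \<in> inner_lines net.
        (mu net ctrl s i - mu net ctrl s k + sigma_up s (k, i) - sigma_lo s (k, i)) * suscept net (k, i))
      = - (\<Sum>k | (k, i) \<in> inner_lines net. psi_drive s (k, i))"
    unfolding sum_negf[symmetric] by (intro sum.cong) (auto simp: angle_flow_eq algebra_simps)
  ultimately show ?thesis unfolding psi_rate_def net_outflow_def by simp
qed

lemma rate_psi:
  "i \<in> buses net \<Longrightarrow> caratheodory_rate (\<lambda>t. psi (x t) i)
     (\<lambda>t. eps_psi ctrl i * net_outflow (inner_lines net) (psi_drive (x t)) i)"
  using ALC unfolding fast_ALC_solution_def psi_rate_eq by blast

text \<open>
  At a generator the frequency part of \<open>mu\<close> cancels the physical outflow in the rate of \<open>rvar\<close>; at a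
  load the algebraic power balance does the same. This is where the choice of the step size
  \<open>1 / inertia\<close> enters.
\<close>

lemma rate_mu:
  assumes i: "i \<in> buses net"
  shows "caratheodory_rate (\<lambda>t. mu net ctrl (x t) i) (\<lambda>t. mu_rate t i)"
proof (cases "i \<in> gens net")
  case True
  have M: "inertia net i > 0" using inertia_pos True .
  have "caratheodory_rate
      (\<lambda>t. eps_mu ctrl i / eps_omega net i * freq (x t) i + eps_mu ctrl i / gain ctrl i * rvar (x t) i)
      (\<lambda>t. eps_mu ctrl i / eps_omega net i * (- power_excess net (x t) i / inertia net i)
        + eps_mu ctrl i / gain ctrl i * (gain ctrl i *
                ((damping net i + \<delta>a i) * freq (x t) i + net_outflow (lines net) (flow (x t)) i
                 - net_outflow (inner_lines net) (angle_flow net (psi (x t))) i)))"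
    by (intro caratheodory_rate_add caratheodory_rate_cmult rate_freq[OF True] rate_rvar[OF i])
  then show ?thesis
  proof (rule caratheodory_rate_cong)
    fix t :: real assume "t \<ge> 0"
    show "eps_mu ctrl i / eps_omega net i * freq (x t) i + eps_mu ctrl i / gain ctrl i * rvar (x t) i
        = mu net ctrl (x t) i" using True by (simp add: mu_def)
    let ?r = "(damping net i + \<delta>a i) * freq (x t) i + net_outflow (lines net) (flow (x t)) i
                 - net_outflow (inner_lines net) (angle_flow net (psi (x t))) i"
    have "eps_mu ctrl i / eps_omega net i * (- power_excess net (x t) i / inertia net i)
        = - eps_mu ctrl i * power_excess net (x t) i"
      using M by (simp add: eps_omega_def)
    moreover have "eps_mu ctrl i / gain ctrl i * (gain ctrl i * ?r) = eps_mu ctrl i * ?r"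
      using eps_pos(5)[OF i] by simp
    ultimately show "eps_mu ctrl i / eps_omega net i * (- power_excess net (x t) i / inertia net i)
        + eps_mu ctrl i / gain ctrl i * (gain ctrl i * ?r) = mu_rate t i"
      by (simp add: power_excess_def algebra_simps)
  qed
next
  case False
  then have i': "i \<in> loads net" using i gens_loads by auto
  have "caratheodory_rate (\<lambda>t. eps_mu ctrl i / gain ctrl i * rvar (x t) i)
      (\<lambda>t. eps_mu ctrl i / gain ctrl i * (gain ctrl i *
                ((damping net i + \<delta>a i) * freq (x t) i + net_outflow (lines net) (flow (x t)) i
                 - net_outflow (inner_lines net) (angle_flow net (psi (x t))) i)))"
    by (intro caratheodory_rate_cmult rate_rvar[OF i])
  then show ?thesis
  proof (rule caratheodory_rate_cong)
    fix t :: real assume "t \<ge> 0"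
    show "eps_mu ctrl i / gain ctrl i * rvar (x t) i = mu net ctrl (x t) i" using False by (simp add: mu_def)
    show "eps_mu ctrl i / gain ctrl i * (gain ctrl i *
                ((damping net i + \<delta>a i) * freq (x t) i + net_outflow (lines net) (flow (x t)) i
                 - net_outflow (inner_lines net) (angle_flow net (psi (x t))) i)) = mu_rate t i"
    proof -
      have "(damping net i + \<delta>a i) * freq (x t) i + net_outflow (lines net) (flow (x t)) i
          - net_outflow (inner_lines net) (angle_flow net (psi (x t))) i
        = injection net i - load (x t) i + \<delta>a i * freq (x t) i
          - net_outflow (inner_lines net) (angle_flow net (psi (x t))) i"
        using power_excess_load[OF i' \<open>t \<ge> 0\<close>] unfolding power_excess_def distrib_right by linarith
      then show ?thesis using eps_pos(5)[OF i] by simp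
    qed
  qed
qed

lemma marginal_cost_eq:
  assumes i: "i \<in> buses net" and "t \<ge> 0"
  shows "deriv (c i) (load (x t) i)
    = freq (x t) i + mu net ctrl (x t) i - gamma_up (x t) i + gamma_lo (x t) i"
proof -
  have "- deriv (c i) (load (x t) i) + eta net ctrl i * freq (x t) i
                + eps_mu ctrl i / gain ctrl i * rvar (x t) i
                - gamma_up (x t) i + gamma_lo (x t) i = 0"
    using ALC assms unfolding fast_ALC_solution_def by blast
  moreover have "eta net ctrl i * freq (x t) i + eps_mu ctrl i / gain ctrl i * rvar (x t) i
      = freq (x t) i + mu net ctrl (x t) i"
    using inertia_pos[of i] by (auto simp: eta_def mu_def eps_omega_def field_simps)
  ultimately show ?thesis by linarith
qed

lemma gamma_nonneg:
  assumes "i \<in> buses net" "t \<ge> 0"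
  shows "gamma_up (x t) i \<ge> 0" "gamma_lo (x t) i \<ge> 0"
proof -
  have init: "gamma_up (x 0) i \<ge> 0" "gamma_lo (x 0) i \<ge> 0"
    using ALC assms by (auto simp: fast_ALC_solution_def nonneg_multipliers_def)
  show "gamma_up (x t) i \<ge> 0"
    by (rule caratheodory_rate_nonneg[OF rate_gamma(1)[OF assms(1)] init(1) _ assms(2)])
      (use eps_pos[OF assms(1)] in \<open>auto simp: proj_rate_def\<close>)
  show "gamma_lo (x t) i \<ge> 0"
    by (rule caratheodory_rate_nonneg[OF rate_gamma(2)[OF assms(1)] init(2) _ assms(2)])
      (use eps_pos[OF assms(1)] in \<open>auto simp: proj_rate_def\<close>)
qed

lemma sigma_nonneg:
  assumes "e \<in> inner_lines net" "t \<ge> 0"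
  shows "sigma_up (x t) e \<ge> 0" "sigma_lo (x t) e \<ge> 0"
proof -
  have init: "sigma_up (x 0) e \<ge> 0" "sigma_lo (x 0) e \<ge> 0"
    using ALC assms by (auto simp: fast_ALC_solution_def nonneg_multipliers_def)
  show "sigma_up (x t) e \<ge> 0"
    by (rule caratheodory_rate_nonneg[OF rate_sigma(1)[OF assms(1)] init(1) _ assms(2)])
      (use eps_sigma_pos[OF assms(1)] in \<open>auto simp: proj_rate_def\<close>)
  show "sigma_lo (x t) e \<ge> 0"
    by (rule caratheodory_rate_nonneg[OF rate_sigma(2)[OF assms(1)] init(2) _ assms(2)])
      (use eps_sigma_pos[OF assms(1)] in \<open>auto simp: proj_rate_def\<close>)
qed

text \<open>
  A load strictly inside its limits leaves nothing for the projection to push upwards, so the load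
  multipliers can only decay.
\<close>

lemma gamma_rate_nonpos:
  assumes "i \<in> buses net" "t \<ge> 0"
  shows "gamma_up_rate t i \<le> 0" "gamma_lo_rate t i \<le> 0"
  using load_interior[OF assms] eps_pos[OF assms(1)]
  by (auto simp: proj_rate_def mult_nonneg_nonpos)

lemma marginal_cost_mvt:
  assumes "i \<in> buses net"
  obtains k where "u \<le> k" "k \<le> l" "deriv (c i) a - deriv (c i) b = k * (a - b)"
proof (cases a b rule: linorder_cases)
  case less
  have "\<exists>z>a. z < b \<and> deriv (c i) b - deriv (c i) a = (b - a) * deriv (deriv (c i)) z"
    using marginal_cost_diff[OF assms] less
    by (intro MVT2) (auto simp: DERIV_deriv_iff_field_differentiable)
  then obtain z where "deriv (c i) b - deriv (c i) a = (b - a) * deriv (deriv (c i)) z" by blast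
  then show thesis
    using that[of "deriv (deriv (c i)) z"] curvature[OF assms, of z] by (simp add: algebra_simps)
next
  case equal
  then show thesis using that[of u] u_le_l by simp
next
  case greater
  have "\<exists>z>b. z < a \<and> deriv (c i) a - deriv (c i) b = (a - b) * deriv (deriv (c i)) z"
    using marginal_cost_diff[OF assms] greater
    by (intro MVT2) (auto simp: DERIV_deriv_iff_field_differentiable)
  then obtain z where "deriv (c i) a - deriv (c i) b = (a - b) * deriv (deriv (c i)) z" by blast
  then show thesis
    using that[of "deriv (deriv (c i)) z"] curvature[OF assms, of z] by (simp add: algebra_simps)
qed

lemma marginal_cost_monotone:
  assumes "i \<in> buses net"
  shows "(deriv (c i) a - deriv (c i) b)\<^sup>2 / l \<le> (deriv (c i) a - deriv (c i) b) * (a - b)"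
    and "u * \<bar>a - b\<bar> \<le> \<bar>deriv (c i) a - deriv (c i) b\<bar>"
    and "0 \<le> (deriv (c i) a - deriv (c i) b) * (a - b)"
proof -
  obtain k where k: "u \<le> k" "k \<le> l" and eq: "deriv (c i) a - deriv (c i) b = k * (a - b)"
    by (rule marginal_cost_mvt[OF assms])
  have "k > 0" using k u_pos by simp
  have "k * (k * (a - b)\<^sup>2) \<le> l * (k * (a - b)\<^sup>2)"
    using k \<open>k > 0\<close> by (intro mult_right_mono) auto
  then show "(deriv (c i) a - deriv (c i) b)\<^sup>2 / l \<le> (deriv (c i) a - deriv (c i) b) * (a - b)"
    unfolding eq using l_pos by (simp add: field_simps power2_eq_square)
  show "u * \<bar>a - b\<bar> \<le> \<bar>deriv (c i) a - deriv (c i) b\<bar>"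
    unfolding eq abs_mult using k u_pos by (intro mult_right_mono) auto
  show "0 \<le> (deriv (c i) a - deriv (c i) b) * (a - b)"
    unfolding eq using \<open>k > 0\<close> by (simp add: mult.assoc zero_le_mult_iff)
qed

text \<open>
  The inequality on the inaccuracy bounds a square by a multiple of this sum.
\<close>

lemma perturbed_damping_pos: "i \<in> buses net \<Longrightarrow> damping net i + \<delta>a i > 0"
  using damping_error[of i] l_pos zero_le_power2[of "\<delta>a i"]
  by (smt (verit) divide_pos_pos mult_nonpos_nonneg zero_less_divide_iff)

lemma dissipation_coercive:
  obtains \<kappa> where "\<kappa> > 0" "\<And>i a b w. i \<in> buses net \<Longrightarrow>
    \<kappa> * (w\<^sup>2 + (deriv (c i) a - deriv (c i) b)\<^sup>2) \<le>
      (damping net i + \<delta>a i) * w\<^sup>2 - \<delta>a i * w * (deriv (c i) a - deriv (c i) b)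
      + (deriv (c i) a - deriv (c i) b) * (a - b)"
proof -
  have "\<exists>\<kappa>>0. \<forall>w g. \<kappa> * (w\<^sup>2 + g\<^sup>2) \<le> (damping net i + \<delta>a i) * w\<^sup>2 - \<delta>a i * w * g + 1 / l * g\<^sup>2"
    if "i \<in> buses net" for i
    using quadratic_form_coercive[OF perturbed_damping_pos[OF that] _ damping_error[OF that]] l_pos
    by (metis zero_less_divide_1_iff)
  then obtain k where k: "\<And>i. i \<in> buses net \<Longrightarrow> k i > 0"
    "\<And>i w g. i \<in> buses net \<Longrightarrow>
      k i * (w\<^sup>2 + g\<^sup>2) \<le> (damping net i + \<delta>a i) * w\<^sup>2 - \<delta>a i * w * g + 1 / l * g\<^sup>2"
    by metis
  define \<kappa> where "\<kappa> = Min (k ` buses net)"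
  have \<kappa>: "\<kappa> \<le> k i" if "i \<in> buses net" for i
    unfolding \<kappa>_def using that finite_buses by (intro Min_le) auto
  show thesis
  proof (rule that)
    have "\<kappa> \<in> k ` buses net" unfolding \<kappa>_def using finite_buses buses_nonempty by (intro Min_in) auto
    then show "\<kappa> > 0" using k(1) by auto
    fix i a b w assume i: "i \<in> buses net"
    let ?g = "deriv (c i) a - deriv (c i) b"
    have "\<kappa> * (w\<^sup>2 + ?g\<^sup>2) \<le> k i * (w\<^sup>2 + ?g\<^sup>2)" using \<kappa>[OF i] by (intro mult_right_mono) auto
    also have "\<dots> \<le> (damping net i + \<delta>a i) * w\<^sup>2 - \<delta>a i * w * ?g + 1 / l * ?g\<^sup>2" by (rule k(2)[OF i])
    also have "\<dots> \<le> (damping net i + \<delta>a i) * w\<^sup>2 - \<delta>a i * w * ?g + ?g * (a - b)"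
      using marginal_cost_monotone(1)[OF i, of a b] by simp
    finally show "\<kappa> * (w\<^sup>2 + ?g\<^sup>2) \<le> (damping net i + \<delta>a i) * w\<^sup>2 - \<delta>a i * w * ?g + ?g * (a - b)" .
  qed
qed

text \<open>
  The size of the coordinates from which the phases are reconstructed.
\<close>

definition state_size :: "real \<Rightarrow> real" where
  "state_size t = 1 + (\<Sum>e\<in>lines net. \<bar>flow (x t) e\<bar>) + (\<Sum>i\<in>buses net. \<bar>rvar (x t) i\<bar>)"

text \<open>
  Along a line, flow divided by susceptance is an antiderivative of the frequency difference; a path in
  the grid adds these up.
\<close>

lemma phase_difference:
  assumes "i \<in> buses net" "j \<in> buses net"
  shows "\<exists>y C. caratheodory_rate y (\<lambda>t. freq (x t) i - freq (x t) j) \<and> (\<forall>t. \<bar>y t\<bar> \<le> C * state_size t)"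
    (is "?Q i j")
proof -
  have size_ge: "1 \<le> state_size t" for t by (simp add: state_size_def sum_nonneg)
  show ?thesis
  proof (rule connected_equivalence[where Q = ?Q])
    show "?Q i i" for i
      by (rule exI[of _ "\<lambda>t. 0"]) (auto intro!: caratheodory_rate_const exI[of _ 0])
    show "?Q j i" if "?Q i j" for i j
    proof -
      from that obtain y C where y: "caratheodory_rate y (\<lambda>t. freq (x t) i - freq (x t) j)"
        "\<And>t. \<bar>y t\<bar> \<le> C * state_size t" by blast
      show ?thesis
        using caratheodory_rate_minus[OF y(1)] y(2) by (intro exI[of _ "\<lambda>t. - y t"] exI[of _ C]) simp
    qed
    show "?Q i k" if "?Q i j" "?Q j k" for i j k
    proof -
      from that obtain y C z C' where y: "caratheodory_rate y (\<lambda>t. freq (x t) i - freq (x t) j)"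
        "\<And>t. \<bar>y t\<bar> \<le> C * state_size t" and z: "caratheodory_rate z (\<lambda>t. freq (x t) j - freq (x t) k)"
        "\<And>t. \<bar>z t\<bar> \<le> C' * state_size t" by blast
      have "\<bar>y t + z t\<bar> \<le> (C + C') * state_size t" for t
        using y(2)[of t] z(2)[of t] by (simp add: distrib_right)
      then show ?thesis
        using caratheodory_rate_add[OF y(1) z(1)]
        by (intro exI[of _ "\<lambda>t. y t + z t"] exI[of _ "C + C'"]) simp
    qed
    show "?Q (fst e) (snd e)" if e: "e \<in> lines net" for e
    proof (intro exI conjI allI)
      have B: "suscept net e > 0" by (rule line_suscept_pos[OF e])
      show "caratheodory_rate (\<lambda>t. 1 / suscept net e * flow (x t) e) (\<lambda>t. freq (x t) (fst e) - freq (x t) (snd e))"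
        by (rule caratheodory_rate_cong[OF caratheodory_rate_cmult[OF rate_flow[OF e], of "1 / suscept net e"]])
          (use B in auto)
      fix t
      have "\<bar>flow (x t) e\<bar> \<le> (\<Sum>e\<in>lines net. \<bar>flow (x t) e\<bar>)"
        using e finite_lines by (intro member_le_sum) auto
      then have "\<bar>flow (x t) e\<bar> \<le> state_size t"
        unfolding state_size_def by (simp add: add_increasing2 add_increasing sum_nonneg)
      then show "\<bar>1 / suscept net e * flow (x t) e\<bar> \<le> 1 / suscept net e * state_size t"
        using B by (simp add: abs_mult divide_right_mono)
    qed
  qed (use assms in auto)
qed

text \<open>
  Phase differences to a reference bus \<open>i0\<close> being known, one more relation determines the phases: in
  \<open>\<Sum>\<^sub>i r\<^sub>i / K\<^sub>i\<close> all outflows cancel, so this sum is an antiderivative of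
  \<open>\<Sum>\<^sub>i (D\<^sub>i + \<delta>a\<^sub>i) \<omega>\<^sub>i\<close>. It can be solved for the reference phase because the perturbed dampings are
  positive.
\<close>

lemma phase_exists:
  obtains \<Theta> C where "\<And>i. i \<in> buses net \<Longrightarrow> caratheodory_rate (\<Theta> i) (\<lambda>t. freq (x t) i)"
    "\<And>i t. i \<in> buses net \<Longrightarrow> \<bar>\<Theta> i t\<bar> \<le> C * state_size t"
proof -
  let ?N = "buses net"
  obtain i0 where i0: "i0 \<in> ?N" using buses_nonempty by blast
  have "\<forall>i. \<exists>y C. i \<in> ?N \<longrightarrow> caratheodory_rate y (\<lambda>t. freq (x t) i - freq (x t) i0) \<and> (\<forall>t. \<bar>y t\<bar> \<le> C * state_size t)"
    using phase_difference[OF _ i0] by blast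
  then obtain y C where y: "\<And>i. i \<in> ?N \<Longrightarrow> caratheodory_rate (y i) (\<lambda>t. freq (x t) i - freq (x t) i0)"
    "\<And>i t. i \<in> ?N \<Longrightarrow> \<bar>y i t\<bar> \<le> C i * state_size t"
    by metis
  have size_ge: "1 \<le> state_size t" for t by (simp add: state_size_def sum_nonneg)
  let ?D = "\<lambda>i. damping net i + \<delta>a i"
  define S where "S = (\<Sum>i\<in>?N. ?D i)"
  have "S > 0" unfolding S_def
    using finite_buses buses_nonempty perturbed_damping_pos by (intro sum_pos) auto
  define z where "z t = 1 / S * ((\<Sum>i\<in>?N. 1 / gain ctrl i * rvar (x t) i) - (\<Sum>i\<in>?N. ?D i * y i t))" for t
  have "caratheodory_rate z (\<lambda>t. 1 / S * ((\<Sum>i\<in>?N. 1 / gain ctrl i * (gain ctrl i *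
                ((damping net i + \<delta>a i) * freq (x t) i + net_outflow (lines net) (flow (x t)) i
                 - net_outflow (inner_lines net) (angle_flow net (psi (x t))) i)))
       - (\<Sum>i\<in>?N. ?D i * (freq (x t) i - freq (x t) i0))))"
    unfolding z_def
    by (intro caratheodory_rate_cmult caratheodory_rate_diff caratheodory_rate_sum y rate_rvar)
  then have z: "caratheodory_rate z (\<lambda>t. freq (x t) i0)"
  proof (rule caratheodory_rate_cong)
    fix t :: real
    have flows: "(\<Sum>i\<in>?N. net_outflow (lines net) f i) = 0" "(\<Sum>i\<in>?N. net_outflow (inner_lines net) f i) = 0" for f
      using sum_mult_net_outflow[OF finite_buses lines_subset, of "\<lambda>_. 1" f]
        sum_mult_net_outflow[OF finite_buses inner_lines_buses, of "\<lambda>_. 1" f] by simp_all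
    have "(\<Sum>i\<in>?N. 1 / gain ctrl i * (gain ctrl i *
                (?D i * freq (x t) i + net_outflow (lines net) (flow (x t)) i
                 - net_outflow (inner_lines net) (angle_flow net (psi (x t))) i)))
      = (\<Sum>i\<in>?N. ?D i * freq (x t) i + net_outflow (lines net) (flow (x t)) i
                 - net_outflow (inner_lines net) (angle_flow net (psi (x t))) i)"
      by (intro sum.cong) (auto dest: eps_pos(5))
    also have "\<dots> = (\<Sum>i\<in>?N. ?D i * freq (x t) i)" by (simp add: sum.distrib sum_subtractf flows)
    also have "\<dots> - (\<Sum>i\<in>?N. ?D i * (freq (x t) i - freq (x t) i0)) = S * freq (x t) i0"
      by (simp add: S_def sum_distrib_right right_diff_distrib sum_subtractf)
    finally show "1 / S * ((\<Sum>i\<in>?N. 1 / gain ctrl i * (gain ctrl i *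
                (?D i * freq (x t) i + net_outflow (lines net) (flow (x t)) i
                 - net_outflow (inner_lines net) (angle_flow net (psi (x t))) i)))
       - (\<Sum>i\<in>?N. ?D i * (freq (x t) i - freq (x t) i0))) = freq (x t) i0"
      using \<open>S > 0\<close> by simp
  qed simp
  define C0 where "C0 = 1 / S * ((\<Sum>i\<in>?N. 1 / gain ctrl i) + (\<Sum>i\<in>?N. ?D i * C i))"
  have z_le: "\<bar>z t\<bar> \<le> C0 * state_size t" for t
  proof -
    have r: "\<bar>rvar (x t) i\<bar> \<le> state_size t" if "i \<in> ?N" for i
    proof -
      have "\<bar>rvar (x t) i\<bar> \<le> (\<Sum>i\<in>?N. \<bar>rvar (x t) i\<bar>)"
        using that finite_buses by (intro member_le_sum) auto
      then show ?thesis unfolding state_size_def by (simp add: add_increasing2 add_increasing sum_nonneg)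
    qed
    have 1: "\<bar>\<Sum>i\<in>?N. 1 / gain ctrl i * rvar (x t) i\<bar> \<le> (\<Sum>i\<in>?N. 1 / gain ctrl i) * state_size t"
      unfolding sum_distrib_right
    proof (rule order_trans[OF sum_abs sum_mono])
      fix i assume i: "i \<in> ?N"
      show "\<bar>1 / gain ctrl i * rvar (x t) i\<bar> \<le> 1 / gain ctrl i * state_size t"
        unfolding abs_mult using eps_pos(5)[OF i] r[OF i] by (intro mult_mono) auto
    qed
    have 2: "\<bar>\<Sum>i\<in>?N. ?D i * y i t\<bar> \<le> (\<Sum>i\<in>?N. ?D i * C i) * state_size t"
      unfolding sum_distrib_right
    proof (rule order_trans[OF sum_abs sum_mono])
      fix i assume i: "i \<in> ?N"
      have "\<bar>?D i * y i t\<bar> = ?D i * \<bar>y i t\<bar>" using perturbed_damping_pos[OF i] by (simp add: abs_mult)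
      also have "\<dots> \<le> ?D i * (C i * state_size t)"
        using perturbed_damping_pos[OF i] y(2)[OF i] by (intro mult_left_mono) auto
      finally show "\<bar>?D i * y i t\<bar> \<le> ?D i * C i * state_size t" by (simp add: mult.assoc)
    qed
    have "\<bar>z t\<bar> = 1 / S * \<bar>(\<Sum>i\<in>?N. 1 / gain ctrl i * rvar (x t) i) - (\<Sum>i\<in>?N. ?D i * y i t)\<bar>"
      unfolding z_def abs_mult using \<open>S > 0\<close> by simp
    also have "\<dots> \<le> 1 / S * ((\<Sum>i\<in>?N. 1 / gain ctrl i) * state_size t + (\<Sum>i\<in>?N. ?D i * C i) * state_size t)"
      using 1 2 \<open>S > 0\<close> by (intro mult_left_mono) auto
    also have "\<dots> = C0 * state_size t" by (simp only: C0_def distrib_right mult.assoc)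
    finally show ?thesis .
  qed
  define K where "K = C0 + (\<Sum>i\<in>?N. \<bar>C i\<bar>)"
  show thesis
  proof (rule that)
    fix i assume i: "i \<in> ?N"
    show "caratheodory_rate (\<lambda>t. y i t + z t) (\<lambda>t. freq (x t) i)"
      using caratheodory_rate_add[OF y(1)[OF i] z] by simp
    fix t
    have "\<bar>C i\<bar> \<le> (\<Sum>i\<in>?N. \<bar>C i\<bar>)" using i finite_buses by (intro member_le_sum) auto
    then have "C i * state_size t \<le> (\<Sum>i\<in>?N. \<bar>C i\<bar>) * state_size t"
      using size_ge[of t] by (intro mult_right_mono) auto
    then show "\<bar>y i t + z t\<bar> \<le> K * state_size t"
      using y(2)[OF i, of t] z_le[of t] by (simp add: K_def distrib_right)
  qed
qed

end

section \<open>Energy relative to a saddle point\<close>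

context closed_loop
begin

text \<open>
  Half the weighted squared distance to a reference point. Each weight is the inverse step size of its
  coordinate, so that the step sizes disappear from the rate. The frequencies of the load buses are
  absent because they follow algebraically from the other coordinates; the reference frequency is \<open>0\<close>.
\<close>

definition energy ::
  "('n \<times> 'n \<Rightarrow> real) \<Rightarrow> ('n \<Rightarrow> real) \<Rightarrow> ('n \<Rightarrow> real) \<Rightarrow> ('n \<Rightarrow> real) \<Rightarrow> ('n \<Rightarrow> real) \<Rightarrow>
    ('n \<times> 'n \<Rightarrow> real) \<Rightarrow> ('n \<times> 'n \<Rightarrow> real) \<Rightarrow> real \<Rightarrow> real" where
  "energy P \<psi> m gu gl su sl t =
    (\<Sum>i\<in>gens net. (freq (x t) i - 0)\<^sup>2 / (2 * (1 / inertia net i))) +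
    (\<Sum>e\<in>lines net. (flow (x t) e - P e)\<^sup>2 / (2 * suscept net e)) +
    (\<Sum>i\<in>buses net. (mu net ctrl (x t) i - m i)\<^sup>2 / (2 * eps_mu ctrl i)) +
    (\<Sum>i\<in>buses net. (psi (x t) i - \<psi> i)\<^sup>2 / (2 * eps_psi ctrl i)) +
    (\<Sum>i\<in>buses net. (gamma_up (x t) i - gu i)\<^sup>2 / (2 * eps_gamma_up ctrl i)) +
    (\<Sum>i\<in>buses net. (gamma_lo (x t) i - gl i)\<^sup>2 / (2 * eps_gamma_lo ctrl i)) +
    (\<Sum>e\<in>inner_lines net. (sigma_up (x t) e - su e)\<^sup>2 / (2 * eps_sigma_up ctrl e)) +
    (\<Sum>e\<in>inner_lines net. (sigma_lo (x t) e - sl e)\<^sup>2 / (2 * eps_sigma_lo ctrl e))"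

lemma finite_gens: "finite (gens net)"
  using finite_buses gens_loads(1) by (metis finite_Un)

lemma weights_pos:
  "i \<in> gens net \<Longrightarrow> 1 / inertia net i > 0"
  "e \<in> lines net \<Longrightarrow> suscept net e > 0"
  "i \<in> buses net \<Longrightarrow> eps_mu ctrl i > 0"
  "i \<in> buses net \<Longrightarrow> eps_psi ctrl i > 0"
  "i \<in> buses net \<Longrightarrow> eps_gamma_up ctrl i > 0"
  "i \<in> buses net \<Longrightarrow> eps_gamma_lo ctrl i > 0"
  "e \<in> inner_lines net \<Longrightarrow> eps_sigma_up ctrl e > 0"
  "e \<in> inner_lines net \<Longrightarrow> eps_sigma_lo ctrl e > 0"
  using inertia_pos line_suscept_pos eps_pos eps_sigma_pos by auto

lemma energy_ge:
  "i \<in> gens net \<Longrightarrow> (freq (x t) i - 0)\<^sup>2 / (2 * (1 / inertia net i)) \<le> energy P \<psi> m gu gl su sl t"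
  "e \<in> lines net \<Longrightarrow> (flow (x t) e - P e)\<^sup>2 / (2 * suscept net e) \<le> energy P \<psi> m gu gl su sl t"
  "i \<in> buses net \<Longrightarrow> (mu net ctrl (x t) i - m i)\<^sup>2 / (2 * eps_mu ctrl i) \<le> energy P \<psi> m gu gl su sl t"
  "i \<in> buses net \<Longrightarrow> (psi (x t) i - \<psi> i)\<^sup>2 / (2 * eps_psi ctrl i) \<le> energy P \<psi> m gu gl su sl t"
  "i \<in> buses net \<Longrightarrow> (gamma_up (x t) i - gu i)\<^sup>2 / (2 * eps_gamma_up ctrl i) \<le> energy P \<psi> m gu gl su sl t"
  "i \<in> buses net \<Longrightarrow> (gamma_lo (x t) i - gl i)\<^sup>2 / (2 * eps_gamma_lo ctrl i) \<le> energy P \<psi> m gu gl su sl t"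
  "e \<in> inner_lines net \<Longrightarrow> (sigma_up (x t) e - su e)\<^sup>2 / (2 * eps_sigma_up ctrl e) \<le> energy P \<psi> m gu gl su sl t"
  "e \<in> inner_lines net \<Longrightarrow> (sigma_lo (x t) e - sl e)\<^sup>2 / (2 * eps_sigma_lo ctrl e) \<le> energy P \<psi> m gu gl su sl t"
  and energy_nonneg: "0 \<le> energy P \<psi> m gu gl su sl t"
proof -
  have sq: "0 \<le> (a - b)\<^sup>2 / (2 * w)" if "w > 0" for a b w :: real using that by simp
  let ?f1 = "\<lambda>i. (freq (x t) i - 0)\<^sup>2 / (2 * (1 / inertia net i))"
  have n1: "0 \<le> sum ?f1 (gens net)" by (intro sum_nonneg sq weights_pos)
  have m1: "?f1 i \<le> sum ?f1 (gens net)" if "i \<in> gens net" for i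
    by (rule member_le_sum[OF that _ finite_gens]) (intro sq weights_pos, simp)
  let ?f2 = "\<lambda>e. (flow (x t) e - P e)\<^sup>2 / (2 * suscept net e)"
  have n2: "0 \<le> sum ?f2 (lines net)" by (intro sum_nonneg sq weights_pos)
  have m2: "?f2 e \<le> sum ?f2 (lines net)" if "e \<in> lines net" for e
    by (rule member_le_sum[OF that _ finite_lines]) (intro sq weights_pos, simp)
  let ?f3 = "\<lambda>i. (mu net ctrl (x t) i - m i)\<^sup>2 / (2 * eps_mu ctrl i)"
  have n3: "0 \<le> sum ?f3 (buses net)" by (intro sum_nonneg sq weights_pos)
  have m3: "?f3 i \<le> sum ?f3 (buses net)" if "i \<in> buses net" for i
    by (rule member_le_sum[OF that _ finite_buses]) (intro sq weights_pos, simp)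
  let ?f4 = "\<lambda>i. (psi (x t) i - \<psi> i)\<^sup>2 / (2 * eps_psi ctrl i)"
  have n4: "0 \<le> sum ?f4 (buses net)" by (intro sum_nonneg sq weights_pos)
  have m4: "?f4 i \<le> sum ?f4 (buses net)" if "i \<in> buses net" for i
    by (rule member_le_sum[OF that _ finite_buses]) (intro sq weights_pos, simp)
  let ?f5 = "\<lambda>i. (gamma_up (x t) i - gu i)\<^sup>2 / (2 * eps_gamma_up ctrl i)"
  have n5: "0 \<le> sum ?f5 (buses net)" by (intro sum_nonneg sq weights_pos)
  have m5: "?f5 i \<le> sum ?f5 (buses net)" if "i \<in> buses net" for i
    by (rule member_le_sum[OF that _ finite_buses]) (intro sq weights_pos, simp)
  let ?f6 = "\<lambda>i. (gamma_lo (x t) i - gl i)\<^sup>2 / (2 * eps_gamma_lo ctrl i)"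
  have n6: "0 \<le> sum ?f6 (buses net)" by (intro sum_nonneg sq weights_pos)
  have m6: "?f6 i \<le> sum ?f6 (buses net)" if "i \<in> buses net" for i
    by (rule member_le_sum[OF that _ finite_buses]) (intro sq weights_pos, simp)
  let ?f7 = "\<lambda>e. (sigma_up (x t) e - su e)\<^sup>2 / (2 * eps_sigma_up ctrl e)"
  have n7: "0 \<le> sum ?f7 (inner_lines net)" by (intro sum_nonneg sq weights_pos)
  have m7: "?f7 e \<le> sum ?f7 (inner_lines net)" if "e \<in> inner_lines net" for e
    by (rule member_le_sum[OF that _ finite_inner_lines]) (intro sq weights_pos, simp)
  let ?f8 = "\<lambda>e. (sigma_lo (x t) e - sl e)\<^sup>2 / (2 * eps_sigma_lo ctrl e)"
  have n8: "0 \<le> sum ?f8 (inner_lines net)" by (intro sum_nonneg sq weights_pos)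
  have m8: "?f8 e \<le> sum ?f8 (inner_lines net)" if "e \<in> inner_lines net" for e
    by (rule member_le_sum[OF that _ finite_inner_lines]) (intro sq weights_pos, simp)
  note nn = n1 n2 n3 n4 n5 n6 n7 n8
  show "0 \<le> energy P \<psi> m gu gl su sl t" unfolding energy_def using nn by linarith
  show "?f1 i \<le> energy P \<psi> m gu gl su sl t" if "i \<in> gens net"
    unfolding energy_def using nn m1[OF that] by linarith
  show "?f2 e \<le> energy P \<psi> m gu gl su sl t" if "e \<in> lines net"
    unfolding energy_def using nn m2[OF that] by linarith
  show "?f3 i \<le> energy P \<psi> m gu gl su sl t" if "i \<in> buses net"
    unfolding energy_def using nn m3[OF that] by linarith
  show "?f4 i \<le> energy P \<psi> m gu gl su sl t" if "i \<in> buses net"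
    unfolding energy_def using nn m4[OF that] by linarith
  show "?f5 i \<le> energy P \<psi> m gu gl su sl t" if "i \<in> buses net"
    unfolding energy_def using nn m5[OF that] by linarith
  show "?f6 i \<le> energy P \<psi> m gu gl su sl t" if "i \<in> buses net"
    unfolding energy_def using nn m6[OF that] by linarith
  show "?f7 e \<le> energy P \<psi> m gu gl su sl t" if "e \<in> inner_lines net"
    unfolding energy_def using nn m7[OF that] by linarith
  show "?f8 e \<le> energy P \<psi> m gu gl su sl t" if "e \<in> inner_lines net"
    unfolding energy_def using nn m8[OF that] by linarith
qed

end

locale saddle_reference = closed_loop +
  fixes d' P' \<psi>' m' gu gl su sl
  assumes saddle: "ROLC_saddle net c d' P' \<psi>' m' gu gl su sl"
begin

abbreviation V :: "real \<Rightarrow> real" where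
  "V \<equiv> energy P' \<psi>' m' gu gl su sl"

abbreviation gamma_gap :: "real \<Rightarrow> 'a \<Rightarrow> real" where
  "gamma_gap t i \<equiv> (gamma_up (x t) i - gu i) - (gamma_lo (x t) i - gl i)"

abbreviation marginal_gap :: "real \<Rightarrow> 'a \<Rightarrow> real" where
  "marginal_gap t i \<equiv> deriv (c i) (load (x t) i) - deriv (c i) (d' i)"

text \<open>
  The step sizes have cancelled, and the first sum may range over all buses because the power excess vanishes at
  loads.
\<close>

definition V_rate :: "real \<Rightarrow> real" where
  "V_rate t =
    (\<Sum>i\<in>buses net. - freq (x t) i * power_excess net (x t) i) +
    (\<Sum>e\<in>lines net. (flow (x t) e - P' e) * (freq (x t) (fst e) - freq (x t) (snd e))) +
    (\<Sum>i\<in>buses net. (mu net ctrl (x t) i - m' i) * (injection net i - load (x t) i + \<delta>a i * freq (x t) i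
      - net_outflow (inner_lines net) (angle_flow net (psi (x t))) i)) +
    (\<Sum>i\<in>buses net. (psi (x t) i - \<psi>' i) * net_outflow (inner_lines net) (psi_drive (x t)) i) +
    (\<Sum>i\<in>buses net. (gamma_up (x t) i - gu i) * proj_rate (load (x t) i - load_max net i) (gamma_up (x t) i)) +
    (\<Sum>i\<in>buses net. (gamma_lo (x t) i - gl i) * proj_rate (- load (x t) i + load_min net i) (gamma_lo (x t) i)) +
    (\<Sum>e\<in>inner_lines net. (sigma_up (x t) e - su e) *
       proj_rate (angle_flow net (psi (x t)) e - flow_max net e) (sigma_up (x t) e)) +
    (\<Sum>e\<in>inner_lines net. (sigma_lo (x t) e - sl e) *
       proj_rate (- angle_flow net (psi (x t)) e + flow_min net e) (sigma_lo (x t) e))"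

lemma V_has_rate: "caratheodory_rate V V_rate"
proof -
  have "caratheodory_rate V (\<lambda>t.
    (\<Sum>i\<in>gens net. (freq (x t) i - 0) * ((- power_excess net (x t) i / inertia net i) / (1 / inertia net i))) +
    (\<Sum>e\<in>lines net. (flow (x t) e - P' e) * ((suscept net e * (freq (x t) (fst e) - freq (x t) (snd e))) / suscept net e)) +
    (\<Sum>i\<in>buses net. (mu net ctrl (x t) i - m' i) * (mu_rate t i / eps_mu ctrl i)) +
    (\<Sum>i\<in>buses net. (psi (x t) i - \<psi>' i) * (eps_psi ctrl i * net_outflow (inner_lines net) (psi_drive (x t)) i / eps_psi ctrl i)) +
    (\<Sum>i\<in>buses net. (gamma_up (x t) i - gu i) * (gamma_up_rate t i / eps_gamma_up ctrl i)) +
    (\<Sum>i\<in>buses net. (gamma_lo (x t) i - gl i) * (gamma_lo_rate t i / eps_gamma_lo ctrl i)) +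
    (\<Sum>e\<in>inner_lines net. (sigma_up (x t) e - su e) *
       (eps_sigma_up ctrl e * proj_rate (angle_flow net (psi (x t)) e - flow_max net e) (sigma_up (x t) e) / eps_sigma_up ctrl e)) +
    (\<Sum>e\<in>inner_lines net. (sigma_lo (x t) e - sl e) *
       (eps_sigma_lo ctrl e * proj_rate (- angle_flow net (psi (x t)) e + flow_min net e) (sigma_lo (x t) e) / eps_sigma_lo ctrl e)))"
    (is "caratheodory_rate _ ?R")
    unfolding energy_def
    by (intro caratheodory_rate_add caratheodory_rate_sum caratheodory_rate_square
        rate_freq rate_flow rate_mu rate_psi rate_gamma rate_sigma)
  then show ?thesis
  proof (rule caratheodory_rate_cong)
    fix t :: real assume t: "t \<ge> 0"
    have cancel: "a * (k * b / k) = a * b" if "k > 0" for a b k :: real using that by simp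
    have "(\<Sum>i\<in>gens net. (freq (x t) i - 0) * ((- power_excess net (x t) i / inertia net i) / (1 / inertia net i)))
        = (\<Sum>i\<in>gens net. - freq (x t) i * power_excess net (x t) i)"
    proof (intro sum.cong refl)
      fix i assume "i \<in> gens net"
      then have "inertia net i > 0" by (rule inertia_pos)
      then show "(freq (x t) i - 0) * ((- power_excess net (x t) i / inertia net i) / (1 / inertia net i))
        = - freq (x t) i * power_excess net (x t) i" by simp
    qed
    also have "\<dots> = (\<Sum>i\<in>buses net. - freq (x t) i * power_excess net (x t) i)"
      using gens_loads t finite_buses power_excess_load by (intro sum.mono_neutral_left) auto
    finally have gen: "(\<Sum>i\<in>gens net. (freq (x t) i - 0) * ((- power_excess net (x t) i / inertia net i) / (1 / inertia net i)))
      = (\<Sum>i\<in>buses net. - freq (x t) i * power_excess net (x t) i)" .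
    show "?R t = V_rate t"
      unfolding V_rate_def gen
      by (intro arg_cong2[of _ _ _ _ "(+)"] sum.cong refl cancel weights_pos; assumption)
  qed simp
qed

lemma saddle_facts:
  assumes "i \<in> buses net"
  shows "d' i = injection net i - net_outflow (lines net) P' i"
    "d' i = injection net i - net_outflow (inner_lines net) (angle_flow net \<psi>') i"
    "load_min net i \<le> d' i" "d' i \<le> load_max net i" "gu i \<ge> 0" "gl i \<ge> 0"
    "gu i * (d' i - load_max net i) = 0" "gl i * (load_min net i - d' i) = 0"
    "deriv (c i) (d' i) = m' i - gu i + gl i"
    "net_outflow (inner_lines net) (\<lambda>e. angle_flow net m' e - suscept net e * (su e - sl e)) i = 0"
  using saddle assms unfolding ROLC_saddle_def ROLC_feasible_def by auto

lemma saddle_line_facts: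
  assumes "e \<in> inner_lines net"
  shows "flow_min net e \<le> angle_flow net \<psi>' e" "angle_flow net \<psi>' e \<le> flow_max net e"
    "su e \<ge> 0" "sl e \<ge> 0"
    "su e * (angle_flow net \<psi>' e - flow_max net e) = 0"
    "sl e * (flow_min net e - angle_flow net \<psi>' e) = 0"
  using saddle assms unfolding ROLC_saddle_def ROLC_feasible_def by auto

text \<open>
  The cancellations of the primal-dual flow: the frequency and flow terms cancel by summation by parts
  (\<open>A\<close>), so do the terms in \<open>mu\<close>, \<open>psi\<close> and \<open>sigma\<close> (\<open>B\<close>, \<open>C\<close>, \<open>S\<close>), and the limits on the
  load contribute \<open>G\<close>. Substituting \<open>\<Delta>\<mu> = \<Delta>c' - \<omega> + \<Delta>\<gamma>\<close> from the marginal cost equation leaves the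
  terms on the right.
\<close>

lemma V_rate_le:
  assumes t: "t \<ge> 0"
  shows "V_rate t \<le> (\<Sum>i\<in>buses net. \<delta>a i * freq (x t) i * gamma_gap t i) -
    (\<Sum>i\<in>buses net. (damping net i + \<delta>a i) * (freq (x t) i)\<^sup>2
       - \<delta>a i * freq (x t) i * marginal_gap t i + marginal_gap t i * (load (x t) i - d' i))"
proof -
  let ?N = "buses net" and ?E = "lines net" and ?F = "inner_lines net"
  let ?w = "\<lambda>i. freq (x t) i"
  let ?dd = "\<lambda>i. load (x t) i - d' i"
  let ?dP = "\<lambda>e. flow (x t) e - P' e"
  let ?dm = "\<lambda>i. mu net ctrl (x t) i - m' i"
  let ?dp = "\<lambda>i. psi (x t) i - \<psi>' i"
  let ?ds = "\<lambda>e. (sigma_up (x t) e - su e) - (sigma_lo (x t) e - sl e)"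
  let ?X = "\<Sum>i\<in>?N. ?dm i * net_outflow ?F (angle_flow net ?dp) i"
  have angle_diff: "angle_flow net (\<lambda>i. f i - g i) e = angle_flow net f e - angle_flow net g e" for f g e
    by (simp add: angle_flow_eq algebra_simps)
  have A: "(\<Sum>i\<in>?N. - ?w i * power_excess net (x t) i) + (\<Sum>e\<in>?E. ?dP e * (?w (fst e) - ?w (snd e)))
      = (\<Sum>i\<in>?N. - damping net i * (?w i)\<^sup>2 - ?w i * ?dd i)"
  proof -
    have "(\<Sum>e\<in>?E. ?dP e * (?w (fst e) - ?w (snd e))) = (\<Sum>i\<in>?N. ?w i * net_outflow ?E ?dP i)"
      by (simp add: sum_mult_net_outflow[OF finite_buses lines_subset] mult_ac)
    moreover have "- ?w i * power_excess net (x t) i + ?w i * net_outflow ?E ?dP i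
        = - damping net i * (?w i)\<^sup>2 - ?w i * ?dd i" if "i \<in> ?N" for i
    proof -
      have pe: "power_excess net (x t) i = damping net i * ?w i + ?dd i + net_outflow ?E ?dP i"
        using saddle_facts(1)[OF that] by (simp add: power_excess_def net_outflow_diff)
      show ?thesis unfolding pe by (simp add: power2_eq_square algebra_simps)
    qed
    ultimately show ?thesis by (simp add: sum.distrib[symmetric])
  qed
  have B: "(\<Sum>i\<in>?N. ?dm i * (injection net i - load (x t) i + \<delta>a i * ?w i
      - net_outflow ?F (angle_flow net (psi (x t))) i))
    = (\<Sum>i\<in>?N. - ?dm i * ?dd i + \<delta>a i * ?w i * ?dm i) - ?X"
    unfolding sum_subtractf[symmetric]
  proof (intro sum.cong refl)
    fix i assume i: "i \<in> ?N"
    have "angle_flow net ?dp = (\<lambda>e. angle_flow net (psi (x t)) e - angle_flow net \<psi>' e)"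
      by (rule ext) (rule angle_diff)
    then have "net_outflow ?F (angle_flow net ?dp) i
      = net_outflow ?F (angle_flow net (psi (x t))) i - net_outflow ?F (angle_flow net \<psi>') i"
      by (simp add: net_outflow_diff)
    then have "injection net i - load (x t) i + \<delta>a i * ?w i - net_outflow ?F (angle_flow net (psi (x t))) i
      = - ?dd i + \<delta>a i * ?w i - net_outflow ?F (angle_flow net ?dp) i"
      using saddle_facts(2)[OF i] by simp
    then show "?dm i * (injection net i - load (x t) i + \<delta>a i * ?w i
      - net_outflow ?F (angle_flow net (psi (x t))) i)
      = - ?dm i * ?dd i + \<delta>a i * ?w i * ?dm i - ?dm i * net_outflow ?F (angle_flow net ?dp) i"
      by (simp only:) (simp add: algebra_simps)
  qed
  have C: "(\<Sum>i\<in>?N. ?dp i * net_outflow ?F (psi_drive (x t)) i)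
    = ?X - (\<Sum>e\<in>?F. ?ds e * angle_flow net ?dp e)"
  proof -
    have "net_outflow ?F (psi_drive (x t)) i = net_outflow ?F (angle_flow net ?dm) i
        - net_outflow ?F (\<lambda>e. suscept net e * ?ds e) i" if i: "i \<in> ?N" for i
    proof -
      have "net_outflow ?F (psi_drive (x t)) i = net_outflow ?F (psi_drive (x t)) i -
          net_outflow ?F (\<lambda>e. angle_flow net m' e - suscept net e * (su e - sl e)) i"
        using saddle_facts(10)[OF i] by simp
      also have "\<dots> = net_outflow ?F (\<lambda>e. angle_flow net ?dm e - suscept net e * ?ds e) i"
        unfolding net_outflow_diff[symmetric] angle_diff by (simp add: algebra_simps)
      finally show ?thesis by (simp add: net_outflow_diff)
    qed
    then have "(\<Sum>i\<in>?N. ?dp i * net_outflow ?F (psi_drive (x t)) i)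
      = (\<Sum>i\<in>?N. ?dp i * net_outflow ?F (angle_flow net ?dm) i)
        - (\<Sum>i\<in>?N. ?dp i * net_outflow ?F (\<lambda>e. suscept net e * ?ds e) i)"
      by (simp add: right_diff_distrib sum_subtractf)
    also have "(\<Sum>i\<in>?N. ?dp i * net_outflow ?F (angle_flow net ?dm) i) = ?X"
      by (rule sum_mult_angle_outflow[OF finite_buses inner_lines_buses])
    also have "(\<Sum>i\<in>?N. ?dp i * net_outflow ?F (\<lambda>e. suscept net e * ?ds e) i) = (\<Sum>e\<in>?F. ?ds e * angle_flow net ?dp e)"
      unfolding sum_mult_net_outflow[OF finite_buses inner_lines_buses] angle_flow_eq
      by (intro sum.cong) (auto simp: mult_ac)
    finally show ?thesis .
  qed
  have S: "(\<Sum>e\<in>?F. (sigma_up (x t) e - su e) *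
       proj_rate (angle_flow net (psi (x t)) e - flow_max net e) (sigma_up (x t) e)) +
    (\<Sum>e\<in>?F. (sigma_lo (x t) e - sl e) *
       proj_rate (- angle_flow net (psi (x t)) e + flow_min net e) (sigma_lo (x t) e))
    \<le> (\<Sum>e\<in>?F. ?ds e * angle_flow net ?dp e)"
    unfolding sum.distrib[symmetric]
  proof (intro sum_mono)
    fix e assume e: "e \<in> ?F"
    note s = saddle_line_facts[OF e]
    have "(sigma_up (x t) e - su e) * proj_rate (angle_flow net (psi (x t)) e - flow_max net e) (sigma_up (x t) e)
        \<le> (sigma_up (x t) e - su e) * ((angle_flow net (psi (x t)) e - flow_max net e) - (angle_flow net \<psi>' e - flow_max net e))"
      using s sigma_nonneg[OF e t] by (intro proj_rate_saddle_le) auto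
    moreover have "(sigma_lo (x t) e - sl e) * proj_rate (- angle_flow net (psi (x t)) e + flow_min net e) (sigma_lo (x t) e)
        \<le> (sigma_lo (x t) e - sl e) * ((- angle_flow net (psi (x t)) e + flow_min net e) - (flow_min net e - angle_flow net \<psi>' e))"
      using s sigma_nonneg[OF e t] by (intro proj_rate_saddle_le) auto
    ultimately show "(sigma_up (x t) e - su e) *
       proj_rate (angle_flow net (psi (x t)) e - flow_max net e) (sigma_up (x t) e) +
      (sigma_lo (x t) e - sl e) *
       proj_rate (- angle_flow net (psi (x t)) e + flow_min net e) (sigma_lo (x t) e)
      \<le> ?ds e * angle_flow net ?dp e"
      by (simp add: angle_diff algebra_simps)
  qed
  have G: "(\<Sum>i\<in>?N. (gamma_up (x t) i - gu i) * proj_rate (load (x t) i - load_max net i) (gamma_up (x t) i)) +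
    (\<Sum>i\<in>?N. (gamma_lo (x t) i - gl i) * proj_rate (- load (x t) i + load_min net i) (gamma_lo (x t) i))
    \<le> (\<Sum>i\<in>?N. gamma_gap t i * ?dd i)"
    unfolding sum.distrib[symmetric]
  proof (intro sum_mono)
    fix i assume i: "i \<in> ?N"
    note s = saddle_facts[OF i]
    have "(gamma_up (x t) i - gu i) * proj_rate (load (x t) i - load_max net i) (gamma_up (x t) i)
        \<le> (gamma_up (x t) i - gu i) * ((load (x t) i - load_max net i) - (d' i - load_max net i))"
      using s gamma_nonneg[OF i t] by (intro proj_rate_saddle_le) auto
    moreover have "(gamma_lo (x t) i - gl i) * proj_rate (- load (x t) i + load_min net i) (gamma_lo (x t) i)
        \<le> (gamma_lo (x t) i - gl i) * ((- load (x t) i + load_min net i) - (load_min net i - d' i))"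
      using s gamma_nonneg[OF i t] by (intro proj_rate_saddle_le) auto
    ultimately show "(gamma_up (x t) i - gu i) * proj_rate (load (x t) i - load_max net i) (gamma_up (x t) i) +
      (gamma_lo (x t) i - gl i) * proj_rate (- load (x t) i + load_min net i) (gamma_lo (x t) i)
      \<le> gamma_gap t i * ?dd i"
      by (simp add: algebra_simps)
  qed
  have "V_rate t \<le> (\<Sum>i\<in>?N. - damping net i * (?w i)\<^sup>2 - ?w i * ?dd i)
      + (\<Sum>i\<in>?N. - ?dm i * ?dd i + \<delta>a i * ?w i * ?dm i) + (\<Sum>i\<in>?N. gamma_gap t i * ?dd i)"
    unfolding V_rate_def using A B C S G by linarith
  also have "\<dots> = (\<Sum>i\<in>?N. \<delta>a i * ?w i * gamma_gap t i) -
    (\<Sum>i\<in>?N. (damping net i + \<delta>a i) * (?w i)\<^sup>2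
       - \<delta>a i * ?w i * marginal_gap t i + marginal_gap t i * ?dd i)"
    unfolding sum_subtractf[symmetric] sum.distrib[symmetric]
  proof (intro sum.cong refl)
    fix i assume i: "i \<in> ?N"
    have dm: "?dm i = marginal_gap t i - ?w i + gamma_gap t i"
      using marginal_cost_eq[OF i t] saddle_facts(9)[OF i] by simp
    show "- damping net i * (?w i)\<^sup>2 - ?w i * ?dd i + (- ?dm i * ?dd i + \<delta>a i * ?w i * ?dm i) + gamma_gap t i * ?dd i
      = \<delta>a i * ?w i * gamma_gap t i - ((damping net i + \<delta>a i) * (?w i)\<^sup>2
       - \<delta>a i * ?w i * marginal_gap t i + marginal_gap t i * ?dd i)"
      unfolding dm by (simp add: power2_eq_square algebra_simps)
  qed
  finally show ?thesis .
qed

end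

section \<open>Energy corrected by the phases\<close>

text \<open>
  Convergence of a coordinate once the energy relative to its limit tends to zero.
\<close>

lemma tendsto_of_weighted_square:
  fixes y :: "real \<Rightarrow> real"
  assumes le: "\<And>t. (y t - k)\<^sup>2 / (2 * w) \<le> V t" and "w > 0" and V: "(V \<longlongrightarrow> 0) at_top"
  shows "(y \<longlongrightarrow> k) at_top"
proof -
  have "((\<lambda>t. (y t - k)\<^sup>2) \<longlongrightarrow> 0) at_top"
  proof (rule tendsto_sandwich[of "\<lambda>t. 0" _ _ "\<lambda>t. 2 * w * V t"])
    show "\<forall>\<^sub>F t in at_top. (y t - k)\<^sup>2 \<le> 2 * w * V t"
      using le \<open>w > 0\<close> by (simp add: field_simps)
    show "((\<lambda>t. 2 * w * V t) \<longlongrightarrow> 0) at_top" using tendsto_mult_left[OF V, of "2 * w"] by simp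
  qed auto
  then have "((\<lambda>t. sqrt ((y t - k)\<^sup>2)) \<longlongrightarrow> sqrt 0) at_top" by (rule tendsto_real_sqrt)
  then have "((\<lambda>t. y t - k) \<longlongrightarrow> 0) at_top" by (simp add: tendsto_rabs_zero_iff)
  then show ?thesis by (simp add: LIM_zero_iff)
qed

context closed_loop
begin

text \<open>
  The monotone quantity that pays for all terms containing the rates of \<open>gamma\<close>.
\<close>

definition gamma_total :: "real \<Rightarrow> real" where
  "gamma_total t = (\<Sum>i\<in>buses net. gamma_up (x t) i + gamma_lo (x t) i)"

definition gamma_total_rate :: "real \<Rightarrow> real" where
  "gamma_total_rate t = (\<Sum>i\<in>buses net. gamma_up_rate t i + gamma_lo_rate t i)"

lemma rate_gamma_total: "caratheodory_rate gamma_total gamma_total_rate"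
  unfolding gamma_total_def gamma_total_rate_def
  by (intro caratheodory_rate_sum caratheodory_rate_add rate_gamma)

lemma gamma_total_nonneg: "t \<ge> 0 \<Longrightarrow> gamma_total t \<ge> 0"
  unfolding gamma_total_def by (intro sum_nonneg add_nonneg_nonneg gamma_nonneg)

lemma gamma_total_rate_le:
  assumes "i \<in> buses net" "t \<ge> 0"
  shows "\<bar>gamma_up_rate t i - gamma_lo_rate t i\<bar> \<le> - gamma_total_rate t"
proof -
  have "(\<Sum>j\<in>{i}. - (gamma_up_rate t j + gamma_lo_rate t j)) \<le> (\<Sum>j\<in>buses net. - (gamma_up_rate t j + gamma_lo_rate t j))"
  proof (rule sum_mono2[OF finite_buses])
    show "0 \<le> - (gamma_up_rate t j + gamma_lo_rate t j)" if "j \<in> buses net - {i}" for j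
      using gamma_rate_nonpos[of j t] that assms(2) by simp
  qed (use assms in auto)
  then have "- (gamma_up_rate t i + gamma_lo_rate t i) \<le> - gamma_total_rate t"
    unfolding gamma_total_rate_def sum_negf by simp
  then show ?thesis using gamma_rate_nonpos[OF assms] by linarith
qed

lemma rvar_eq:
  assumes i: "i \<in> buses net"
  shows "rvar s i = gain ctrl i / eps_mu ctrl i * mu net ctrl s i
    - gain ctrl i / eps_omega net i * (if i \<in> gens net then freq s i else 0)"
  using eps_pos[OF i] inertia_pos[of i] by (auto simp: mu_def eps_omega_def field_simps)

lemma gamma_decreasing:
  assumes i: "i \<in> buses net" and "0 \<le> s" "s \<le> t"
  shows "gamma_up (x t) i \<le> gamma_up (x s) i" "gamma_lo (x t) i \<le> gamma_lo (x s) i"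
  using gamma_rate_nonpos[OF i] assms
  by (auto intro!: caratheodory_rate_decreasing[OF rate_gamma(1)[OF i]] caratheodory_rate_decreasing[OF rate_gamma(2)[OF i]])

lemma gamma_converges:
  assumes i: "i \<in> buses net"
  obtains a b where "((\<lambda>t. gamma_up (x t) i) \<longlongrightarrow> a) at_top" "((\<lambda>t. gamma_lo (x t) i) \<longlongrightarrow> b) at_top"
    "0 \<le> a" "0 \<le> b"
proof -
  obtain a where "((\<lambda>t. gamma_up (x t) i) \<longlongrightarrow> a) at_top" "0 \<le> a"
    by (rule antimono_bounded_tendsto[of "\<lambda>t. gamma_up (x t) i" 0])
      (use gamma_decreasing[OF i] gamma_nonneg[OF i] that in auto)
  moreover obtain b where "((\<lambda>t. gamma_lo (x t) i) \<longlongrightarrow> b) at_top" "0 \<le> b"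
    by (rule antimono_bounded_tendsto[of "\<lambda>t. gamma_lo (x t) i" 0])
      (use gamma_decreasing[OF i] gamma_nonneg[OF i] that in auto)
  ultimately show thesis using that by blast
qed

end

locale phased_reference = saddle_reference +
  fixes \<Theta> :: "'a \<Rightarrow> real \<Rightarrow> real" and C\<^sub>\<Theta> :: real
  assumes rate_phase: "\<And>i. i \<in> buses net \<Longrightarrow> caratheodory_rate (\<Theta> i) (\<lambda>t. freq (x t) i)"
    and phase_le: "\<And>i t. i \<in> buses net \<Longrightarrow> \<bar>\<Theta> i t\<bar> \<le> C\<^sub>\<Theta> * state_size t"
begin

text \<open>
  The boundary term of the integration by parts in \<open>\<Sum>\<^sub>i \<delta>a\<^sub>i \<omega>\<^sub>i \<Delta>\<gamma>\<^sub>i\<close>.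
\<close>

definition correction :: "real \<Rightarrow> real" where
  "correction t = (\<Sum>i\<in>buses net. \<delta>a i * (\<Theta> i t * gamma_gap t i))"

definition correction_rate :: "real \<Rightarrow> real" where
  "correction_rate t = (\<Sum>i\<in>buses net. \<delta>a i *
     (freq (x t) i * gamma_gap t i + \<Theta> i t * (gamma_up_rate t i - gamma_lo_rate t i)))"

definition phase_load :: "real \<Rightarrow> real" where
  "phase_load t = (\<Sum>i\<in>buses net. \<bar>\<delta>a i\<bar> * \<bar>\<Theta> i t\<bar>)"

definition dissipation :: "real \<Rightarrow> real" where
  "dissipation t = (\<Sum>i\<in>buses net. (damping net i + \<delta>a i) * (freq (x t) i)\<^sup>2
       - \<delta>a i * freq (x t) i * marginal_gap t i + marginal_gap t i * (load (x t) i - d' i))"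

lemma rate_correction: "caratheodory_rate correction correction_rate"
proof -
  have gap: "caratheodory_rate (\<lambda>t. gamma_gap t i) (\<lambda>t. gamma_up_rate t i - gamma_lo_rate t i)"
    if i: "i \<in> buses net" for i
  proof -
    have "caratheodory_rate (\<lambda>t. gamma_gap t i) (\<lambda>t. (gamma_up_rate t i - 0) - (gamma_lo_rate t i - 0))"
      by (intro caratheodory_rate_diff rate_gamma caratheodory_rate_const i)
    then show ?thesis by simp
  qed
  show ?thesis
    unfolding correction_def correction_rate_def
    by (intro caratheodory_rate_sum caratheodory_rate_cmult caratheodory_rate_mult rate_phase gap)
qed

lemma dissipation_ge:
  obtains \<kappa> where "\<kappa> > 0" "\<And>i t. i \<in> buses net \<Longrightarrow> \<kappa> * (freq (x t) i)\<^sup>2 \<le> dissipation t"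
    "\<And>i t. i \<in> buses net \<Longrightarrow> \<kappa> * (load (x t) i - d' i)\<^sup>2 \<le> dissipation t"
proof -
  obtain k where k: "k > 0" and coer: "\<And>i a b w. i \<in> buses net \<Longrightarrow>
    k * (w\<^sup>2 + (deriv (c i) a - deriv (c i) b)\<^sup>2) \<le>
      (damping net i + \<delta>a i) * w\<^sup>2 - \<delta>a i * w * (deriv (c i) a - deriv (c i) b)
      + (deriv (c i) a - deriv (c i) b) * (a - b)"
    by (rule dissipation_coercive) (rule that)
  have bound: "k * ((freq (x t) i)\<^sup>2 + (marginal_gap t i)\<^sup>2) \<le> dissipation t" if i: "i \<in> buses net" for i t
  proof -
    have pos: "0 \<le> k * (w\<^sup>2 + g\<^sup>2)" for w g :: real using k by simp
    show ?thesis
      unfolding dissipation_def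
    proof (rule order_trans[OF coer[OF i, of "freq (x t) i" "load (x t) i" "d' i"]], rule member_le_sum[OF i _ finite_buses])
      fix j assume "j \<in> buses net - {i}"
      then show "0 \<le> (damping net j + \<delta>a j) * (freq (x t) j)\<^sup>2
       - \<delta>a j * freq (x t) j * marginal_gap t j + marginal_gap t j * (load (x t) j - d' j)"
        using order_trans[OF pos coer[of j "freq (x t) j" "load (x t) j" "d' j"]] by auto
    qed
  qed
  \<comment> \<open>The factor \<open>u\<^sup>2\<close> converts the marginal cost gap into a load gap.\<close>
  define \<kappa> where "\<kappa> = k * min 1 (u\<^sup>2)"
  have \<kappa>: "\<kappa> \<le> k" "\<kappa> \<le> k * u\<^sup>2" using k by (auto simp: \<kappa>_def mult_left_le)
  show thesis
  proof (rule that)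
    show "\<kappa> > 0" using k u_pos by (simp add: \<kappa>_def)
    fix i t assume i: "i \<in> buses net"
    have "\<kappa> * (freq (x t) i)\<^sup>2 \<le> k * ((freq (x t) i)\<^sup>2 + (marginal_gap t i)\<^sup>2)"
      using \<kappa>(1) k by (intro mult_mono) auto
    then show "\<kappa> * (freq (x t) i)\<^sup>2 \<le> dissipation t" using bound[OF i, of t] by linarith
    have "(u * \<bar>load (x t) i - d' i\<bar>)\<^sup>2 \<le> \<bar>marginal_gap t i\<bar>\<^sup>2"
      using marginal_cost_monotone(2)[OF i] u_pos by (intro power_mono) auto
    then have "u\<^sup>2 * (load (x t) i - d' i)\<^sup>2 \<le> (marginal_gap t i)\<^sup>2"
      by (simp add: power_mult_distrib)
    then have "k * (u\<^sup>2 * (load (x t) i - d' i)\<^sup>2) \<le> k * ((freq (x t) i)\<^sup>2 + (marginal_gap t i)\<^sup>2)"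
      using k by (intro mult_left_mono) (auto simp: add_increasing)
    moreover have "\<kappa> * (load (x t) i - d' i)\<^sup>2 \<le> k * u\<^sup>2 * (load (x t) i - d' i)\<^sup>2"
      using \<kappa>(2) by (rule mult_right_mono) auto
    ultimately show "\<kappa> * (load (x t) i - d' i)\<^sup>2 \<le> dissipation t"
      using bound[OF i, of t] by (simp add: mult.assoc)
  qed
qed

lemma dissipation_nonneg: "0 \<le> dissipation t"
proof -
  obtain \<kappa> where \<kappa>: "\<kappa> > 0" "\<And>i t. i \<in> buses net \<Longrightarrow> \<kappa> * (freq (x t) i)\<^sup>2 \<le> dissipation t"
    by (rule dissipation_ge) (rule that)
  obtain i where "i \<in> buses net" using buses_nonempty by blast
  then show ?thesis using \<kappa>(2)[of i t] \<kappa>(1) by (smt (verit) mult_nonneg_nonneg zero_le_power2)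
qed

text \<open>
  The indefinite sum cancels against the correction, and what remains is controlled by the rate of the
  monotone quantity \<open>gamma_total\<close>.
\<close>

lemma modified_rate_le:
  assumes t: "t \<ge> 0"
  shows "V_rate t - correction_rate t \<le> - dissipation t - phase_load t * gamma_total_rate t"
proof -
  have "- (\<Sum>i\<in>buses net. \<delta>a i * (\<Theta> i t * (gamma_up_rate t i - gamma_lo_rate t i)))
      \<le> phase_load t * (- gamma_total_rate t)"
    unfolding phase_load_def sum_distrib_right sum_negf[symmetric]
  proof (rule sum_mono)
    fix i assume i: "i \<in> buses net"
    let ?g = "gamma_up_rate t i - gamma_lo_rate t i"
    have "- (\<delta>a i * (\<Theta> i t * ?g)) \<le> \<bar>\<delta>a i * (\<Theta> i t * ?g)\<bar>" by linarith
    also have "\<dots> = \<bar>\<delta>a i\<bar> * \<bar>\<Theta> i t\<bar> * \<bar>?g\<bar>" by (simp only: abs_mult mult.assoc)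
    also have "\<dots> \<le> \<bar>\<delta>a i\<bar> * \<bar>\<Theta> i t\<bar> * (- gamma_total_rate t)"
      using gamma_total_rate_le[OF i t] by (intro mult_left_mono) auto
    finally show "- (\<delta>a i * (\<Theta> i t * ?g)) \<le> \<bar>\<delta>a i\<bar> * \<bar>\<Theta> i t\<bar> * (- gamma_total_rate t)" .
  qed
  moreover have "correction_rate t = (\<Sum>i\<in>buses net. \<delta>a i * freq (x t) i * gamma_gap t i)
      + (\<Sum>i\<in>buses net. \<delta>a i * (\<Theta> i t * (gamma_up_rate t i - gamma_lo_rate t i)))"
    unfolding correction_rate_def sum.distrib[symmetric] by (intro sum.cong) (auto simp: algebra_simps)
  moreover have "V_rate t \<le> (\<Sum>i\<in>buses net. \<delta>a i * freq (x t) i * gamma_gap t i) - dissipation t"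
    unfolding dissipation_def by (rule V_rate_le[OF t])
  ultimately show ?thesis by linarith
qed

lemma gamma_gap_bounded:
  obtains G where "\<And>i t. i \<in> buses net \<Longrightarrow> t \<ge> 0 \<Longrightarrow> \<bar>gamma_gap t i\<bar> \<le> G i"
proof (rule that)
  fix i t assume "i \<in> buses net" "(t :: real) \<ge> 0"
  then show "\<bar>gamma_gap t i\<bar> \<le> gamma_up (x 0) i + gamma_lo (x 0) i + \<bar>gu i\<bar> + \<bar>gl i\<bar>"
    using gamma_decreasing[of i 0 t] gamma_nonneg[of i t] by linarith
qed

lemma state_size_sublinear: "sublinear_in V state_size"
proof -
  have V0: "V t \<ge> 0" for t by (rule energy_nonneg)
  have P: "sublinear_in V (\<lambda>t. flow (x t) e)" if "e \<in> lines net" for e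
    by (rule sublinear_in_square[OF energy_ge(2)]) (use that weights_pos in auto)
  have m: "sublinear_in V (\<lambda>t. mu net ctrl (x t) i)" if "i \<in> buses net" for i
    by (rule sublinear_in_square[OF energy_ge(3)]) (use that weights_pos in auto)
  have r: "sublinear_in V (\<lambda>t. rvar (x t) i)" if i: "i \<in> buses net" for i
  proof -
    have "sublinear_in V (\<lambda>t. if i \<in> gens net then freq (x t) i else 0)"
    proof (cases "i \<in> gens net")
      case True
      then show ?thesis
        using sublinear_in_square[OF energy_ge(1)[OF True] weights_pos(1)[OF True]] by simp
    next
      case False
      then show ?thesis using sublinear_in_const[of V 0] V0 by simp
    qed
    then have "sublinear_in V (\<lambda>t. gain ctrl i / eps_mu ctrl i * mu net ctrl (x t) i
        + (- gain ctrl i / eps_omega net i) * (if i \<in> gens net then freq (x t) i else 0))"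
      by (intro sublinear_in_add sublinear_in_cmult m i)
    then show ?thesis unfolding rvar_eq[OF i] by simp
  qed
  show ?thesis
    unfolding state_size_def
    by (intro sublinear_in_add sublinear_in_sum sublinear_in_abs sublinear_in_const P r V0)
qed

text \<open>
  With \<open>Z = V - correction + constant\<close>, sublinearity of the phases gives both \<open>V \<le> 2 Z\<close> and
  \<open>phase_load \<le> Z\<close>, hence \<open>Z' \<le> - dissipation - Z * gamma_total'\<close>. Multiplication by
  \<open>exp gamma_total\<close> removes the last term.
\<close>

lemma energy_certificate:
  obtains Y Y_rate where "caratheodory_rate Y Y_rate"
    "\<And>t. t \<ge> 0 \<Longrightarrow> 0 \<le> Y t" "\<And>t. t \<ge> 0 \<Longrightarrow> V t \<le> 2 * Y t" "\<And>t. t \<ge> 0 \<Longrightarrow> Y_rate t \<le> - dissipation t"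
proof -
  have V0: "V t \<ge> 0" for t by (rule energy_nonneg)
  obtain G where G: "\<And>i t. i \<in> buses net \<Longrightarrow> t \<ge> 0 \<Longrightarrow> \<bar>gamma_gap t i\<bar> \<le> G i"
    by (rule gamma_gap_bounded) (rule that)
  have G0: "G i \<ge> 0" if "i \<in> buses net" for i using G[OF that, of 0] by linarith
  define W where "W t = (\<Sum>i\<in>buses net. \<bar>\<delta>a i\<bar> * (1 + G i) * \<bar>\<Theta> i t\<bar>)" for t
  have "sublinear_in V (\<Theta> i)" if i: "i \<in> buses net" for i
  proof (rule sublinear_in_dominated[OF sublinear_in_cmult[OF state_size_sublinear, of C\<^sub>\<Theta>]])
    show "\<bar>\<Theta> i t\<bar> \<le> \<bar>C\<^sub>\<Theta> * state_size t\<bar>" for t using phase_le[OF i, of t] by linarith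
  qed
  then have "sublinear_in V W"
    unfolding W_def by (intro sublinear_in_sum sublinear_in_cmult sublinear_in_abs V0)
  then obtain C' where C': "\<And>t. t \<ge> 0 \<Longrightarrow> \<bar>W t\<bar> \<le> 1 / 2 * V t + C'"
    by (rule sublinear_inE[of _ _ "1 / 2"]) (use that in auto)
  define C where "C = \<bar>C'\<bar>"
  then have "0 \<le> C" by simp
  have C: "\<bar>W t\<bar> \<le> 1 / 2 * V t + C" if "t \<ge> 0" for t
    using C'[OF that] unfolding C_def by linarith
  have phase_load: "phase_load t \<le> W t" "0 \<le> phase_load t" for t
    unfolding phase_load_def W_def
    using G0 by (auto intro!: sum_mono sum_nonneg mult_right_mono simp: mult_le_cancel_left1)
  have corr: "\<bar>correction t\<bar> \<le> W t" if t: "t \<ge> 0" for t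
    unfolding correction_def W_def
  proof (rule order_trans[OF sum_abs sum_mono])
    fix i assume i: "i \<in> buses net"
    have "\<bar>\<delta>a i * (\<Theta> i t * gamma_gap t i)\<bar> = \<bar>\<delta>a i\<bar> * \<bar>gamma_gap t i\<bar> * \<bar>\<Theta> i t\<bar>"
      by (simp only: abs_mult mult_ac)
    also have "\<dots> \<le> \<bar>\<delta>a i\<bar> * (1 + G i) * \<bar>\<Theta> i t\<bar>"
      using G[OF i t] by (intro mult_right_mono mult_left_mono) auto
    finally show "\<bar>\<delta>a i * (\<Theta> i t * gamma_gap t i)\<bar> \<le> \<bar>\<delta>a i\<bar> * (1 + G i) * \<bar>\<Theta> i t\<bar>" .
  qed
  define Z where "Z t = V t - correction t + 2 * C" for t
  define Z_rate where "Z_rate t = V_rate t - correction_rate t" for t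
  have Z: "caratheodory_rate Z Z_rate"
    using caratheodory_rate_add[OF caratheodory_rate_diff[OF V_has_rate rate_correction] caratheodory_rate_const[of "2 * C"]]
    unfolding Z_def Z_rate_def by simp
  have Z_ge: "1 / 2 * V t + C \<le> Z t" if "t \<ge> 0" for t
    using corr[OF that] C[OF that] unfolding Z_def by linarith
  have V_le: "V t \<le> 2 * Z t" if "t \<ge> 0" for t
    using Z_ge[OF that] \<open>0 \<le> C\<close> by linarith
  have Z_rate_le: "Z_rate t + Z t * gamma_total_rate t \<le> - dissipation t" if t: "t \<ge> 0" for t
  proof -
    have "gamma_total_rate t \<le> 0"
      unfolding gamma_total_rate_def using gamma_rate_nonpos[OF _ t] by (intro sum_nonpos add_nonpos_nonpos) auto
    moreover have "phase_load t \<le> Z t"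
      using phase_load(1)[of t] C[OF t] Z_ge[OF t] by linarith
    ultimately have "Z t * gamma_total_rate t \<le> phase_load t * gamma_total_rate t"
      by (intro mult_right_mono_neg)
    then show ?thesis using modified_rate_le[OF t] unfolding Z_rate_def by linarith
  qed
  show thesis
  proof (rule that)
    show "caratheodory_rate (\<lambda>t. Z t * exp (gamma_total t))
        (\<lambda>t. Z_rate t * exp (gamma_total t) + Z t * (exp (gamma_total t) * gamma_total_rate t))"
      by (intro caratheodory_rate_mult Z caratheodory_rate_exp rate_gamma_total)
    fix t :: real assume t: "t \<ge> 0"
    have e: "1 \<le> exp (gamma_total t)" using gamma_total_nonneg[OF t] by simp
    have Z0: "0 \<le> Z t" using V_le[OF t] V0[of t] by linarith
    then show "0 \<le> Z t * exp (gamma_total t)" by simp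
    have "Z t * 1 \<le> Z t * exp (gamma_total t)" using e Z0 by (rule mult_left_mono)
    then show "V t \<le> 2 * (Z t * exp (gamma_total t))" using V_le[OF t] by linarith
    have "Z_rate t * exp (gamma_total t) + Z t * (exp (gamma_total t) * gamma_total_rate t)
        = exp (gamma_total t) * (Z_rate t + Z t * gamma_total_rate t)" by (simp add: algebra_simps)
    also have "\<dots> \<le> exp (gamma_total t) * (- dissipation t)"
      using Z_rate_le[OF t] by (intro mult_left_mono) auto
    also have "\<dots> \<le> - dissipation t"
      using mult_right_mono[OF e dissipation_nonneg[of t]] by simp
    finally show "Z_rate t * exp (gamma_total t) + Z t * (exp (gamma_total t) * gamma_total_rate t)
        \<le> - dissipation t" .
  qed
qed

text \<open>
  With bounded phases the corrected energy plus a multiple of \<open>gamma_total\<close> is nonincreasing, so \<open>V\<close>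
  converges; a sequence of times along which \<open>V\<close> tends to zero identifies the limit.
\<close>

lemma energy_vanishes:
  assumes bounded: "\<And>i t. i \<in> buses net \<Longrightarrow> t \<ge> 0 \<Longrightarrow> \<bar>\<Theta> i t\<bar> \<le> B"
    and gap: "\<And>i. i \<in> buses net \<Longrightarrow> ((\<lambda>t. gamma_gap t i) \<longlongrightarrow> 0) at_top"
    and \<rho>: "filterlim \<rho> at_top sequentially" and limit: "(\<lambda>n. V (\<rho> n)) \<longlonglongrightarrow> 0"
  shows "(V \<longlongrightarrow> 0) at_top"
proof -
  have V0: "V t \<ge> 0" for t by (rule energy_nonneg)
  define K where "K = (\<Sum>i\<in>buses net. \<bar>\<delta>a i\<bar> * B)"
  have load_le: "phase_load t \<le> K" if "t \<ge> 0" for t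
    unfolding phase_load_def K_def using bounded that by (intro sum_mono mult_left_mono) auto
  have corr0: "(correction \<longlongrightarrow> 0) at_top"
  proof -
    have "((\<lambda>t. \<Sum>i\<in>buses net. \<delta>a i * (\<Theta> i t * gamma_gap t i)) \<longlongrightarrow> (\<Sum>i\<in>buses net. \<delta>a i * 0)) at_top"
    proof (intro tendsto_intros)
      fix i assume i: "i \<in> buses net"
      show "((\<lambda>t. \<Theta> i t * gamma_gap t i) \<longlongrightarrow> 0) at_top"
      proof (rule tendsto_0_le[of "\<lambda>t. gamma_gap t i" _ _ B])
        show "\<forall>\<^sub>F t in at_top. norm (\<Theta> i t * gamma_gap t i) \<le> norm (gamma_gap t i) * B"
          using eventually_ge_at_top[of 0]
        proof eventually_elim
          case (elim t)
          have "\<bar>\<Theta> i t\<bar> * \<bar>gamma_gap t i\<bar> \<le> B * \<bar>gamma_gap t i\<bar>"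
            using bounded[OF i elim] by (intro mult_right_mono) auto
          then show ?case unfolding real_norm_def abs_mult by (simp only: mult.commute)
        qed
      qed (rule gap[OF i])
    qed
    then show ?thesis unfolding correction_def by simp
  qed
  obtain G where G: "\<And>i t. i \<in> buses net \<Longrightarrow> t \<ge> 0 \<Longrightarrow> \<bar>gamma_gap t i\<bar> \<le> G i"
    by (rule gamma_gap_bounded) (rule that)
  have corr_le: "correction t \<le> (\<Sum>i\<in>buses net. \<bar>\<delta>a i\<bar> * (B * G i))" if t: "t \<ge> 0" for t
    unfolding correction_def
  proof (rule sum_mono)
    fix i assume i: "i \<in> buses net"
    have "\<delta>a i * (\<Theta> i t * gamma_gap t i) \<le> \<bar>\<delta>a i\<bar> * (\<bar>\<Theta> i t\<bar> * \<bar>gamma_gap t i\<bar>)"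
      by (metis abs_ge_self abs_mult)
    also have "\<dots> \<le> \<bar>\<delta>a i\<bar> * (B * G i)"
    proof (intro mult_left_mono mult_mono)
      show "0 \<le> B" using bounded[OF i t] by linarith
    qed (use bounded[OF i t] G[OF i t] in auto)
    finally show "\<delta>a i * (\<Theta> i t * gamma_gap t i) \<le> \<bar>\<delta>a i\<bar> * (B * G i)" .
  qed
  define Z where "Z t = V t - correction t + K * gamma_total t" for t
  have Z: "caratheodory_rate Z (\<lambda>t. V_rate t - correction_rate t + K * gamma_total_rate t)"
    unfolding Z_def
    by (intro caratheodory_rate_add caratheodory_rate_diff caratheodory_rate_cmult V_has_rate
        rate_correction rate_gamma_total)
  have rate_le: "V_rate t - correction_rate t + K * gamma_total_rate t \<le> 0" if t: "t \<ge> 0" for t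
  proof -
    have "gamma_total_rate t \<le> 0"
      unfolding gamma_total_rate_def using gamma_rate_nonpos[OF _ t] by (intro sum_nonpos add_nonpos_nonpos) auto
    then have "K * gamma_total_rate t \<le> phase_load t * gamma_total_rate t"
      using load_le[OF t] by (intro mult_right_mono_neg)
    then show ?thesis using modified_rate_le[OF t] dissipation_nonneg[of t] by linarith
  qed
  have K0: "K \<ge> 0" using load_le[of 0] unfolding phase_load_def
    by (smt (verit) abs_ge_zero mult_nonneg_nonneg sum_nonneg)
  obtain L where L: "(Z \<longlongrightarrow> L) at_top"
  proof (rule antimono_bounded_tendsto[of Z "- (\<Sum>i\<in>buses net. \<bar>\<delta>a i\<bar> * (B * G i))"])
    show "Z t \<le> Z s" if "0 \<le> s" "s \<le> t" for s t
      using that rate_le by (intro caratheodory_rate_decreasing[OF Z]) auto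
    show "- (\<Sum>i\<in>buses net. \<bar>\<delta>a i\<bar> * (B * G i)) \<le> Z t" if "t \<ge> 0" for t
      using corr_le[OF that] V0[of t] mult_nonneg_nonneg[OF K0 gamma_total_nonneg[OF that]]
      unfolding Z_def by linarith
  qed (use that in auto)
  obtain g where g: "(gamma_total \<longlongrightarrow> g) at_top"
  proof (rule antimono_bounded_tendsto[of gamma_total 0])
    show "gamma_total t \<le> gamma_total s" if "0 \<le> s" "s \<le> t" for s t
      unfolding gamma_total_def using that by (intro sum_mono add_mono gamma_decreasing)
  qed (use that gamma_total_nonneg in auto)
  have "((\<lambda>t. Z t + correction t - K * gamma_total t) \<longlongrightarrow> L + 0 - K * g) at_top"
    by (intro tendsto_intros L corr0 g)
  then have V_lim: "(V \<longlongrightarrow> L - K * g) at_top" by (simp add: Z_def)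
  then have "(\<lambda>n. V (\<rho> n)) \<longlonglongrightarrow> L - K * g" using \<rho> by (rule filterlim_compose)
  then have "L - K * g = 0" using limit by (rule LIMSEQ_unique)
  then show ?thesis using V_lim by simp
qed

end

section \<open>Boundedness and limits of the signals\<close>

lemma bounded_net_outflow:
  "(\<And>e. e \<in> A \<Longrightarrow> bounded_signal (\<lambda>t. f t e)) \<Longrightarrow> bounded_signal (\<lambda>t. net_outflow A (f t) i)"
  unfolding net_outflow_def by (intro bounded_signal_diff bounded_signal_sum) auto

lemma lipschitz_net_outflow:
  "(\<And>e. e \<in> A \<Longrightarrow> lipschitz_signal (\<lambda>t. f t e)) \<Longrightarrow> lipschitz_signal (\<lambda>t. net_outflow A (f t) i)"
  unfolding net_outflow_def by (intro lipschitz_signal_diff lipschitz_signal_sum) auto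

lemma bounded_proj_rate:
  assumes "bounded_signal z"
  shows "bounded_signal (\<lambda>t. proj_rate (z t) (y t))"
proof -
  obtain K where K: "K > 0" "\<And>t. 0 \<le> t \<Longrightarrow> \<bar>z t\<bar> \<le> K" using assms by (rule bounded_signalE) (rule that)
  show ?thesis
  proof (rule bounded_signalI)
    show "\<bar>proj_rate (z t) (y t)\<bar> \<le> K" if "t \<ge> 0" for t
      using K(1) K(2)[OF that] by (simp add: proj_rate_def)
  qed
qed

lemma tendsto_0_of_square:
  fixes f :: "real \<Rightarrow> real"
  assumes "((\<lambda>t. k * (f t)\<^sup>2) \<longlongrightarrow> 0) F" "k > 0"
  shows "(f \<longlongrightarrow> 0) F"
proof -
  have "((\<lambda>t. 1 / k * (k * (f t)\<^sup>2)) \<longlongrightarrow> 1 / k * 0) F" by (intro tendsto_intros assms)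
  then have "((\<lambda>t. sqrt ((f t)\<^sup>2)) \<longlongrightarrow> sqrt 0) F" using assms(2) by (intro tendsto_real_sqrt) simp
  then show ?thesis by (simp add: tendsto_rabs_zero_iff)
qed

lemma bounded_mult_tendsto_0:
  assumes "bounded_signal f" "(g \<longlongrightarrow> 0) at_top"
  shows "((\<lambda>t. f t * g t) \<longlongrightarrow> 0) at_top"
proof -
  obtain K where K: "\<And>t. 0 \<le> t \<Longrightarrow> \<bar>f t\<bar> \<le> K" using assms(1) by (rule bounded_signalE) (rule that)
  show ?thesis
  proof (rule tendsto_0_le[OF assms(2), of _ K])
    show "\<forall>\<^sub>F t in at_top. norm (f t * g t) \<le> norm (g t) * K"
      using eventually_ge_at_top[of 0]
    proof eventually_elim
      case (elim t)
      have "\<bar>f t\<bar> * \<bar>g t\<bar> \<le> K * \<bar>g t\<bar>" using K[OF elim] by (rule mult_right_mono) simp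
      then show ?case unfolding real_norm_def abs_mult by (simp only: mult.commute)
    qed
  qed
qed

text \<open>
  If the constraint is eventually slack by a fixed amount, a positive multiplier decreases at a rate
  bounded away from zero, reaches zero in finite time and stays there.
\<close>

lemma multiplier_vanishes:
  assumes y: "caratheodory_rate y (\<lambda>t. \<epsilon> * proj_rate (z t) (y t))" and nonneg: "\<And>t. t \<ge> 0 \<Longrightarrow> y t \<ge> 0"
    and "\<epsilon> > 0" and z: "(z \<longlongrightarrow> \<zeta>) at_top" "\<zeta> < 0"
  shows "(y \<longlongrightarrow> 0) at_top"
proof -
  have "\<forall>\<^sub>F t in at_top. z t < \<zeta> / 2" using z(2) by (intro order_tendstoD(2)[OF z(1)]) simp
  then obtain T0 where T0: "\<And>t. t \<ge> T0 \<Longrightarrow> z t < \<zeta> / 2" unfolding eventually_at_top_linorder by blast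
  define T where "T = max T0 0"
  have T: "T \<ge> 0" "\<And>t. t \<ge> T \<Longrightarrow> z t < \<zeta> / 2" using T0 by (auto simp: T_def)
  have rate: "\<epsilon> * proj_rate (z t) (y t) \<le> 0" if "t \<ge> T" for t
    using T(2)[OF that] z(2) \<open>\<epsilon> > 0\<close> by (auto simp: proj_rate_def mult_nonneg_nonpos)
  have dec: "y t \<le> y s" if "T \<le> s" "s \<le> t" for s t
    using that T(1) rate by (intro caratheodory_rate_decreasing[OF y]) auto
  have "\<exists>s\<ge>T. y s = 0"
  proof (rule ccontr)
    assume "\<not> (\<exists>s\<ge>T. y s = 0)"
    then have pos: "y s > 0" if "s \<ge> T" for s using nonneg[of s] T(1) that by force
    have rate': "\<epsilon> * proj_rate (z t) (y t) \<le> \<epsilon> * (\<zeta> / 2)" if "t \<ge> T" for t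
      using pos[OF that] T(2)[OF that] \<open>\<epsilon> > 0\<close> by (simp add: proj_rate_def)
    \<comment> \<open>The time after which the linear upper bound reaches zero.\<close>
    define s where "s = - 2 * y T / (\<epsilon> * \<zeta>)"
    have "\<epsilon> * \<zeta> < 0" using \<open>\<epsilon> > 0\<close> z(2) by (simp add: mult_pos_neg)
    then have s: "s \<ge> 0" "\<epsilon> * (\<zeta> / 2) * s = - y T"
      using pos[of T] by (auto simp: s_def divide_nonpos_neg field_simps)
    have "y (T + s) - y T \<le> \<epsilon> * (\<zeta> / 2) * (T + s - T)"
      using rate' T(1) s(1) by (intro caratheodory_rate_le[OF y]) auto
    then have "y (T + s) \<le> 0" using s(2) by simp
    then show False using pos[of "T + s"] s(1) by simp
  qed
  then obtain s where s: "s \<ge> T" "y s = 0" by blast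
  have "y t = 0" if "t \<ge> s" for t using dec[of s t] nonneg[of t] s T(1) that by simp
  then have "\<forall>\<^sub>F t in at_top. y t = 0" unfolding eventually_at_top_linorder by blast
  then show ?thesis by (rule tendsto_eventually)
qed

context phased_reference
begin

lemma V_bounded: obtains K where "\<And>t. t \<ge> 0 \<Longrightarrow> V t \<le> K"
proof -
  obtain Y Y_rate where Y: "caratheodory_rate Y Y_rate"
    "\<And>t. t \<ge> 0 \<Longrightarrow> V t \<le> 2 * Y t" "\<And>t. t \<ge> 0 \<Longrightarrow> Y_rate t \<le> - dissipation t"
    by (rule energy_certificate) (rule that)
  show thesis
  proof (rule that[of "2 * Y 0"])
    fix t :: real assume t: "t \<ge> 0"
    have "Y_rate s \<le> 0" if "s > 0" for s using Y(3)[of s] dissipation_nonneg[of s] that by linarith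
    then have "Y t \<le> Y 0" using t by (intro caratheodory_rate_decreasing[OF Y(1)]) auto
    then show "V t \<le> 2 * Y 0" using Y(2)[OF t] by linarith
  qed
qed

lemma bounded_if_sublinear:
  assumes "sublinear_in V y"
  shows "bounded_signal y"
proof -
  obtain K where K: "\<And>t. t \<ge> 0 \<Longrightarrow> V t \<le> K" by (rule V_bounded) (rule that)
  obtain C where C: "\<And>t. t \<ge> 0 \<Longrightarrow> \<bar>y t\<bar> \<le> 1 * V t + C"
    using assms zero_less_one by (rule sublinear_inE) (rule that)
  show ?thesis
  proof (rule bounded_signalI)
    show "\<bar>y t\<bar> \<le> K + C" if "t \<ge> 0" for t using K[OF that] C[OF that] by linarith
  qed
qed

lemma bounded_if_energy:
  assumes "\<And>t. (y t - k)\<^sup>2 / (2 * w) \<le> V t" "w > 0"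
  shows "bounded_signal y"
  by (rule bounded_if_sublinear[OF sublinear_in_square[OF assms]])

lemma bounded_states:
  "e \<in> lines net \<Longrightarrow> bounded_signal (\<lambda>t. flow (x t) e)"
  "i \<in> buses net \<Longrightarrow> bounded_signal (\<lambda>t. mu net ctrl (x t) i)"
  "i \<in> buses net \<Longrightarrow> bounded_signal (\<lambda>t. psi (x t) i)"
  "i \<in> buses net \<Longrightarrow> bounded_signal (\<lambda>t. gamma_up (x t) i)"
  "i \<in> buses net \<Longrightarrow> bounded_signal (\<lambda>t. gamma_lo (x t) i)"
  "e \<in> inner_lines net \<Longrightarrow> bounded_signal (\<lambda>t. sigma_up (x t) e)"
  "e \<in> inner_lines net \<Longrightarrow> bounded_signal (\<lambda>t. sigma_lo (x t) e)"
proof -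
  show "bounded_signal (\<lambda>t. flow (x t) e)" if "e \<in> lines net"
    by (rule bounded_if_energy[OF energy_ge(2)[OF that] weights_pos(2)[OF that]])
  show "bounded_signal (\<lambda>t. mu net ctrl (x t) i)" if "i \<in> buses net"
    by (rule bounded_if_energy[OF energy_ge(3)[OF that] weights_pos(3)[OF that]])
  show "bounded_signal (\<lambda>t. psi (x t) i)" if "i \<in> buses net"
    by (rule bounded_if_energy[OF energy_ge(4)[OF that] weights_pos(4)[OF that]])
  show "bounded_signal (\<lambda>t. gamma_up (x t) i)" if "i \<in> buses net"
    by (rule bounded_if_energy[OF energy_ge(5)[OF that] weights_pos(5)[OF that]])
  show "bounded_signal (\<lambda>t. gamma_lo (x t) i)" if "i \<in> buses net"
    by (rule bounded_if_energy[OF energy_ge(6)[OF that] weights_pos(6)[OF that]])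
  show "bounded_signal (\<lambda>t. sigma_up (x t) e)" if "e \<in> inner_lines net"
    by (rule bounded_if_energy[OF energy_ge(7)[OF that] weights_pos(7)[OF that]])
  show "bounded_signal (\<lambda>t. sigma_lo (x t) e)" if "e \<in> inner_lines net"
    by (rule bounded_if_energy[OF energy_ge(8)[OF that] weights_pos(8)[OF that]])
qed

lemma bounded_phase:
  obtains B where "\<And>i t. i \<in> buses net \<Longrightarrow> t \<ge> 0 \<Longrightarrow> \<bar>\<Theta> i t\<bar> \<le> B"
proof -
  have "bounded_signal state_size" by (rule bounded_if_sublinear[OF state_size_sublinear])
  then obtain K where K: "\<And>t. 0 \<le> t \<Longrightarrow> \<bar>state_size t\<bar> \<le> K" by (rule bounded_signalE) (rule that)
  show thesis
  proof (rule that)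
    fix i t assume "i \<in> buses net" "(t :: real) \<ge> 0"
    have "\<bar>\<Theta> i t\<bar> \<le> C\<^sub>\<Theta> * state_size t" by (rule phase_le) fact
    also have "\<dots> \<le> \<bar>C\<^sub>\<Theta>\<bar> * \<bar>state_size t\<bar>" by (metis abs_ge_self abs_mult)
    also have "\<dots> \<le> \<bar>C\<^sub>\<Theta>\<bar> * K" using K[OF \<open>t \<ge> 0\<close>] by (intro mult_left_mono) auto
    finally show "\<bar>\<Theta> i t\<bar> \<le> \<bar>C\<^sub>\<Theta>\<bar> * K" .
  qed
qed

lemma bounded_load: "i \<in> buses net \<Longrightarrow> bounded_signal (\<lambda>t. load (x t) i)"
  by (rule bounded_signalI[of _ "\<bar>load_min net i\<bar> + \<bar>load_max net i\<bar>"])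
    (use load_interior in \<open>fastforce simp: abs_real_def\<close>)

lemma freq_load_eq:
  assumes "i \<in> loads net" "t \<ge> 0"
  shows "freq (x t) i =
    1 / damping net i * (injection net i - load (x t) i - net_outflow (lines net) (flow (x t)) i)"
proof -
  have "i \<in> buses net" using assms gens_loads by auto
  then have "damping net i > 0" by (rule damping_pos)
  moreover have "damping net i * freq (x t) i = injection net i - load (x t) i - net_outflow (lines net) (flow (x t)) i"
    using power_excess_load[OF assms] unfolding power_excess_def by linarith
  ultimately show ?thesis by (simp add: field_simps)
qed

lemma bounded_cong:
  assumes "bounded_signal f" "\<And>t. t \<ge> 0 \<Longrightarrow> f t = g t"
  shows "bounded_signal g"
  using assms by (auto simp: bounded_signal_def)

lemma lipschitz_cong:
  assumes "lipschitz_signal f" "\<And>t. t \<ge> 0 \<Longrightarrow> f t = g t"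
  shows "lipschitz_signal g"
  using assms by (auto simp: lipschitz_signal_def)

lemma bounded_freq:
  assumes i: "i \<in> buses net"
  shows "bounded_signal (\<lambda>t. freq (x t) i)"
proof (cases "i \<in> gens net")
  case True
  show ?thesis
    by (rule bounded_if_sublinear, rule sublinear_in_square[OF energy_ge(1)[OF True] weights_pos(1)[OF True]])
next
  case False
  then have i': "i \<in> loads net" using i gens_loads by auto
  have "bounded_signal (\<lambda>t. 1 / damping net i * (injection net i - load (x t) i - net_outflow (lines net) (flow (x t)) i))"
    by (intro bounded_signal_cmult bounded_signal_diff bounded_net_outflow bounded_load bounded_states
        bounded_signal_const i)
  then show ?thesis by (rule bounded_cong) (simp add: freq_load_eq[OF i'])
qed

lemma bounded_angle_flow:
  assumes "\<And>i. i \<in> buses net \<Longrightarrow> bounded_signal (\<lambda>t. f t i)" "e \<in> inner_lines net"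
  shows "bounded_signal (\<lambda>t. angle_flow net (f t) e)"
  unfolding angle_flow_eq using assms(2) inner_lines_buses
  by (intro bounded_signal_cmult bounded_signal_diff assms(1)) auto

lemma lipschitz_angle_flow:
  assumes "\<And>i. i \<in> buses net \<Longrightarrow> lipschitz_signal (\<lambda>t. f t i)" "e \<in> inner_lines net"
  shows "lipschitz_signal (\<lambda>t. angle_flow net (f t) e)"
  unfolding angle_flow_eq using assms(2) inner_lines_buses
  by (intro lipschitz_signal_cmult lipschitz_signal_diff assms(1)) auto

lemma bounded_psi_drive:
  "e \<in> inner_lines net \<Longrightarrow> bounded_signal (\<lambda>t. psi_drive (x t) e)"
  by (intro bounded_signal_diff bounded_signal_cmult bounded_angle_flow bounded_states)

lemma lipschitz_flow: "e \<in> lines net \<Longrightarrow> lipschitz_signal (\<lambda>t. flow (x t) e)"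
  by (rule caratheodory_rate_lipschitz[OF rate_flow], assumption)
    (intro bounded_signal_cmult bounded_signal_diff bounded_freq line_ends)

lemma lipschitz_mu: "i \<in> buses net \<Longrightarrow> lipschitz_signal (\<lambda>t. mu net ctrl (x t) i)"
  by (rule caratheodory_rate_lipschitz[OF rate_mu], assumption)
    (intro bounded_signal_cmult bounded_signal_diff bounded_signal_add bounded_freq bounded_load
      bounded_net_outflow bounded_angle_flow bounded_states bounded_signal_const)

lemma lipschitz_psi: "i \<in> buses net \<Longrightarrow> lipschitz_signal (\<lambda>t. psi (x t) i)"
  by (rule caratheodory_rate_lipschitz[OF rate_psi], assumption)
    (intro bounded_signal_cmult bounded_net_outflow bounded_psi_drive)

lemma lipschitz_gamma:
  assumes "i \<in> buses net"
  shows "lipschitz_signal (\<lambda>t. gamma_up (x t) i)" "lipschitz_signal (\<lambda>t. gamma_lo (x t) i)"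
proof -
  have "bounded_signal (\<lambda>t. - load (x t) i + load_min net i)"
    using bounded_signal_diff[OF bounded_signal_const bounded_load[OF assms], of "load_min net i"]
    by (simp add: algebra_simps)
  then show "lipschitz_signal (\<lambda>t. gamma_lo (x t) i)"
    by (intro caratheodory_rate_lipschitz[OF rate_gamma(2)[OF assms]] bounded_signal_cmult bounded_proj_rate)
  show "lipschitz_signal (\<lambda>t. gamma_up (x t) i)"
    by (intro caratheodory_rate_lipschitz[OF rate_gamma(1)[OF assms]] bounded_signal_cmult bounded_proj_rate
        bounded_signal_diff bounded_load bounded_signal_const assms)
qed

lemma lipschitz_sigma:
  assumes "e \<in> inner_lines net"
  shows "lipschitz_signal (\<lambda>t. sigma_up (x t) e)" "lipschitz_signal (\<lambda>t. sigma_lo (x t) e)"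
proof -
  have f: "bounded_signal (\<lambda>t. angle_flow net (psi (x t)) e)"
    by (intro bounded_angle_flow bounded_states assms)
  have "bounded_signal (\<lambda>t. - angle_flow net (psi (x t)) e + flow_min net e)"
    using bounded_signal_diff[OF bounded_signal_const f, of "flow_min net e"]
    by (simp add: algebra_simps)
  then show "lipschitz_signal (\<lambda>t. sigma_lo (x t) e)"
    by (intro caratheodory_rate_lipschitz[OF rate_sigma(2)[OF assms]] bounded_signal_cmult bounded_proj_rate)
  show "lipschitz_signal (\<lambda>t. sigma_up (x t) e)"
    by (intro caratheodory_rate_lipschitz[OF rate_sigma(1)[OF assms]] bounded_signal_cmult bounded_proj_rate
        bounded_signal_diff f bounded_signal_const)
qed

lemma lipschitz_freq_gen:
  assumes "i \<in> gens net"
  shows "lipschitz_signal (\<lambda>t. freq (x t) i)"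
proof (rule caratheodory_rate_lipschitz[OF rate_freq[OF assms]])
  have i: "i \<in> buses net" using assms by (rule gens_buses)
  have "bounded_signal (\<lambda>t. - 1 / inertia net i * power_excess net (x t) i)"
    unfolding power_excess_def
    by (intro bounded_signal_cmult bounded_signal_add bounded_signal_diff bounded_freq bounded_load
        bounded_net_outflow bounded_states bounded_signal_const i)
  then show "bounded_signal (\<lambda>t. - power_excess net (x t) i / inertia net i)" by simp
qed

text \<open>
  The load is defined implicitly. At a generator the marginal cost equation expresses \<open>c' (d)\<close>, at a
  load bus, after elimination of the algebraic frequency, it expresses \<open>c' (d) + d / D\<close>, by Lipschitz
  coordinates; both are strongly monotone in \<open>d\<close>.
\<close>

lemma lipschitz_load:
  assumes i: "i \<in> buses net"
  shows "lipschitz_signal (\<lambda>t. load (x t) i)"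
proof (cases "i \<in> gens net")
  case True
  have "lipschitz_signal (\<lambda>t. freq (x t) i + mu net ctrl (x t) i - gamma_up (x t) i + gamma_lo (x t) i)"
    by (intro lipschitz_signal_add lipschitz_signal_diff lipschitz_freq_gen lipschitz_mu lipschitz_gamma i True)
  then have "lipschitz_signal (\<lambda>t. deriv (c i) (load (x t) i))"
    by (rule lipschitz_cong) (simp add: marginal_cost_eq[OF i])
  then show ?thesis
  proof (rule lipschitz_signal_dominated[of _ _ "1 / u"])
    show "\<bar>load (x t) i - load (x s) i\<bar> \<le> 1 / u * \<bar>deriv (c i) (load (x t) i) - deriv (c i) (load (x s) i)\<bar>" for s t
      using marginal_cost_monotone(2)[OF i, of "load (x t) i" "load (x s) i"] u_pos by (simp add: field_simps)
  qed (use u_pos in simp)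
next
  case False
  then have i': "i \<in> loads net" using i gens_loads by auto
  let ?D = "damping net i"
  have D: "?D > 0" using damping_pos i by blast
  let ?y = "\<lambda>t. 1 / ?D * (injection net i - net_outflow (lines net) (flow (x t)) i)
     + mu net ctrl (x t) i - gamma_up (x t) i + gamma_lo (x t) i"
  have y: "lipschitz_signal ?y"
    by (intro lipschitz_signal_add lipschitz_signal_diff lipschitz_signal_cmult lipschitz_signal_const
        lipschitz_net_outflow lipschitz_flow lipschitz_mu lipschitz_gamma i)
  have y_eq: "?y t = deriv (c i) (load (x t) i) + 1 / ?D * load (x t) i" if "t \<ge> 0" for t
    unfolding marginal_cost_eq[OF i that] freq_load_eq[OF i' that] by (simp add: algebra_simps diff_divide_distrib)
  show ?thesis
  proof (rule lipschitz_signal_dominated[OF y, of _ "1 / u"])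
    fix s t :: real assume st: "0 \<le> s" "0 \<le> t"
    let ?a = "load (x t) i" and ?b = "load (x s) i"
    let ?g = "deriv (c i) ?a - deriv (c i) ?b"
    \<comment> \<open>The two summands have the same sign by monotonicity of the marginal cost.\<close>
    have "\<bar>?g\<bar> \<le> \<bar>?g + 1 / ?D * (?a - ?b)\<bar>"
    proof (cases "?g \<ge> 0 \<and> ?a - ?b \<ge> 0 \<or> ?g \<le> 0 \<and> ?a - ?b \<le> 0")
      case True
      then show ?thesis
      proof
        assume "?g \<ge> 0 \<and> ?a - ?b \<ge> 0"
        then have "0 \<le> 1 / ?D * (?a - ?b)" using D by simp
        then show ?thesis using \<open>?g \<ge> 0 \<and> ?a - ?b \<ge> 0\<close> by linarith
      next
        assume *: "?g \<le> 0 \<and> ?a - ?b \<le> 0"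
        then have "1 / ?D * (?a - ?b) \<le> 0" using D by (intro mult_nonneg_nonpos) auto
        then show ?thesis using * by linarith
      qed
    next
      case False
      then have "?g * (?a - ?b) < 0" by (auto simp: mult_less_0_iff)
      then show ?thesis using marginal_cost_monotone(3)[OF i, of ?a ?b] by linarith
    qed
    also have "?g + 1 / ?D * (?a - ?b) = ?y t - ?y s"
      unfolding y_eq[OF st(1)] y_eq[OF st(2)] by (simp add: algebra_simps)
    finally have "u * \<bar>?a - ?b\<bar> \<le> \<bar>?y t - ?y s\<bar>"
      using marginal_cost_monotone(2)[OF i, of ?a ?b] by linarith
    then show "\<bar>?a - ?b\<bar> \<le> 1 / u * \<bar>?y t - ?y s\<bar>" using u_pos by (simp add: field_simps)
  qed (use u_pos in simp)
qed

lemma lipschitz_freq: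
  assumes i: "i \<in> buses net"
  shows "lipschitz_signal (\<lambda>t. freq (x t) i)"
proof (cases "i \<in> gens net")
  case True
  then show ?thesis by (rule lipschitz_freq_gen)
next
  case False
  then have i': "i \<in> loads net" using i gens_loads by auto
  have "lipschitz_signal (\<lambda>t. 1 / damping net i * (injection net i - load (x t) i - net_outflow (lines net) (flow (x t)) i))"
    by (intro lipschitz_signal_cmult lipschitz_signal_diff lipschitz_net_outflow lipschitz_load lipschitz_flow
        lipschitz_signal_const i)
  then show ?thesis by (rule lipschitz_cong) (simp add: freq_load_eq[OF i'])
qed

lemma freq_load_converge:
  assumes i: "i \<in> buses net"
  shows "((\<lambda>t. freq (x t) i) \<longlongrightarrow> 0) at_top" "((\<lambda>t. load (x t) i) \<longlongrightarrow> d' i) at_top"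
proof -
  obtain Y Y_rate where Y: "caratheodory_rate Y Y_rate" "\<And>t. t \<ge> 0 \<Longrightarrow> 0 \<le> Y t"
    "\<And>t. t \<ge> 0 \<Longrightarrow> Y_rate t \<le> - dissipation t"
    by (rule energy_certificate) (rule that)
  obtain \<kappa> where \<kappa>: "\<kappa> > 0" "\<And>i t. i \<in> buses net \<Longrightarrow> \<kappa> * (freq (x t) i)\<^sup>2 \<le> dissipation t"
    "\<And>i t. i \<in> buses net \<Longrightarrow> \<kappa> * (load (x t) i - d' i)\<^sup>2 \<le> dissipation t"
    by (rule dissipation_ge) (rule that)
  have vanish: "(f \<longlongrightarrow> 0) at_top"
    if f: "lipschitz_signal f" "bounded_signal f" "\<And>t. \<kappa> * (f t)\<^sup>2 \<le> dissipation t" for f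
  proof (rule tendsto_0_of_square[OF _ \<kappa>(1)])
    show "((\<lambda>t. \<kappa> * (f t)\<^sup>2) \<longlongrightarrow> 0) at_top"
    proof (rule dissipation_vanishes[OF Y(1,2)])
      show "lipschitz_signal (\<lambda>t. \<kappa> * (f t)\<^sup>2)"
        unfolding power2_eq_square by (intro lipschitz_signal_cmult lipschitz_signal_mult f)
      show "0 \<le> \<kappa> * (f t)\<^sup>2" for t using \<kappa>(1) by simp
      show "Y_rate t \<le> - (\<kappa> * (f t)\<^sup>2)" if "t \<ge> 0" for t using Y(3)[OF that] f(3)[of t] by linarith
    qed
  qed
  show "((\<lambda>t. freq (x t) i) \<longlongrightarrow> 0) at_top"
    by (rule vanish[OF lipschitz_freq bounded_freq \<kappa>(2)]) (rule i)+
  have "((\<lambda>t. load (x t) i - d' i) \<longlongrightarrow> 0) at_top"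
    by (intro vanish lipschitz_signal_diff bounded_signal_diff lipschitz_load bounded_load
        lipschitz_signal_const bounded_signal_const \<kappa>(3) i)
  then show "((\<lambda>t. load (x t) i) \<longlongrightarrow> d' i) at_top" by (simp add: LIM_zero_iff)
qed

text \<open>
  At generators the frequency and, by Barbalat's lemma, its rate tend to zero; at loads the power
  balance holds exactly.
\<close>

lemma outflow_converges:
  assumes i: "i \<in> buses net"
  shows "((\<lambda>t. net_outflow (lines net) (flow (x t)) i) \<longlongrightarrow> injection net i - d' i) at_top"
proof -
  have "((\<lambda>t. power_excess net (x t) i) \<longlongrightarrow> 0) at_top"
  proof (cases "i \<in> gens net")
    case True
    have M: "inertia net i > 0" by (rule inertia_pos[OF True])
    have "lipschitz_signal (\<lambda>t. - 1 / inertia net i * power_excess net (x t) i)"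
      unfolding power_excess_def
      by (intro lipschitz_signal_cmult lipschitz_signal_add lipschitz_signal_diff lipschitz_freq lipschitz_load
          lipschitz_net_outflow lipschitz_flow lipschitz_signal_const i)
    then have "lipschitz_signal (\<lambda>t. - power_excess net (x t) i / inertia net i)" by simp
    then have "((\<lambda>t. - power_excess net (x t) i / inertia net i) \<longlongrightarrow> 0) at_top"
      by (rule barbalat[OF rate_freq[OF True] freq_load_converge(1)[OF i]])
    then have "((\<lambda>t. - inertia net i * (- power_excess net (x t) i / inertia net i)) \<longlongrightarrow> - inertia net i * 0) at_top"
      by (intro tendsto_intros)
    then show ?thesis using M by simp
  next
    case False
    then have "i \<in> loads net" using i gens_loads by auto
    have "\<forall>\<^sub>F t in at_top. power_excess net (x t) i = 0"
      using eventually_ge_at_top[of 0] by eventually_elim (rule power_excess_load[OF \<open>i \<in> loads net\<close>])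
    then show ?thesis by (rule tendsto_eventually)
  qed
  then have "((\<lambda>t. power_excess net (x t) i - damping net i * freq (x t) i - load (x t) i + injection net i)
      \<longlongrightarrow> 0 - damping net i * 0 - d' i + injection net i) at_top"
    by (intro tendsto_intros freq_load_converge i)
  then show ?thesis by (simp add: power_excess_def)
qed

text \<open>
  The limits exist because the multipliers are nonincreasing and nonnegative, see \<open>gamma_limits\<close>.
\<close>

definition gamma_up_limit :: "'a \<Rightarrow> real" where
  "gamma_up_limit i = (THE a. ((\<lambda>t. gamma_up (x t) i) \<longlongrightarrow> a) at_top)"

definition gamma_lo_limit :: "'a \<Rightarrow> real" where
  "gamma_lo_limit i = (THE a. ((\<lambda>t. gamma_lo (x t) i) \<longlongrightarrow> a) at_top)"

definition mu_limit :: "'a \<Rightarrow> real" where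
  "mu_limit i = deriv (c i) (d' i) + gamma_up_limit i - gamma_lo_limit i"

lemma gamma_limits:
  assumes i: "i \<in> buses net"
  shows "((\<lambda>t. gamma_up (x t) i) \<longlongrightarrow> gamma_up_limit i) at_top"
    "((\<lambda>t. gamma_lo (x t) i) \<longlongrightarrow> gamma_lo_limit i) at_top"
    "0 \<le> gamma_up_limit i" "0 \<le> gamma_lo_limit i"
    "gamma_up_limit i * (d' i - load_max net i) = 0" "gamma_lo_limit i * (load_min net i - d' i) = 0"
proof -
  obtain a b where ab: "((\<lambda>t. gamma_up (x t) i) \<longlongrightarrow> a) at_top" "((\<lambda>t. gamma_lo (x t) i) \<longlongrightarrow> b) at_top"
    "0 \<le> a" "0 \<le> b"
    by (rule gamma_converges[OF i]) (rule that)
  have lims: "gamma_up_limit i = a" "gamma_lo_limit i = b"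
    unfolding gamma_up_limit_def gamma_lo_limit_def
    using ab tendsto_unique[OF trivial_limit_at_top_linorder] by blast+
  show "((\<lambda>t. gamma_up (x t) i) \<longlongrightarrow> gamma_up_limit i) at_top"
    "((\<lambda>t. gamma_lo (x t) i) \<longlongrightarrow> gamma_lo_limit i) at_top"
    "0 \<le> gamma_up_limit i" "0 \<le> gamma_lo_limit i"
    unfolding lims by (rule ab)+
  have d: "((\<lambda>t. load (x t) i - load_max net i) \<longlongrightarrow> d' i - load_max net i) at_top"
    "((\<lambda>t. - load (x t) i + load_min net i) \<longlongrightarrow> - d' i + load_min net i) at_top"
    by (intro tendsto_intros freq_load_converge i)+
  show "gamma_up_limit i * (d' i - load_max net i) = 0"
  proof (cases "d' i < load_max net i")
    case True
    then have "((\<lambda>t. gamma_up (x t) i) \<longlongrightarrow> 0) at_top"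
      by (intro multiplier_vanishes[OF rate_gamma(1)[OF i] gamma_nonneg(1)[OF i] eps_pos(3)[OF i] d(1)]) auto
    then have "a = 0" using ab(1) tendsto_unique[OF trivial_limit_at_top_linorder] by blast
    then show ?thesis by (simp add: lims)
  next
    case False
    then show ?thesis using saddle_facts(4)[OF i] by simp
  qed
  show "gamma_lo_limit i * (load_min net i - d' i) = 0"
  proof (cases "load_min net i < d' i")
    case True
    then have "((\<lambda>t. gamma_lo (x t) i) \<longlongrightarrow> 0) at_top"
      by (intro multiplier_vanishes[OF rate_gamma(2)[OF i] gamma_nonneg(2)[OF i] eps_pos(4)[OF i] d(2)]) auto
    then have "b = 0" using ab(2) tendsto_unique[OF trivial_limit_at_top_linorder] by blast
    then show ?thesis by (simp add: lims)
  next
    case False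
    then show ?thesis using saddle_facts(3)[OF i] by simp
  qed
qed

lemma mu_converges:
  assumes i: "i \<in> buses net"
  shows "((\<lambda>t. mu net ctrl (x t) i) \<longlongrightarrow> mu_limit i) at_top"
proof -
  have "isCont (deriv (c i)) (d' i)"
    using marginal_cost_diff[OF i] by (rule field_differentiable_imp_continuous_at)
  then have "((\<lambda>t. deriv (c i) (load (x t) i)) \<longlongrightarrow> deriv (c i) (d' i)) at_top"
    using freq_load_converge(2)[OF i] by (rule isCont_tendsto_compose)
  then have "((\<lambda>t. deriv (c i) (load (x t) i) - freq (x t) i + gamma_up (x t) i - gamma_lo (x t) i)
      \<longlongrightarrow> deriv (c i) (d' i) - 0 + gamma_up_limit i - gamma_lo_limit i) at_top"
    by (intro tendsto_intros freq_load_converge gamma_limits i)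
  moreover have "\<forall>\<^sub>F t in at_top. deriv (c i) (load (x t) i) - freq (x t) i + gamma_up (x t) i - gamma_lo (x t) i
      = mu net ctrl (x t) i"
    using eventually_ge_at_top[of 0] by eventually_elim (simp add: marginal_cost_eq[OF i])
  ultimately show ?thesis unfolding mu_limit_def by (simp add: tendsto_cong)
qed

text \<open>
  Barbalat's lemma for \<open>mu\<close> shows that \<open>y = psi - \<psi>'\<close> has vanishing outflows in the limit. As \<open>y\<close> is
  bounded, the energy \<open>\<Sum> B (y\<^sub>i - y\<^sub>j)\<^sup>2\<close>, which is the sum of \<open>y\<close> times its outflow, tends to zero. So
  the virtual flows converge to those of the reference point, whatever \<open>psi\<close> itself does.
\<close>

lemma angle_flow_converges:
  assumes e: "e \<in> inner_lines net"
  shows "((\<lambda>t. angle_flow net (psi (x t)) e) \<longlongrightarrow> angle_flow net \<psi>' e) at_top"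
proof -
  let ?N = "buses net" and ?F = "inner_lines net"
  let ?y = "\<lambda>t i. psi (x t) i - \<psi>' i"
  have out0: "((\<lambda>t. net_outflow ?F (angle_flow net (?y t)) i) \<longlongrightarrow> 0) at_top" if i: "i \<in> ?N" for i
  proof -
    have "lipschitz_signal (\<lambda>t. mu_rate t i)"
      by (intro lipschitz_signal_cmult lipschitz_signal_diff lipschitz_signal_add lipschitz_freq lipschitz_load
          lipschitz_net_outflow lipschitz_angle_flow lipschitz_psi lipschitz_signal_const i)
    then have "((\<lambda>t. mu_rate t i) \<longlongrightarrow> 0) at_top" by (rule barbalat[OF rate_mu[OF i] mu_converges[OF i]])
    then have "((\<lambda>t. d' i - load (x t) i + \<delta>a i * freq (x t) i - 1 / eps_mu ctrl i * mu_rate t i)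
        \<longlongrightarrow> d' i - d' i + \<delta>a i * 0 - 1 / eps_mu ctrl i * 0) at_top"
      by (intro tendsto_intros freq_load_converge i)
    moreover have "d' i - load (x t) i + \<delta>a i * freq (x t) i - 1 / eps_mu ctrl i * mu_rate t i
        = net_outflow ?F (angle_flow net (?y t)) i" for t
    proof -
      have "angle_flow net (?y t) = (\<lambda>e. angle_flow net (psi (x t)) e - angle_flow net \<psi>' e)"
        by (auto simp: angle_flow_eq algebra_simps)
      then show ?thesis using saddle_facts(2)[OF i] eps_pos(1)[OF i] by (simp add: net_outflow_diff)
    qed
    ultimately show ?thesis by simp
  qed
  have "((\<lambda>t. \<Sum>i\<in>?N. ?y t i * net_outflow ?F (angle_flow net (?y t)) i) \<longlongrightarrow> (\<Sum>i\<in>?N. 0)) at_top"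
    by (intro tendsto_sum bounded_mult_tendsto_0 out0 bounded_signal_diff bounded_states bounded_signal_const)
  then have energy0: "((\<lambda>t. \<Sum>e\<in>?F. suscept net e * (?y t (fst e) - ?y t (snd e))\<^sup>2) \<longlongrightarrow> 0) at_top"
    by (simp add: sum_mult_net_outflow[OF finite_buses inner_lines_buses] angle_flow_eq power2_eq_square mult_ac)
  have B: "suscept net e > 0" if "e \<in> ?F" for e using that inner_lines_subset line_suscept_pos by blast
  have "((\<lambda>t. suscept net e * (?y t (fst e) - ?y t (snd e))\<^sup>2) \<longlongrightarrow> 0) at_top"
  proof (rule tendsto_sandwich[OF _ _ tendsto_const energy0])
    show "\<forall>\<^sub>F t in at_top. 0 \<le> suscept net e * (?y t (fst e) - ?y t (snd e))\<^sup>2" using B[OF e] by simp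
    show "\<forall>\<^sub>F t in at_top. suscept net e * (?y t (fst e) - ?y t (snd e))\<^sup>2
        \<le> (\<Sum>e\<in>?F. suscept net e * (?y t (fst e) - ?y t (snd e))\<^sup>2)"
    proof (intro always_eventually allI)
      fix t
      show "suscept net e * (?y t (fst e) - ?y t (snd e))\<^sup>2
        \<le> (\<Sum>e\<in>?F. suscept net e * (?y t (fst e) - ?y t (snd e))\<^sup>2)"
        by (rule member_le_sum[OF e _ finite_inner_lines, of "\<lambda>e. suscept net e * (?y t (fst e) - ?y t (snd e))\<^sup>2"])
          (use B in \<open>auto simp: less_imp_le\<close>)
    qed
  qed
  then have "((\<lambda>t. ?y t (fst e) - ?y t (snd e)) \<longlongrightarrow> 0) at_top" using B[OF e] by (rule tendsto_0_of_square)
  then have "((\<lambda>t. suscept net e * (?y t (fst e) - ?y t (snd e)) + angle_flow net \<psi>' e)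
      \<longlongrightarrow> suscept net e * 0 + angle_flow net \<psi>' e) at_top"
    by (intro tendsto_intros)
  then show ?thesis by (simp add: angle_flow_eq algebra_simps)
qed

lemma sigma_limits:
  assumes e: "e \<in> inner_lines net"
  shows "angle_flow net \<psi>' e < flow_max net e \<Longrightarrow> ((\<lambda>t. sigma_up (x t) e) \<longlongrightarrow> 0) at_top"
    "flow_min net e < angle_flow net \<psi>' e \<Longrightarrow> ((\<lambda>t. sigma_lo (x t) e) \<longlongrightarrow> 0) at_top"
proof -
  have f: "((\<lambda>t. angle_flow net (psi (x t)) e - flow_max net e) \<longlongrightarrow> angle_flow net \<psi>' e - flow_max net e) at_top"
    "((\<lambda>t. - angle_flow net (psi (x t)) e + flow_min net e) \<longlongrightarrow> - angle_flow net \<psi>' e + flow_min net e) at_top"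
    by (intro tendsto_intros angle_flow_converges e)+
  show "((\<lambda>t. sigma_up (x t) e) \<longlongrightarrow> 0) at_top" if "angle_flow net \<psi>' e < flow_max net e"
    using that
    by (intro multiplier_vanishes[OF rate_sigma(1)[OF e] sigma_nonneg(1)[OF e] eps_sigma_pos(1)[OF e] f(1)]) auto
  show "((\<lambda>t. sigma_lo (x t) e) \<longlongrightarrow> 0) at_top" if "flow_min net e < angle_flow net \<psi>' e"
    using that
    by (intro multiplier_vanishes[OF rate_sigma(2)[OF e] sigma_nonneg(2)[OF e] eps_sigma_pos(2)[OF e] f(2)]) auto
qed

text \<open>
  Stationarity in \<open>psi\<close> is obtained from convergence of the virtual flows alone: their rates tend to
  zero by Barbalat's lemma, and summation by parts expresses \<open>\<Sum>\<^sub>i \<epsilon>\<^sub>i h\<^sub>i\<^sup>2\<close>, for the outflows \<open>h\<close> of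
  \<open>psi_drive\<close>, through these rates with bounded coefficients.
\<close>

lemma psi_drive_vanishes:
  assumes i: "i \<in> buses net"
  shows "((\<lambda>t. net_outflow (inner_lines net) (psi_drive (x t)) i) \<longlongrightarrow> 0) at_top"
proof -
  let ?N = "buses net" and ?F = "inner_lines net"
  let ?h = "\<lambda>t i. net_outflow ?F (psi_drive (x t)) i"
  let ?r = "\<lambda>t i. eps_psi ctrl i * ?h t i"
  have r0: "((\<lambda>t. angle_flow net (?r t) e) \<longlongrightarrow> 0) at_top" if e: "e \<in> ?F" for e
  proof (rule barbalat[OF _ angle_flow_converges[OF e]])
    have ends: "fst e \<in> ?N" "snd e \<in> ?N" using e inner_lines_buses by auto
    show "caratheodory_rate (\<lambda>t. angle_flow net (psi (x t)) e) (\<lambda>t. angle_flow net (?r t) e)"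
      unfolding angle_flow_eq
      by (rule caratheodory_rate_cmult[OF caratheodory_rate_diff[OF rate_psi[OF ends(1)] rate_psi[OF ends(2)], unfolded angle_flow_eq]])
    show "lipschitz_signal (\<lambda>t. angle_flow net (?r t) e)"
      by (intro lipschitz_angle_flow lipschitz_signal_cmult lipschitz_net_outflow lipschitz_signal_diff
          lipschitz_mu lipschitz_sigma e)
  qed
  have "((\<lambda>t. \<Sum>e\<in>?F. psi_drive (x t) e * (1 / suscept net e * angle_flow net (?r t) e)) \<longlongrightarrow> (\<Sum>e\<in>?F. 0)) at_top"
  proof (rule tendsto_sum)
    fix e assume e: "e \<in> ?F"
    then have "((\<lambda>t. 1 / suscept net e * angle_flow net (?r t) e) \<longlongrightarrow> 0) at_top"
      using tendsto_mult_left[OF r0, of e "1 / suscept net e"] by simp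
    then show "((\<lambda>t. psi_drive (x t) e * (1 / suscept net e * angle_flow net (?r t) e)) \<longlongrightarrow> 0) at_top"
      by (rule bounded_mult_tendsto_0[OF bounded_psi_drive[OF e]])
  qed
  moreover have "(\<Sum>e\<in>?F. psi_drive (x t) e * (1 / suscept net e * angle_flow net (?r t) e))
      = (\<Sum>i\<in>?N. eps_psi ctrl i * (?h t i)\<^sup>2)" for t
  proof -
    have "(\<Sum>i\<in>?N. eps_psi ctrl i * (?h t i)\<^sup>2) = (\<Sum>i\<in>?N. ?r t i * ?h t i)"
      by (simp add: power2_eq_square mult.assoc)
    also have "\<dots> = (\<Sum>e\<in>?F. (?r t (fst e) - ?r t (snd e)) * psi_drive (x t) e)"
      by (rule sum_mult_net_outflow[OF finite_buses inner_lines_buses])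
    also have "\<dots> = (\<Sum>e\<in>?F. psi_drive (x t) e * (1 / suscept net e * angle_flow net (?r t) e))"
    proof (intro sum.cong refl)
      fix e assume "e \<in> ?F"
      then have B: "suscept net e > 0" using inner_lines_subset line_suscept_pos by blast
      have "1 / suscept net e * angle_flow net (?r t) e = ?r t (fst e) - ?r t (snd e)"
        unfolding angle_flow_eq[of net "?r t"] using B by simp
      then show "(?r t (fst e) - ?r t (snd e)) * psi_drive (x t) e
          = psi_drive (x t) e * (1 / suscept net e * angle_flow net (?r t) e)" by (simp only: mult.commute)
    qed
    finally show ?thesis by simp
  qed
  ultimately have sum0: "((\<lambda>t. \<Sum>i\<in>?N. eps_psi ctrl i * (?h t i)\<^sup>2) \<longlongrightarrow> 0) at_top" by simp
  have "((\<lambda>t. eps_psi ctrl i * (?h t i)\<^sup>2) \<longlongrightarrow> 0) at_top"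
  proof (rule tendsto_sandwich[OF _ _ tendsto_const sum0])
    show "\<forall>\<^sub>F t in at_top. 0 \<le> eps_psi ctrl i * (?h t i)\<^sup>2" using eps_pos(2)[OF i] by simp
    show "\<forall>\<^sub>F t in at_top. eps_psi ctrl i * (?h t i)\<^sup>2 \<le> (\<Sum>i\<in>?N. eps_psi ctrl i * (?h t i)\<^sup>2)"
    proof (intro always_eventually allI)
      fix t
      show "eps_psi ctrl i * (?h t i)\<^sup>2 \<le> (\<Sum>i\<in>?N. eps_psi ctrl i * (?h t i)\<^sup>2)"
        by (rule member_le_sum[OF i _ finite_buses, of "\<lambda>i. eps_psi ctrl i * (?h t i)\<^sup>2"])
          (use eps_pos(2) in \<open>auto simp: less_imp_le\<close>)
    qed
  qed
  then show ?thesis using eps_pos(2)[OF i] by (rule tendsto_0_of_square)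
qed

end

section \<open>Convergence to an optimal point\<close>

lemma tendsto_weighted_square:
  fixes f :: "'b \<Rightarrow> real"
  assumes "(f \<longlongrightarrow> k) F"
  shows "((\<lambda>n. (f n - k)\<^sup>2 / (2 * w)) \<longlongrightarrow> 0) F"
proof -
  have "((\<lambda>n. 1 / (2 * w) * (f n - k)\<^sup>2) \<longlongrightarrow> 1 / (2 * w) * (k - k)\<^sup>2) F"
    by (intro tendsto_intros assms)
  then show ?thesis by simp
qed

context phased_reference
begin

text \<open>
  Only the physical flows, the angles and the line multipliers need a subsequence; everything else in
  the optimality conditions converges along the whole trajectory.
\<close>

lemma limit_point_saddle:
  obtains \<rho> P \<psi> p q where "filterlim \<rho> at_top sequentially"
    "\<And>e. e \<in> lines net \<Longrightarrow> (\<lambda>n. flow (x (\<rho> n)) e) \<longlonglongrightarrow> P e"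
    "\<And>i. i \<in> buses net \<Longrightarrow> (\<lambda>n. psi (x (\<rho> n)) i) \<longlonglongrightarrow> \<psi> i"
    "\<And>e. e \<in> inner_lines net \<Longrightarrow> (\<lambda>n. sigma_up (x (\<rho> n)) e) \<longlonglongrightarrow> p e"
    "\<And>e. e \<in> inner_lines net \<Longrightarrow> (\<lambda>n. sigma_lo (x (\<rho> n)) e) \<longlonglongrightarrow> q e"
    "ROLC_saddle net c d' P \<psi> mu_limit gamma_up_limit gamma_lo_limit p q"
proof -
  let ?N = "buses net" and ?E = "lines net" and ?F = "inner_lines net"
  define z where "z k n = (case k of Inl (Inl e) \<Rightarrow> flow (x (real n)) e | Inl (Inr i) \<Rightarrow> psi (x (real n)) i
      | Inr (Inl e) \<Rightarrow> sigma_up (x (real n)) e | Inr (Inr e) \<Rightarrow> sigma_lo (x (real n)) e)" for k n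
  have range: "bounded (range (\<lambda>n. f (real n)))" if bd: "bounded_signal f" for f
  proof -
    obtain K where K: "\<And>t. 0 \<le> t \<Longrightarrow> \<bar>f t\<bar> \<le> K" using bd by (rule bounded_signalE) (rule that)
    then have "\<bar>f (real n)\<bar> \<le> K" for n by simp
    then show ?thesis unfolding bounded_real by blast
  qed
  have fin: "finite ((?E <+> ?N) <+> (?F <+> ?F))"
    using finite_lines finite_buses finite_inner_lines by simp
  have bdd: "bounded (range (z k))" if "k \<in> (?E <+> ?N) <+> (?F <+> ?F)" for k
    using that unfolding z_def by (auto intro!: range bounded_states)
  obtain r where r: "strict_mono r" "\<And>k. k \<in> (?E <+> ?N) <+> (?F <+> ?F) \<Longrightarrow> convergent (\<lambda>n. z k (r n))"
    by (rule finite_family_convergent_subseq[OF fin bdd]) (assumption, rule that)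
  define \<rho> where "\<rho> n = real (r n)" for n
  define P where "P e = lim (\<lambda>n. flow (x (\<rho> n)) e)" for e
  define \<psi> where "\<psi> i = lim (\<lambda>n. psi (x (\<rho> n)) i)" for i
  define p where "p e = lim (\<lambda>n. sigma_up (x (\<rho> n)) e)" for e
  define q where "q e = lim (\<lambda>n. sigma_lo (x (\<rho> n)) e)" for e
  have \<rho>: "filterlim \<rho> at_top sequentially"
    unfolding \<rho>_def by (rule filterlim_compose[OF filterlim_real_sequentially filterlim_subseq[OF r(1)]])
  have P: "(\<lambda>n. flow (x (\<rho> n)) e) \<longlonglongrightarrow> P e" if "e \<in> ?E" for e
    using r(2)[of "Inl (Inl e)"] that unfolding z_def P_def \<rho>_def by (simp add: convergent_LIMSEQ_iff InlI InrI)
  have \<psi>: "(\<lambda>n. psi (x (\<rho> n)) i) \<longlonglongrightarrow> \<psi> i" if "i \<in> ?N" for i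
    using r(2)[of "Inl (Inr i)"] that unfolding z_def \<psi>_def \<rho>_def by (simp add: convergent_LIMSEQ_iff InlI InrI)
  have p: "(\<lambda>n. sigma_up (x (\<rho> n)) e) \<longlonglongrightarrow> p e" if "e \<in> ?F" for e
    using r(2)[of "Inr (Inl e)"] that unfolding z_def p_def \<rho>_def by (simp add: convergent_LIMSEQ_iff InlI InrI)
  have q: "(\<lambda>n. sigma_lo (x (\<rho> n)) e) \<longlonglongrightarrow> q e" if "e \<in> ?F" for e
    using r(2)[of "Inr (Inr e)"] that unfolding z_def q_def \<rho>_def by (simp add: convergent_LIMSEQ_iff InlI InrI)
  have along: "(\<lambda>n. f (\<rho> n)) \<longlonglongrightarrow> a" if "(f \<longlongrightarrow> a) at_top" for f and a :: real
    using that \<rho> by (rule filterlim_compose)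
  have ends: "fst e \<in> ?N" "snd e \<in> ?N" if "e \<in> ?F" for e using that inner_lines_buses by auto
  have f: "angle_flow net \<psi> e = angle_flow net \<psi>' e" if e: "e \<in> ?F" for e
  proof (rule LIMSEQ_unique)
    show "(\<lambda>n. angle_flow net (psi (x (\<rho> n))) e) \<longlonglongrightarrow> angle_flow net \<psi> e"
      unfolding angle_flow_eq by (intro tendsto_intros \<psi> ends e)
    show "(\<lambda>n. angle_flow net (psi (x (\<rho> n))) e) \<longlonglongrightarrow> angle_flow net \<psi>' e"
      by (rule along[OF angle_flow_converges[OF e]])
  qed
  have \<rho>_nonneg: "\<rho> n \<ge> 0" for n by (simp add: \<rho>_def)
  have P_out: "net_outflow ?E P i = injection net i - d' i" if i: "i \<in> ?N" for i
  proof (rule LIMSEQ_unique)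
    show "(\<lambda>n. net_outflow ?E (flow (x (\<rho> n))) i) \<longlonglongrightarrow> net_outflow ?E P i"
      by (rule tendsto_net_outflow) (rule P)
    show "(\<lambda>n. net_outflow ?E (flow (x (\<rho> n))) i) \<longlonglongrightarrow> injection net i - d' i"
      by (rule along[OF outflow_converges[OF i]])
  qed
  have stationary: "net_outflow ?F (\<lambda>e. angle_flow net mu_limit e - suscept net e * (p e - q e)) i = 0"
    if i: "i \<in> ?N" for i
  proof (rule LIMSEQ_unique)
    show "(\<lambda>n. net_outflow ?F (psi_drive (x (\<rho> n))) i)
        \<longlonglongrightarrow> net_outflow ?F (\<lambda>e. angle_flow net mu_limit e - suscept net e * (p e - q e)) i"
    proof (rule tendsto_net_outflow)
      fix e assume e: "e \<in> ?F"
      show "(\<lambda>n. psi_drive (x (\<rho> n)) e) \<longlonglongrightarrow> angle_flow net mu_limit e - suscept net e * (p e - q e)"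
        unfolding angle_flow_eq
        by (intro tendsto_intros p q e along[OF mu_converges] ends)
    qed
    show "(\<lambda>n. net_outflow ?F (psi_drive (x (\<rho> n))) i) \<longlonglongrightarrow> 0"
      by (rule along[OF psi_drive_vanishes[OF i]])
  qed
  have f_out: "net_outflow ?F (angle_flow net \<psi>) i = net_outflow ?F (angle_flow net \<psi>') i" for i
    by (rule net_outflow_cong) (rule f)
  have "ROLC_saddle net c d' P \<psi> mu_limit gamma_up_limit gamma_lo_limit p q"
    unfolding ROLC_saddle_def ROLC_feasible_def
  proof (intro conjI ballI)
    fix i assume i: "i \<in> ?N"
    show "d' i = injection net i - damping net i * 0 - net_outflow ?E P i" using P_out[OF i] by simp
    show "d' i = injection net i - net_outflow ?F (angle_flow net \<psi>) i"
      unfolding f_out by (rule saddle_facts(2)[OF i])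
    show "load_min net i \<le> d' i" "d' i \<le> load_max net i" using saddle_facts[OF i] by auto
    show "0 \<le> gamma_up_limit i" "0 \<le> gamma_lo_limit i"
      "gamma_up_limit i * (d' i - load_max net i) = 0" "gamma_lo_limit i * (load_min net i - d' i) = 0"
      by (rule gamma_limits[OF i])+
    show "deriv (c i) (d' i) = mu_limit i - gamma_up_limit i + gamma_lo_limit i" by (simp add: mu_limit_def)
    show "net_outflow ?F (\<lambda>e. angle_flow net mu_limit e - suscept net e * (p e - q e)) i = 0"
      by (rule stationary[OF i])
  next
    fix e assume e: "e \<in> ?F"
    show "flow_min net e \<le> angle_flow net \<psi> e" "angle_flow net \<psi> e \<le> flow_max net e"
      using saddle_line_facts[OF e] unfolding f[OF e] by auto
    show "0 \<le> p e" by (rule LIMSEQ_le_const[OF p[OF e]]) (use sigma_nonneg[OF e \<rho>_nonneg] in auto)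
    show "0 \<le> q e" by (rule LIMSEQ_le_const[OF q[OF e]]) (use sigma_nonneg[OF e \<rho>_nonneg] in auto)
    show "p e * (angle_flow net \<psi> e - flow_max net e) = 0"
    proof (cases "angle_flow net \<psi>' e < flow_max net e")
      case True
      then have "p e = 0" by (rule LIMSEQ_unique[OF p[OF e] along[OF sigma_limits(1)[OF e]]])
      then show ?thesis by simp
    next
      case False
      then show ?thesis using saddle_line_facts(2)[OF e] f[OF e] by simp
    qed
    show "q e * (flow_min net e - angle_flow net \<psi> e) = 0"
    proof (cases "flow_min net e < angle_flow net \<psi>' e")
      case True
      then have "q e = 0" by (rule LIMSEQ_unique[OF q[OF e] along[OF sigma_limits(2)[OF e]]])
      then show ?thesis by simp
    next
      case False
      then show ?thesis using saddle_line_facts(1)[OF e] f[OF e] by simp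
    qed
  qed
  then show thesis using that[of \<rho> P \<psi> p q] \<rho> P \<psi> p q by blast
qed

text \<open>
  The energy is applied a second time, now relative to the saddle point found in the limit.
\<close>

lemma trajectory_converges:
  obtains s where "converges_to net x s" "load s = d'" "freq s = (\<lambda>i. 0)"
    "ROLC_feasible net (load s) (freq s) (flow s) (psi s)"
proof -
  obtain \<rho> P \<psi> p q where \<rho>: "filterlim \<rho> at_top sequentially"
    and lims: "\<And>e. e \<in> lines net \<Longrightarrow> (\<lambda>n. flow (x (\<rho> n)) e) \<longlonglongrightarrow> P e"
    "\<And>i. i \<in> buses net \<Longrightarrow> (\<lambda>n. psi (x (\<rho> n)) i) \<longlonglongrightarrow> \<psi> i"
    "\<And>e. e \<in> inner_lines net \<Longrightarrow> (\<lambda>n. sigma_up (x (\<rho> n)) e) \<longlonglongrightarrow> p e"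
    "\<And>e. e \<in> inner_lines net \<Longrightarrow> (\<lambda>n. sigma_lo (x (\<rho> n)) e) \<longlonglongrightarrow> q e"
    and limit_saddle: "ROLC_saddle net c d' P \<psi> mu_limit gamma_up_limit gamma_lo_limit p q"
    by (rule limit_point_saddle) (rule that)
  interpret limit: phased_reference net ctrl c u l \<delta>a x d' P \<psi> mu_limit gamma_up_limit gamma_lo_limit p q \<Theta> C\<^sub>\<Theta>
    by unfold_locales (use limit_saddle rate_phase phase_le in auto)
  have along: "(\<lambda>n. f (\<rho> n)) \<longlonglongrightarrow> a" if "(f \<longlongrightarrow> a) at_top" for f and a :: real
    using that \<rho> by (rule filterlim_compose)
  obtain B where B: "\<And>i t. i \<in> buses net \<Longrightarrow> t \<ge> 0 \<Longrightarrow> \<bar>\<Theta> i t\<bar> \<le> B" by (rule bounded_phase) (rule that)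
  have V: "(limit.V \<longlongrightarrow> 0) at_top"
  proof (rule limit.energy_vanishes[OF B _ \<rho>])
    fix i assume i: "i \<in> buses net"
    have "((\<lambda>t. (gamma_up (x t) i - gamma_up_limit i) - (gamma_lo (x t) i - gamma_lo_limit i)) \<longlongrightarrow>
        (gamma_up_limit i - gamma_up_limit i) - (gamma_lo_limit i - gamma_lo_limit i)) at_top"
      by (intro tendsto_intros gamma_limits i)
    then show "((\<lambda>t. limit.gamma_gap t i) \<longlongrightarrow> 0) at_top" by simp
  next
    show "(\<lambda>n. limit.V (\<rho> n)) \<longlonglongrightarrow> 0"
      unfolding energy_def
      by (intro tendsto_add_zero tendsto_null_sum tendsto_weighted_square lims
          along[OF freq_load_converge(1)[OF gens_buses]] along[OF mu_converges] along[OF gamma_limits(1)]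
          along[OF gamma_limits(2)])
  qed
  define s where "s = \<lparr>load = d', freq = \<lambda>i. 0, flow = P, psi = \<psi>, gamma_up = gamma_up_limit,
    gamma_lo = gamma_lo_limit,
    rvar = \<lambda>i. gain ctrl i / eps_mu ctrl i * mu_limit i, sigma_up = p, sigma_lo = q\<rparr>"
  show thesis
  proof (rule that[of s])
    show "load s = d'" "freq s = (\<lambda>i. 0)" by (simp_all add: s_def)
    show "ROLC_feasible net (load s) (freq s) (flow s) (psi s)"
      using limit_saddle by (simp add: s_def ROLC_saddle_def)
    have r: "((\<lambda>t. rvar (x t) i) \<longlongrightarrow> gain ctrl i / eps_mu ctrl i * mu_limit i) at_top" if i: "i \<in> buses net" for i
    proof -
      have "((\<lambda>t. if i \<in> gens net then freq (x t) i else 0) \<longlongrightarrow> 0) at_top"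
        using freq_load_converge(1)[OF i] by (cases "i \<in> gens net") simp_all
      then have "((\<lambda>t. gain ctrl i / eps_mu ctrl i * mu net ctrl (x t) i
          - gain ctrl i / eps_omega net i * (if i \<in> gens net then freq (x t) i else 0))
        \<longlongrightarrow> gain ctrl i / eps_mu ctrl i * mu_limit i - gain ctrl i / eps_omega net i * 0) at_top"
        by (intro tendsto_intros mu_converges i)
      then show ?thesis unfolding rvar_eq[OF i] by simp
    qed
    show "converges_to net x s"
      unfolding converges_to_def s_def state.simps
    proof (intro conjI ballI)
      fix i assume i: "i \<in> buses net"
      show "((\<lambda>t. load (x t) i) \<longlongrightarrow> d' i) at_top" "((\<lambda>t. freq (x t) i) \<longlongrightarrow> 0) at_top"
        by (rule freq_load_converge[OF i])+
      show "((\<lambda>t. psi (x t) i) \<longlongrightarrow> \<psi> i) at_top"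
        by (rule tendsto_of_weighted_square[OF energy_ge(4)[OF i] weights_pos(4)[OF i] V])
      show "((\<lambda>t. gamma_up (x t) i) \<longlongrightarrow> gamma_up_limit i) at_top"
        "((\<lambda>t. gamma_lo (x t) i) \<longlongrightarrow> gamma_lo_limit i) at_top"
        by (rule gamma_limits[OF i])+
      show "((\<lambda>t. rvar (x t) i) \<longlongrightarrow> gain ctrl i / eps_mu ctrl i * mu_limit i) at_top" by (rule r[OF i])
    next
      fix e assume e: "e \<in> lines net"
      show "((\<lambda>t. flow (x t) e) \<longlongrightarrow> P e) at_top"
        by (rule tendsto_of_weighted_square[OF energy_ge(2)[OF e] weights_pos(2)[OF e] V])
    next
      fix e assume e: "e \<in> inner_lines net"
      show "((\<lambda>t. sigma_up (x t) e) \<longlongrightarrow> p e) at_top"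
        by (rule tendsto_of_weighted_square[OF energy_ge(7)[OF e] weights_pos(7)[OF e] V])
      show "((\<lambda>t. sigma_lo (x t) e) \<longlongrightarrow> q e) at_top"
        by (rule tendsto_of_weighted_square[OF energy_ge(8)[OF e] weights_pos(8)[OF e] V])
    qed
  qed
qed

end

text \<open>
  Every feasible point of (R-OLC) projects to one of (OLC), and the frequency cost is nonnegative and
  zero at zero frequency.
\<close>

lemma (in power_network) ROLC_optimal_of_OLC_minimum:
  assumes feas: "ROLC_feasible net d (\<lambda>i. 0) P \<psi>"
    and opt: "\<And>d' \<theta>. OLC_feasible net d' \<theta> \<Longrightarrow> (\<Sum>i\<in>buses net. c i (d i)) \<le> (\<Sum>i\<in>buses net. c i (d' i))"
  shows "ROLC_optimal net c d (\<lambda>i. 0) P \<psi>"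
proof -
  have "ROLC_cost net c d (\<lambda>i. 0) \<le> ROLC_cost net c d' \<omega>'" if "ROLC_feasible net d' \<omega>' P' \<psi>'" for d' \<omega>' P' \<psi>'
  proof -
    have "OLC_feasible net d' \<psi>'"
      using that unfolding ROLC_feasible_def OLC_feasible_def by blast
    then have "(\<Sum>i\<in>buses net. c i (d i)) \<le> (\<Sum>i\<in>buses net. c i (d' i))" by (rule opt)
    moreover have "0 \<le> (\<Sum>i\<in>buses net. 1 / 2 * damping net i * (\<omega>' i)\<^sup>2)"
      using damping_pos by (intro sum_nonneg mult_nonneg_nonneg) (auto simp: less_imp_le)
    ultimately show ?thesis unfolding ROLC_cost_def by simp
  qed
  then show ?thesis
    using feas unfolding ROLC_optimal_def is_arg_min_def by (auto simp: not_less)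
qed

text \<open>
  The interval is the set where \<open>(a / 2 - d)\<^sup>2 < d\<^sup>2 + d D_min\<close>, and the bound only improves from
  \<open>D_min\<close> to \<open>D\<close>.
\<close>

lemma inaccuracy_admissible:
  fixes a d D D_min :: real
  assumes "d > 0" "D_min \<le> D" "D_min > 0"
    and a: "a \<in> {2 * (d - sqrt (d\<^sup>2 + d * D_min)) <..< 2 * (d + sqrt (d\<^sup>2 + d * D_min))}"
  shows "a\<^sup>2 < 4 * (D + a) * d"
proof -
  have "\<bar>a / 2 - d\<bar> < sqrt (d\<^sup>2 + d * D_min)" using a by (auto simp: abs_less_iff)
  then have "\<bar>a / 2 - d\<bar>\<^sup>2 < (sqrt (d\<^sup>2 + d * D_min))\<^sup>2" by (intro power_strict_mono) auto
  also have "\<dots> = d\<^sup>2 + d * D_min" using assms by simp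
  finally have "a\<^sup>2 < 4 * (D_min + a) * d" by (simp add: power2_eq_square field_simps)
  also have "\<dots> \<le> 4 * (D + a) * d" using assms by simp
  finally show ?thesis .
qed

theorem theorem4:
  fixes net :: "'n network" and ctrl :: "'n controller"
    and c :: "'n \<Rightarrow> real \<Rightarrow> real" and u l :: real
    and \<delta>a :: "'n \<Rightarrow> real" and d' D_min :: real
    and x :: "real \<Rightarrow> 'n state"
  assumes "power_network net" and "positive_controller net ctrl"
    and "\<exists>d \<theta>. OLC_feasible net d \<theta>"
    and "0 < u" and "u \<le> l"
    and "\<And>i s. i \<in> buses net \<Longrightarrow> c i field_differentiable (at s)"
    and "\<And>i s. i \<in> buses net \<Longrightarrow> deriv (c i) field_differentiable (at s)"
    and "\<And>i s. i \<in> buses net \<Longrightarrow> u \<le> deriv (deriv (c i)) s \<and> deriv (deriv (c i)) s \<le> l"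
    and "d' = 1 / l" and "D_min = Min (damping net ` buses net)"
    and "\<And>i. i \<in> buses net \<Longrightarrow>
           \<delta>a i \<in> {2 * (d' - sqrt (d'\<^sup>2 + d' * D_min)) <..< 2 * (d' + sqrt (d'\<^sup>2 + d' * D_min))}"
    and "NET_solution net x"
    and "fast_ALC_solution net c ctrl (\<lambda>i. damping net i + \<delta>a i) x"
    and "\<And>i t. i \<in> buses net \<Longrightarrow> t \<ge> 0 \<Longrightarrow>
           load_min net i < load (x t) i \<and> load (x t) i < load_max net i"
  shows "\<exists>s. converges_to net x s \<and> ROLC_optimal net c (load s) (freq s) (flow s) (psi s)"
proof -
  interpret power_network net by fact
  have D_min: "D_min > 0" "\<And>i. i \<in> buses net \<Longrightarrow> D_min \<le> damping net i"
    using assms(10) finite_buses buses_nonempty damping_pos by auto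
  have "d' > 0" using assms(4,5,9) by simp
  interpret closed_loop net ctrl c u l \<delta>a x
  proof unfold_locales
    show "(\<delta>a i)\<^sup>2 < 4 * (damping net i + \<delta>a i) * (1 / l)" if "i \<in> buses net" for i
      using inaccuracy_admissible[OF \<open>d' > 0\<close> D_min(2)[OF that] D_min(1) assms(11)[OF that]]
      unfolding assms(9) .
  qed (use assms in blast)+
  obtain d0 \<theta>0 where "OLC_feasible net d0 \<theta>0" using assms(3) by blast
  with cost_diff obtain d P \<psi> m gu gl su sl where saddle: "ROLC_saddle net c d P \<psi> m gu gl su sl"
    and opt: "\<And>d' \<theta>. OLC_feasible net d' \<theta> \<Longrightarrow> (\<Sum>i\<in>buses net. c i (d i)) \<le> (\<Sum>i\<in>buses net. c i (d' i))"
    by (rule ROLC_saddle_exists) (assumption, rule that)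
  obtain \<Theta> C where \<Theta>: "\<And>i. i \<in> buses net \<Longrightarrow> caratheodory_rate (\<Theta> i) (\<lambda>t. freq (x t) i)"
    "\<And>i t. i \<in> buses net \<Longrightarrow> \<bar>\<Theta> i t\<bar> \<le> C * state_size t"
    by (rule phase_exists) (rule that)
  interpret phased_reference net ctrl c u l \<delta>a x d P \<psi> m gu gl su sl \<Theta> C
    by unfold_locales (fact saddle \<Theta>)+
  obtain s where s: "converges_to net x s" "load s = d" "freq s = (\<lambda>i. 0)"
    "ROLC_feasible net (load s) (freq s) (flow s) (psi s)"
    by (rule trajectory_converges) (rule that)
  have "ROLC_optimal net c (load s) (freq s) (flow s) (psi s)"
    using s(4) opt unfolding s(2,3) by (rule ROLC_optimal_of_OLC_minimum)
  then show ?thesis using s(1) by blast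
qed

end
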